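(* Let $X$ be a Banach space and let $\Gamma:[0,1]\to cwk(X)$ be a multifunction. Then the following conditions are equivalent: (i) $\Gamma$ is $\mathcal{H}$-integrable; (ii) $\mathcal{S}_{\mathcal{H}}(\Gamma)\neq\emptyset$ and for every $f\in\mathcal{S}_{\mathcal{H}}(\Gamma)$ the multifunction $\Gamma-f$ is Birkhoff integrable; (iii) there exists $f\in\mathcal{S}_{\mathcal{H}}(\Gamma)$ such that the multifunction $\Gamma-f$ is Birkhoff integrable.
   Context: $X$ is an arbitrary (not necessarily separable) real Banach space and $cwk(X)$ is the family of all non-empty convex weakly compact subsets of $X$, with Minkowski addition, multiplication by positive scalars, and the Hausdorff distance $d_H$. A multifunction is a map $\Gamma:[0,1]\to cwk(X)$; a selection of $\Gamma$ is a function $f:[0,1]\to X$ with $f(t)\in\Gamma(t)$ for every $t\in[0,1]$. For a function $f$, $(\Gamma-f)(t)=\{x-f(t):x\in\Gamma(t)\}$. $\lambda$ is Lebesgue measure on $[0,1]$ and $\mathcal{L}$ the family of Lebesgue measurable subsets of $[0,1]$. A gauge is any strictly positive function $\delta$ on $[0,1]$. A Perron partition of $[0,1]$ is a finite collection $\{(I_1,t_1),\dots,(I_p,t_p)\}$ of nonoverlapping closed subintervals $I_i$ with union $[0,1]$ and points $t_i\in I_i$; it is $\delta$-fine if $I_i\subset(t_i-\delta(t_i),t_i+\delta(t_i))$ for all $i$. $\Gamma$ is $\mathcal{H}$-integrable on $[0,1]$ if there is $\Phi_\Gamma([0,1])\in cwk(X)$ such that for every $\varepsilon>0$ there is a Lebesgue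 measurable gauge $\delta$ with $d_H\big(\Phi_\Gamma([0,1]),\sum_{i=1}^p\Gamma(t_i)|I_i|\big)<\varepsilon$ for every $\delta$-fine Perron partition of $[0,1]$. $\Gamma$ is Birkhoff integrable on $[0,1]$ if there is $\Phi_\Gamma([0,1])\in cwk(X)$ such that for every $\varepsilon>0$ there is a countable partition $\mathcal{P}_0$ of $[0,1]$ into sets of $\mathcal{L}$ such that for every countable partition $(A_n)_n$ of $[0,1]$ into sets of $\mathcal{L}$ finer than $\mathcal{P}_0$ and any choice of $t_n\in A_n$, the series $\sum_n\lambda(A_n)\Gamma(t_n)$ is unconditionally convergent (in the Hausdorff metric) and $d_H\big(\Phi_\Gamma([0,1]),\sum_n\Gamma(t_n)\lambda(A_n)\big)<\varepsilon$ (empty sets $A_n$ are allowed and contribute nothing). For functions $f:[0,1]\to X$ these notions are applied to $t\mapsto\{f(t)\}$ (with integral in $X$ and norm distance). $\mathcal{S}_{\mathcal{H}}(\Gamma)$ is the set of $\mathcal{H}$-integrable selections of $\Gamma$. *)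

theory Defs
  imports "HOL-Analysis.Analysis"
begin

text \<open>
  Multifunctions and selections on the unit interval are total functions on the reals;
  their values outside \<open>{0..1}\<close> never enter the definitions below.  Minkowski sums are the
  operations \<open>+\<close> and \<open>\<Sum>\<close> on sets from \<open>HOL-Library.Set_Algebras\<close>.
\<close>

definition weak_topology :: "'a::real_normed_vector topology" where
  "weak_topology =
     topology_generated_by {blinfun_apply \<phi> -` U | (\<phi> :: 'a \<Rightarrow>\<^sub>L real) U. open U}"

definition cwk :: "'a::real_normed_vector set set" where
  "cwk = {K. K \<noteq> {} \<and> convex K \<and> compactin weak_topology K}"

text \<open>Only meaningful on non-empty bounded sets; all members of \<open>cwk\<close> are such sets.\<close>

definition hausdorff_distance :: "'a::metric_space set \<Rightarrow> 'a set \<Rightarrow> real" where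
  "hausdorff_distance A B = max (SUP a\<in>A. infdist a B) (SUP b\<in>B. infdist b A)"

subsection \<open>The \<open>\<H>\<close>-integral\<close>

definition measurable_gauge :: "(real \<Rightarrow> real) \<Rightarrow> bool" where
  "measurable_gauge \<delta> \<longleftrightarrow>
     (\<forall>t\<in>{0..1}. 0 < \<delta> t) \<and> \<delta> \<in> borel_measurable (lebesgue_on {0..1})"

text \<open>
  A tagged division may contain degenerate intervals; they have length \<open>0\<close> and
  contribute the neutral element \<open>{0}\<close> to the sum.
\<close>

definition has_H_integral :: "(real \<Rightarrow> 'a::real_normed_vector set) \<Rightarrow> 'a set \<Rightarrow> bool" where
  "has_H_integral \<Gamma> \<Phi> \<longleftrightarrow>
     (\<forall>\<epsilon>>0. \<exists>\<delta>. measurable_gauge \<delta> \<and>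
        (\<forall>p. p tagged_division_of {0..1} \<and> (\<lambda>t. {t - \<delta> t<..<t + \<delta> t}) fine p \<longrightarrow>
             hausdorff_distance \<Phi> (\<Sum>(t, I)\<in>p. (*\<^sub>R) (measure lborel I) ` \<Gamma> t) < \<epsilon>))"

definition H_integrable :: "(real \<Rightarrow> 'a::real_normed_vector set) \<Rightarrow> bool" where
  "H_integrable \<Gamma> \<longleftrightarrow> (\<exists>\<Phi>\<in>cwk. has_H_integral \<Gamma> \<Phi>)"

definition H_integrable_fun :: "(real \<Rightarrow> 'a::real_normed_vector) \<Rightarrow> bool" where
  "H_integrable_fun f \<longleftrightarrow> (\<exists>x. has_H_integral (\<lambda>t. {f t}) {x})"

lemma hausdorff_distance_singletons [simp]: "hausdorff_distance {x} {y} = dist x y"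
  by (simp add: hausdorff_distance_def dist_commute)

lemma sum_singletons: "finite S \<Longrightarrow> (\<Sum>i\<in>S. {g i}) = {\<Sum>i\<in>S. g i :: 'a::comm_monoid_add}"
  by (induction S rule: finite_induct) (auto simp: set_plus_def)

lemma H_integrable_fun_iff:
  "H_integrable_fun f \<longleftrightarrow>
     (\<exists>x. \<forall>\<epsilon>>0. \<exists>\<delta>. measurable_gauge \<delta> \<and>
        (\<forall>p. p tagged_division_of {0..1} \<and> (\<lambda>t. {t - \<delta> t<..<t + \<delta> t}) fine p \<longrightarrow>
             norm (x - (\<Sum>(t, I)\<in>p. measure lborel I *\<^sub>R f t)) < \<epsilon>))"
proof -
  have "hausdorff_distance {x} (\<Sum>(t, I)\<in>p. (*\<^sub>R) (measure lborel I) ` {f t}) =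
        norm (x - (\<Sum>(t, I)\<in>p. measure lborel I *\<^sub>R f t))"
    if "p tagged_division_of {0..1}" for p and x
    using sum_singletons[of p "\<lambda>(t, I). measure lborel I *\<^sub>R f t"] tagged_division_of_finite[OF that]
    by (simp add: case_prod_unfold dist_norm)
  then show ?thesis
    unfolding H_integrable_fun_def has_H_integral_def
    by (simp cong: conj_cong)
qed

definition H_selections :: "(real \<Rightarrow> 'a::real_normed_vector set) \<Rightarrow> (real \<Rightarrow> 'a) set" where
  "H_selections \<Gamma> = {f. (\<forall>t\<in>{0..1}. f t \<in> \<Gamma> t) \<and> H_integrable_fun f}"

definition translate_by :: "(real \<Rightarrow> 'a::real_normed_vector set) \<Rightarrow> (real \<Rightarrow> 'a) \<Rightarrow> real \<Rightarrow> 'a set" where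
  "translate_by \<Gamma> f = (\<lambda>t. {x - f t | x. x \<in> \<Gamma> t})"

subsection \<open>The Birkhoff integral\<close>

text \<open>Finite partitions are covered because some of the sets may be empty.\<close>

definition countable_partition :: "(nat \<Rightarrow> real set) \<Rightarrow> bool" where
  "countable_partition A \<longleftrightarrow>
     (\<forall>n. A n \<in> sets lebesgue) \<and> disjoint_family A \<and> (\<Union>n. A n) = {0..1}"

definition finer :: "(nat \<Rightarrow> real set) \<Rightarrow> (nat \<Rightarrow> real set) \<Rightarrow> bool" where
  "finer A P \<longleftrightarrow> (\<forall>n. \<exists>m. A n \<subseteq> P m)"

definition set_sums :: "(nat \<Rightarrow> 'a::real_normed_vector set) \<Rightarrow> 'a set \<Rightarrow> bool" where
  "set_sums B S \<longleftrightarrow> S \<in> cwk \<and> (\<lambda>N. hausdorff_distance (\<Sum>n<N. B n) S) \<longlonglongrightarrow> 0"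

definition unconditionally_convergent :: "(nat \<Rightarrow> 'a::real_normed_vector set) \<Rightarrow> bool" where
  "unconditionally_convergent B \<longleftrightarrow> (\<forall>\<pi>. bij \<pi> \<longrightarrow> (\<exists>S. set_sums (B \<circ> \<pi>) S))"

text \<open>An empty partition set has no tag and contributes the neutral element \<open>{0}\<close>.\<close>

definition birkhoff_term ::
    "(real \<Rightarrow> 'a::real_normed_vector set) \<Rightarrow> (nat \<Rightarrow> real set) \<Rightarrow> (nat \<Rightarrow> real) \<Rightarrow> nat \<Rightarrow> 'a set" where
  "birkhoff_term \<Gamma> A t n = (if A n = {} then {0} else (*\<^sub>R) (measure lebesgue (A n)) ` \<Gamma> (t n))"

definition has_birkhoff_integral :: "(real \<Rightarrow> 'a::real_normed_vector set) \<Rightarrow> 'a set \<Rightarrow> bool" where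
  "has_birkhoff_integral \<Gamma> \<Phi> \<longleftrightarrow>
     (\<forall>\<epsilon>>0. \<exists>P. countable_partition P \<and>
        (\<forall>A t. countable_partition A \<and> finer A P \<and> (\<forall>n. A n \<noteq> {} \<longrightarrow> t n \<in> A n) \<longrightarrow>
           unconditionally_convergent (birkhoff_term \<Gamma> A t) \<and>
           (\<exists>S. set_sums (birkhoff_term \<Gamma> A t) S \<and> hausdorff_distance \<Phi> S < \<epsilon>)))"

definition birkhoff_integrable :: "(real \<Rightarrow> 'a::real_normed_vector set) \<Rightarrow> bool" where
  "birkhoff_integrable \<Gamma> \<longleftrightarrow> (\<exists>\<Phi>\<in>cwk. has_birkhoff_integral \<Gamma> \<Phi>)"

end

(*
  Everything is read off support functions: the Hausdorff distance of bounded convex sets is the uniform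
  distance of their support functions on the dual unit ball, and by Hahn--Banach a sublinear functional on
  the dual is the support function of a set in cwk exactly when all its linear minorants are evaluations.

  Selection: weakly compact convex sets are dentable, so by Baire's theorem the integral of Gamma is strongly
  exposed by some functional; a selection of maximizers of that functional has Riemann sums converging to the
  exposed point.

  After subtracting an integrable selection f, all sets contain 0 and all support functions are non-negative.
  H => Birkhoff: on a set where a measurable gauge exceeds the mesh of a grid, two points of one cell may tag the
  same interval, so Henstock's lemma bounds the oscillation there, uniformly in the functional; levels with
  finer and finer gauges exhaust the interval up to a null set.  That the tails of the resulting series are
  uniformly small is an Orlicz--Pettis argument inside the weakly compact integral.
  Birkhoff => H: exchanging tags in one fixed partition bounds the oscillation on its pieces; the gauge is the
  distance to the complement of an open set slightly larger than the piece.
*)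
theory Submission
  imports Defs
begin

subsection \<open>The Hahn--Banach theorem\<close>

text \<open>The obstacle is uniformity over the dual ball without separability: for each functional
  the real function \<open>supp (\<Gamma> t) \<phi>\<close> of \<open>t\<close> is Henstock-Kurzweil
  integrable, but no exceptional null set common to all functionals comes with that. So gauges,
  partitions and bounds on pieces are fixed before the functional; only the oscillation bounds taken
  from the real-valued theory may vary with it. Both directions get these bounds by one trick: of
  two choices of tags, collect the larger values in one sum and the smaller values in another; if
  both sums are close to the same number, the sum of all absolute differences is small. Weak
  compactness of an infinite sum is not checked on sets: a linear minorant of a sum splits into
  minorants of the summands, which makes being represented by evaluations stable under sums and
  uniform limits. Non-negative support functions make every series monotone, so one term is bounded
  by the total and a tail by what is missing from a partial sum.\<close>

definition sublinear :: "('a::real_vector \<Rightarrow> real) \<Rightarrow> bool" where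
  "sublinear p \<longleftrightarrow> (\<forall>x y. p (x + y) \<le> p x + p y) \<and> (\<forall>c x. 0 \<le> c \<longrightarrow> p (c *\<^sub>R x) = c * p x)"

lemma sublinear_add: "sublinear p \<Longrightarrow> p (x + y) \<le> p x + p y"
  and sublinear_scale: "sublinear p \<Longrightarrow> 0 \<le> c \<Longrightarrow> p (c *\<^sub>R x) = c * p x"
  by (auto simp: sublinear_def)

lemma sublinear_zero: "sublinear p \<Longrightarrow> p 0 = 0"
  using sublinear_scale[of p 0 0] by simp

lemma sublinear_minus_ge: "sublinear p \<Longrightarrow> - p (- x) \<le> p x"
  using sublinear_add[of p x "- x"] sublinear_zero[of p] by simp

text \<open>One inequality is enough: used with the factor \<open>inverse c\<close> at
  \<open>c *\<^sub>R x\<close> it yields the reverse one.\<close>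

lemma sublinearI:
  assumes add: "\<And>x y. p (x + y) \<le> p x + p y" and zero: "p 0 = 0"
    and scale: "\<And>c x. 0 < c \<Longrightarrow> p (c *\<^sub>R x) \<le> c * p x"
  shows "sublinear p"
proof -
  have "p (c *\<^sub>R x) = c * p x" if "0 \<le> c" for c x
  proof (cases "c = 0")
    case False
    then have c: "0 < c" using that by simp
    have "p x = p (inverse c *\<^sub>R (c *\<^sub>R x))" using c by simp
    also have "\<dots> \<le> inverse c * p (c *\<^sub>R x)" using c by (intro scale) simp
    finally have "c * p x \<le> p (c *\<^sub>R x)" using c by (simp add: field_simps)
    with scale[OF c, of x] show ?thesis by simp
  qed (simp add: zero)
  with add show ?thesis by (auto simp: sublinear_def)
qed

text \<open>Lowering \<open>p\<close> along the cone spanned by \<open>C\<close> forces every linear minorant to be at least \<open>d\<close> on \<open>C\<close>.\<close>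

lemma sublinear_lower:
  fixes p :: "'a::real_vector \<Rightarrow> real"
  assumes p: "sublinear p" and C: "convex C" "C \<noteq> {}" and d: "\<And>c. c \<in> C \<Longrightarrow> d \<le> p c"
  obtains q where "sublinear q" "\<And>x. q x \<le> p x" "\<And>c. c \<in> C \<Longrightarrow> q (- c) \<le> - d"
proof -
  \<comment> \<open>The usual Hahn-Banach infimum of \<open>p (x + s *\<^sub>R c) - s * d\<close>
    over \<open>c \<in> C\<close> and \<open>s \<ge> 0\<close>: taking \<open>s = 0\<close> gives
    \<open>q x \<le> p x\<close>, and \<open>s = 1\<close> at \<open>- c\<close> gives the bound on
    the negatives of \<open>C\<close>.\<close>
  define W where "W = C \<times> {0::real..}"
  define h where "h x w = p (x + snd w *\<^sub>R fst w) - snd w * d" for x w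
  define q where "q x = (INF w\<in>W. h x w)" for x
  have W: "W \<noteq> {}" using C by (auto simp: W_def)
  \<comment> \<open>This is what \<open>d \<le> p c\<close> buys: a finite infimum. The term
    \<open>p (- x)\<close> absorbs \<open>x\<close>, and what is left is non-negative.\<close>
  have lb: "- p (- x) \<le> h x w" if "w \<in> W" for x w
  proof -
    have "snd w * d \<le> p (snd w *\<^sub>R fst w)"
      using that d[of "fst w"] sublinear_scale[OF p, of "snd w"] by (auto simp: W_def intro: mult_left_mono)
    also have "\<dots> \<le> p (x + snd w *\<^sub>R fst w) + p (- x)"
      using sublinear_add[OF p, of "x + snd w *\<^sub>R fst w" "- x"] by (simp add: algebra_simps)
    finally show ?thesis by (simp add: h_def)
  qed
  have bdd: "bdd_below (h x ` W)" for x
    using lb by (intro bdd_belowI2)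
  have le: "q x \<le> h x w" if "w \<in> W" for x w
    unfolding q_def by (rule cINF_lower[OF bdd that])
  have qp: "q x \<le> p x" for x
    using C(2) le[of "(_, 0)" x] by (auto simp: W_def h_def)
  have q0: "q 0 = 0"
  proof (rule antisym)
    show "q 0 \<le> 0" using qp[of 0] sublinear_zero[OF p] by simp
    show "0 \<le> q 0" unfolding q_def
      using lb[of _ 0] sublinear_zero[OF p] by (intro cINF_greatest[OF W]) auto
  qed
  \<comment> \<open>Convexity of \<open>C\<close> merges
    \<open>t *\<^sub>R c + t' *\<^sub>R c'\<close> into one multiple
    \<open>(t + t') *\<^sub>R c''\<close>; this makes the infimum subadditive.\<close>
  have h_add: "\<exists>w''\<in>W. h (x + y) w'' \<le> h x w + h y w'" if w: "w \<in> W" "w' \<in> W" for x y w w'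
  proof -
    obtain c t c' t' where ww: "w = (c, t)" "w' = (c', t')" by (cases w, cases w') auto
    have in_C: "c \<in> C" "c' \<in> C" and t: "0 \<le> t" "0 \<le> t'" using w by (auto simp: ww W_def)
    obtain c'' where c'': "c'' \<in> C" "(t + t') *\<^sub>R c'' = t *\<^sub>R c + t' *\<^sub>R c'"
    proof (cases "t + t' = 0")
      case True
      then show ?thesis using t in_C that[of c] by (simp add: add_nonneg_eq_0_iff)
    next
      case False
      then have pos: "0 < t + t'" using t by simp
      have "(t / (t + t')) *\<^sub>R c + (t' / (t + t')) *\<^sub>R c' \<in> C"
        using pos t in_C by (intro convexD[OF C(1)]) (auto simp: add_divide_distrib[symmetric])
      then show ?thesis using pos by (intro that) (auto simp: scaleR_add_right)
    qed
    have "p (x + y + (t + t') *\<^sub>R c'') \<le> p (x + t *\<^sub>R c) + p (y + t' *\<^sub>R c')"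
      using sublinear_add[OF p, of "x + t *\<^sub>R c" "y + t' *\<^sub>R c'"] by (simp add: c'' add.assoc add.left_commute)
    then have "h (x + y) (c'', t + t') \<le> h x w + h y w'"
      by (simp add: h_def ww algebra_simps)
    moreover have "(c'', t + t') \<in> W" using c'' t by (auto simp: W_def)
    ultimately show ?thesis by blast
  qed
  have "q (x + y) \<le> q x + q y" for x y
  proof -
    have "q (x + y) - h x w \<le> h y w'" if "w \<in> W" "w' \<in> W" for w w'
      using h_add[OF that, of x y] le[of _ "x + y"] by force
    then have "q (x + y) - h x w \<le> q y" if "w \<in> W" for w
      unfolding q_def[of y] using that by (intro cINF_greatest[OF W]) auto
    then have "q (x + y) - q y \<le> h x w" if "w \<in> W" for w
      using that by (auto simp: algebra_simps)
    then have "q (x + y) - q y \<le> q x"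
      unfolding q_def[of x] by (intro cINF_greatest[OF W]) auto
    then show ?thesis by simp
  qed
  moreover have "q (s *\<^sub>R x) \<le> s * q x" if s: "0 < s" for s x
  proof -
    have "q (s *\<^sub>R x) / s \<le> h x w" if w: "w \<in> W" for w
    proof -
      obtain c t where ct: "w = (c, t)" "c \<in> C" "0 \<le> t" using w unfolding W_def by (cases w) auto
      have "q (s *\<^sub>R x) \<le> h (s *\<^sub>R x) (c, s * t)"
        using ct s by (intro le) (auto simp: W_def)
      also have "\<dots> = s * h x w"
        using sublinear_scale[OF p, of s "x + t *\<^sub>R c"] s by (simp add: h_def ct algebra_simps)
      finally show ?thesis using s by (simp add: field_simps)
    qed
    then have "q (s *\<^sub>R x) / s \<le> q x"
      unfolding q_def[of x] by (intro cINF_greatest[OF W])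
    then show ?thesis using s by (simp add: field_simps)
  qed
  ultimately have "sublinear q" using q0 by (intro sublinearI) auto
  moreover have "q (- c) \<le> - d" if "c \<in> C" for c
    using le[of "(c, 1)" "- c"] that sublinear_zero[OF p] by (auto simp: W_def h_def)
  ultimately show ?thesis using qp by (intro that[of q])
qed

text \<open>Zorn's lemma gives a minimal sublinear functional below \<open>p\<close>. It is linear:
  lowering it along a single ray changes nothing, which forces oddness, and an odd subadditive
  function is additive.\<close>

theorem sublinear_dominates_linear:
  fixes p :: "'a::real_vector \<Rightarrow> real"
  assumes p: "sublinear p"
  obtains \<xi> where "linear \<xi>" "\<And>x. \<xi> x \<le> p x"
proof -
  define A where "A = {f. sublinear f \<and> (\<forall>x. f x \<le> p x)}"
  have "\<exists>m\<in>A. \<forall>a\<in>A. (\<forall>x. a x \<le> m x) \<longrightarrow> a = m"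
  \<comment> \<open>The order is reversed, so that the maximal element of Zorn's lemma is a minimal
    functional.\<close>
  proof (rule predicate_Zorn[where P = "\<lambda>f g. \<forall>x. g x \<le> f x"])
    show "partial_order_on A (relation_of (\<lambda>f g. \<forall>x. g x \<le> f x) A)"
      by (rule partial_order_on_relation_ofI) (blast intro: order_refl order_trans ext antisym)+
  next
    fix C assume C: "C \<in> Chains (relation_of (\<lambda>f g. \<forall>x. g x \<le> f x) A)"
    then have CA: "C \<subseteq> A" and
      tot: "\<And>f g. f \<in> C \<Longrightarrow> g \<in> C \<Longrightarrow> (\<forall>x. g x \<le> f x) \<or> (\<forall>x. f x \<le> g x)"
      by (auto simp: Chains_def relation_of_def)
    show "\<exists>u\<in>A. \<forall>a\<in>C. \<forall>x. u x \<le> a x"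
    proof (cases "C = {}")
      case True
      then show ?thesis using p by (auto simp: A_def)
    next
      case False
      define u where "u x = (INF f\<in>C. f x)" for x
      have lb: "- p (- x) \<le> f x" if "f \<in> C" for f x
      proof -
        have "f \<in> A" using that CA by blast
        then have "- f (- x) \<le> f x" "f (- x) \<le> p (- x)"
          using sublinear_minus_ge[of f x] by (auto simp: A_def)
        then show ?thesis by linarith
      qed
      then have bdd: "bdd_below ((\<lambda>f. f x) ` C)" for x
        by (intro bdd_belowI2)
      have le: "u x \<le> f x" if "f \<in> C" for f x
        unfolding u_def by (rule cINF_lower[OF bdd that])
      have sub: "sublinear f" if "f \<in> C" for f using that CA by (auto simp: A_def)
      have "sublinear u"
      proof (rule sublinearI)
        fix x y
        have fg_le: "u (x + y) \<le> f x + g y" if fg: "f \<in> C" "g \<in> C" for f g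
        proof -
          \<comment> \<open>In a chain the smaller of \<open>f\<close> and \<open>g\<close> serves
            at both points, which is all that subadditivity of the infimum needs.\<close>
          obtain k where "k \<in> C" "k x \<le> f x" "k y \<le> g y"
            using tot[OF fg] fg by auto
          then show ?thesis
            using le[of k "x + y"] sublinear_add[OF sub, of k x y] by linarith
        qed
        have "u (x + y) - f x \<le> u y" if "f \<in> C" for f
          unfolding u_def[of y] using fg_le[OF that] False by (intro cINF_greatest) (auto simp: diff_le_eq add.commute)
        then have "u (x + y) - u y \<le> u x"
          unfolding u_def[of x] using False by (intro cINF_greatest) (auto simp: algebra_simps)
        then show "u (x + y) \<le> u x + u y" by simp
      next
        show "u 0 = 0" 
        proof -
          have "(\<lambda>f. f 0) ` C = {0}" 
          proof -
            have "(\<lambda>f. f 0) ` C = (\<lambda>f. 0) ` C"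
              by (rule image_cong[OF refl]) (rule sublinear_zero[OF sub])
            then show ?thesis using False by (simp add: image_constant_conv)
          qed
          then show ?thesis by (simp add: u_def)
        qed
      next
        fix c :: real and x assume c: "0 < c"
        have "u (c *\<^sub>R x) / c \<le> f x" if "f \<in> C" for f
          using le[OF that, of "c *\<^sub>R x"] sublinear_scale[OF sub[OF that], of c x] c
          by (simp add: field_simps)
        then have "u (c *\<^sub>R x) / c \<le> u x"
          unfolding u_def[of x] using False by (intro cINF_greatest)
        then show "u (c *\<^sub>R x) \<le> c * u x" using c by (simp add: field_simps)
      qed
      moreover have "u x \<le> p x" for x

      proof -
        obtain f where f: "f \<in> C" using False by blast
        then have "f x \<le> p x" using CA by (auto simp: A_def)
        with le[OF f, of x] show ?thesis by simp
      qed
      ultimately show ?thesis using le by (auto simp: A_def)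
    qed
  qed
  then obtain f where fA: "f \<in> A" and fmin: "\<And>g. g \<in> A \<Longrightarrow> (\<And>x. g x \<le> f x) \<Longrightarrow> g = f"
    by blast
  from fA have f: "sublinear f" "\<And>x. f x \<le> p x" by (auto simp: A_def)
  have min: "g = f" if "sublinear g" "\<And>x. g x \<le> f x" for g
    using that f(2) by (intro fmin) (auto simp: A_def intro: order_trans)
  \<comment> \<open>Lowering at \<open>y\<close> with the value \<open>f y\<close> itself: by
    minimality the lowered functional is \<open>f\<close> again.\<close>
  have neg: "f (- y) = - f y" for y
  proof -
    obtain q where "sublinear q" "\<And>x. q x \<le> f x" "q (- y) \<le> - f y"
      using sublinear_lower[OF f(1), of "{y}" "f y"] by auto
    with min have "f (- y) \<le> - f y" by metis
    then show ?thesis using sublinear_minus_ge[OF f(1), of y] by simp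
  qed
  have "f (x + y) = f x + f y" for x y
    using sublinear_add[OF f(1), of x y] sublinear_add[OF f(1), of "- x" "- y"] neg[of x] neg[of y]
      neg[of "x + y"] by simp
  moreover have "f (c *\<^sub>R x) = c *\<^sub>R f x" for c x
    using sublinear_scale[OF f(1), of c x] sublinear_scale[OF f(1), of "- c" x] neg[of "c *\<^sub>R x"]
    by (cases "0 \<le> c") auto
  ultimately have "linear f" by (intro linearI)
  with f(2) show ?thesis using that by blast
qed

text \<open>Hahn-Banach in the form used throughout: with a norm for \<open>p\<close> it separates
  convex sets, and with a singleton \<open>C\<close> it yields a linear minorant touching
  \<open>p\<close> at a point. The lowered functional is at most \<open>- d\<close> at
  \<open>- c\<close>, so its linear minorants are at least \<open>d\<close> at
  \<open>c\<close>.\<close>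

theorem Mazur_Orlicz:
  fixes p :: "'a::real_vector \<Rightarrow> real"
  assumes "sublinear p" "convex C" "\<And>c. c \<in> C \<Longrightarrow> d \<le> p c"
  obtains \<xi> where "linear \<xi>" "\<And>x. \<xi> x \<le> p x" "\<And>c. c \<in> C \<Longrightarrow> d \<le> \<xi> c"
proof (cases "C = {}")
  case True
  then show ?thesis using sublinear_dominates_linear[OF assms(1)] that by auto
next
  case False
  obtain q where q: "sublinear q" "\<And>x. q x \<le> p x" "\<And>c. c \<in> C \<Longrightarrow> q (- c) \<le> - d"
    using sublinear_lower[OF assms(1,2) False assms(3)] by blast
  obtain \<xi> where \<xi>: "linear \<xi>" "\<And>x. \<xi> x \<le> q x"
    using sublinear_dominates_linear[OF q(1)] by blast
  have "d \<le> \<xi> c" if "c \<in> C" for c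
    using \<xi>(2)[of "- c"] q(3)[OF that] linear_neg[OF \<xi>(1), of c] by simp
  with \<xi> q(2) show ?thesis by (meson that order_trans)
qed

text \<open>The dual form of decomposing a point of a Minkowski sum. Both parts are found at once,
  as one functional on a product space that has to vanish on all \<open>(x, x, - \<xi> x)\<close>;
  the third coordinate carries the value to be split.\<close>

lemma linear_sandwich:
  fixes p q :: "'a::real_vector \<Rightarrow> real"
  assumes p: "sublinear p" and q: "sublinear q" and \<xi>: "linear \<xi>" "\<And>x. \<xi> x \<le> p x + q x"
  obtains \<xi>1 \<xi>2 where "linear \<xi>1" "linear \<xi>2" "\<And>x. \<xi>1 x \<le> p x" "\<And>x. \<xi>2 x \<le> q x"
    "\<And>x. \<xi> x = \<xi>1 x + \<xi>2 x"
proof -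
  define P where "P = (\<lambda>(x, y, t). p x + q y + t :: real)"
  define C where "C = range (\<lambda>x. (x, x, - \<xi> x))"
  have "sublinear P"
  proof (rule sublinearI)
    fix u v :: "'a \<times> 'a \<times> real"
    show "P (u + v) \<le> P u + P v"
      using sublinear_add[OF p, of "fst u" "fst v"] sublinear_add[OF q, of "fst (snd u)" "fst (snd v)"]
      by (auto simp: P_def case_prod_unfold)
  qed (auto simp: P_def sublinear_zero[OF p] sublinear_zero[OF q] sublinear_scale[OF p]
      sublinear_scale[OF q] zero_prod_def algebra_simps)
  moreover have lin: "linear (\<lambda>x. (x, x, - \<xi> x))"
    by (rule linearI) (auto simp: linear_add[OF \<xi>(1)] linear_scale[OF \<xi>(1)])
  then have "convex C"
    unfolding C_def by (intro convex_linear_image) auto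
  moreover have "0 \<le> P c" if "c \<in> C" for c
    using that \<xi>(2) by (auto simp: P_def C_def)
  ultimately obtain \<zeta> where \<zeta>: "linear \<zeta>" "\<And>u. \<zeta> u \<le> P u" "\<And>c. c \<in> C \<Longrightarrow> 0 \<le> \<zeta> c"
    using Mazur_Orlicz by blast
  \<comment> \<open>\<open>C\<close> is a subspace, so non-negativity on it means vanishing.\<close>
  have diag: "\<zeta> (x, x, - \<xi> x) = 0" for x
  proof -
    have "0 \<le> \<zeta> (x, x, - \<xi> x)" "0 \<le> \<zeta> (- x, - x, - \<xi> (- x))"
      by (auto intro!: \<zeta>(3) simp: C_def)
    moreover have "(- x, - x, - \<xi> (- x)) = - (x, x, - \<xi> x)"
      by (simp add: linear_neg[OF \<xi>(1)])
    ultimately show ?thesis using linear_neg[OF \<zeta>(1), of "(x, x, - \<xi> x)"] by simp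
  qed
  \<comment> \<open>\<open>P\<close> is linear in the third coordinate, so domination for both signs
    determines \<open>\<zeta>\<close> there.\<close>
  have "\<zeta> (0, 0, t) = t" for t
    using \<zeta>(2)[of "(0, 0, t)"] \<zeta>(2)[of "- (0, 0, t)"] linear_neg[OF \<zeta>(1), of "(0, 0, t)"]
    by (simp add: P_def sublinear_zero[OF p] sublinear_zero[OF q])
  moreover have "(x, x, - \<xi> x) = (x, 0, 0) + (0, x, 0) + (0, 0, - \<xi> x)" for x by simp
  ultimately have sum: "\<xi> x = \<zeta> (x, 0, 0) + \<zeta> (0, x, 0)" for x
    using diag[of x] linear_add[OF \<zeta>(1), of "(x, 0, 0) + (0, x, 0)" "(0, 0, - \<xi> x)"]
      linear_add[OF \<zeta>(1), of "(x, 0, 0)" "(0, x, 0)"] by simp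
  show ?thesis
  proof (rule that)
    show "linear (\<lambda>x. \<zeta> (x, 0, 0))" "linear (\<lambda>x. \<zeta> (0, x, 0))"
      by (auto intro!: linearI simp: linear_add[OF \<zeta>(1), symmetric] linear_scale[OF \<zeta>(1), symmetric]
          simp del: real_scaleR_def)
    show "\<zeta> (x, 0, 0) \<le> p x" "\<zeta> (0, x, 0) \<le> q x" for x
      using \<zeta>(2)[of "(x, 0, 0)"] \<zeta>(2)[of "(0, x, 0)"]
      by (auto simp: P_def sublinear_zero[OF p] sublinear_zero[OF q])
  qed (rule sum)
qed

section \<open>Bounded functionals and separation\<close>

lemma sublinear_norm: "0 \<le> e \<Longrightarrow> sublinear (\<lambda>x::'a::real_normed_vector. e * norm x)"
  by (rule sublinearI) (auto simp flip: distrib_left intro: mult_left_mono norm_triangle_ineq)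

lemma linear_le_norm_blinfun:
  fixes \<xi> :: "'a::real_normed_vector \<Rightarrow> real"
  assumes "linear \<xi>" "0 \<le> e" "\<And>x. \<xi> x \<le> e * norm x"
  obtains \<phi> where "\<xi> = blinfun_apply \<phi>" "norm \<phi> \<le> e"
proof -
  have abs: "norm (\<xi> x) \<le> e * norm x" for x
    using assms(3)[of x] assms(3)[of "- x"] linear_neg[OF assms(1), of x] by (auto simp: abs_le_iff)
  then have bl: "bounded_linear \<xi>"
    by (intro bounded_linear_intro[of _ e]) (simp_all add: linear_add[OF assms(1)] linear_scale[OF assms(1)] mult.commute)
  show ?thesis
  proof (rule that[of "Blinfun \<xi>"])
    show "\<xi> = blinfun_apply (Blinfun \<xi>)" using bl by (simp add: bounded_linear_Blinfun_apply)
    show "norm (Blinfun \<xi>) \<le> e"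
      using bl abs assms(2) by (intro norm_blinfun_bound) (auto simp: bounded_linear_Blinfun_apply)
  qed
qed

text \<open>All vectors \<open>a - b\<close> with \<open>b \<in> B\<close> have norm at least
  \<open>infdist a B\<close>; Mazur-Orlicz for the norm and this convex set gives a separating
  functional whose margin is the whole distance.\<close>

lemma convex_separation_infdist:
  fixes B :: "'a::real_normed_vector set"
  assumes "convex B" "B \<noteq> {}"
  obtains \<phi> :: "'a \<Rightarrow>\<^sub>L real" where "norm \<phi> \<le> 1" "\<And>b. b \<in> B \<Longrightarrow> infdist a B \<le> \<phi> a - \<phi> b"
proof -
  have "convex ((\<lambda>b. a - b) ` B)" using convex_translation[OF convex_negations[OF assms(1)], of a] by (simp add: image_image)
  moreover have "infdist a B \<le> 1 * norm c" if "c \<in> (\<lambda>b. a - b) ` B" for c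
    using that infdist_le[of _ B a] by (auto simp: dist_norm)
  ultimately obtain \<xi> where \<xi>: "linear \<xi>" "\<And>x. \<xi> x \<le> 1 * norm x"
      "\<And>c. c \<in> (\<lambda>b. a - b) ` B \<Longrightarrow> infdist a B \<le> \<xi> c"
    using Mazur_Orlicz[OF sublinear_norm[of 1]] by (metis zero_le_one)
  obtain \<phi> where "\<xi> = blinfun_apply \<phi>" "norm \<phi> \<le> 1"
    using linear_le_norm_blinfun[OF \<xi>(1) _ \<xi>(2)] by auto
  then show ?thesis using \<xi>(3) by (intro that) (force simp: blinfun.diff_right[symmetric])+
qed

lemma norming_functional:
  fixes x :: "'a::real_normed_vector"
  obtains \<phi> :: "'a \<Rightarrow>\<^sub>L real" where "norm \<phi> \<le> 1" "\<phi> x = norm x"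
proof -
  obtain \<phi> :: "'a \<Rightarrow>\<^sub>L real" where "norm \<phi> \<le> 1" "infdist x {0} \<le> \<phi> x - \<phi> 0"
    using convex_separation_infdist[of "{0}" x] by auto
  moreover have "\<phi> x \<le> norm x" if "norm \<phi> \<le> 1" for \<phi> :: "'a \<Rightarrow>\<^sub>L real"
    using norm_blinfun[of \<phi> x] mult_right_mono[OF that, of "norm x"] by auto
  ultimately show ?thesis by (intro that[of \<phi>] antisym) (auto simp: blinfun.zero_right)
qed

lemma blinfun_separates: "(\<And>\<phi> :: 'a::real_normed_vector \<Rightarrow>\<^sub>L real. \<phi> x = \<phi> y) \<Longrightarrow> x = y"
  by (metis norming_functional[of "x - y"] blinfun.diff_right eq_iff_diff_eq_0 norm_eq_zero)

subsection \<open>Support functions and the Hausdorff distance\<close>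

definition supp :: "'a::real_normed_vector set \<Rightarrow> ('a \<Rightarrow>\<^sub>L real) \<Rightarrow> real" where
  "supp K \<phi> = (SUP x\<in>K. \<phi> x)"

text \<open>Closedness is left out: Minkowski sums then stay in the class at once, and neither
  \<open>supp\<close> nor the Hausdorff distance sees a closure.\<close>

definition bounded_convex :: "'a::real_normed_vector set set" where
  "bounded_convex = {K. K \<noteq> {} \<and> convex K \<and> bounded K}"

lemma blinfun_le_norm:
  fixes \<phi> :: "'a::real_normed_vector \<Rightarrow>\<^sub>L real"
  assumes "norm \<phi> \<le> c"
  shows "\<phi> x \<le> c * norm x"
  using assms norm_blinfun[of \<phi> x] mult_right_mono[of "norm \<phi>" c "norm x"] by auto

lemma bdd_above_blinfun:
  fixes \<phi> :: "'a::real_normed_vector \<Rightarrow>\<^sub>L real"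
  shows "bounded K \<Longrightarrow> bdd_above (blinfun_apply \<phi> ` K)"
  by (intro bounded_imp_bdd_above bounded_linear_image blinfun.bounded_linear_right)

lemma supp_upper: "bounded K \<Longrightarrow> x \<in> K \<Longrightarrow> blinfun_apply \<phi> x \<le> supp K \<phi>"
  unfolding supp_def by (intro cSUP_upper bdd_above_blinfun)

lemma supp_least: "K \<noteq> {} \<Longrightarrow> (\<And>x. x \<in> K \<Longrightarrow> blinfun_apply \<phi> x \<le> c) \<Longrightarrow> supp K \<phi> \<le> c"
  unfolding supp_def by (rule cSUP_least)

lemma supp_mono: "K \<noteq> {} \<Longrightarrow> K \<subseteq> L \<Longrightarrow> bounded L \<Longrightarrow> supp K \<phi> \<le> supp L \<phi>"
  by (intro supp_least supp_upper) auto

lemma supp_nonneg: "bounded K \<Longrightarrow> 0 \<in> K \<Longrightarrow> 0 \<le> supp K \<phi>"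
  using supp_upper[of K 0 \<phi>] by (simp add: blinfun.zero_right)

lemma supp_singleton [simp]: "supp {x} \<phi> = blinfun_apply \<phi> x"
  by (simp add: supp_def)

lemma supp_plus:
  assumes "A \<noteq> {}" "bounded A" "B \<noteq> {}" "bounded B"
  shows "supp (A + B) \<phi> = supp A \<phi> + supp B \<phi>"
proof (rule antisym)
  show "supp (A + B) \<phi> \<le> supp A \<phi> + supp B \<phi>"
  proof (rule supp_least)
    show "A + B \<noteq> {}" using assms by (auto simp: set_plus_def)
    fix x assume "x \<in> A + B"
    then obtain a b where "x = a + b" "a \<in> A" "b \<in> B" by (auto elim: set_plus_elim)
    then show "\<phi> x \<le> supp A \<phi> + supp B \<phi>"
      using assms by (auto simp: blinfun.add_right intro!: add_mono supp_upper)
  qed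
next
  have bdd: "bounded (A + B)" using bounded_plus[OF assms(2,4)] by (simp add: set_plus_image)
  have ab: "\<phi> a + \<phi> b \<le> supp (A + B) \<phi>" if "a \<in> A" "b \<in> B" for a b
    using supp_upper[OF bdd, of "a + b"] that by (auto simp: blinfun.add_right)
  have "supp B \<phi> \<le> supp (A + B) \<phi> - \<phi> a" if "a \<in> A" for a
    using ab[OF that] assms(3) by (intro supp_least) (auto simp: le_diff_eq add.commute)
  then have "supp A \<phi> \<le> supp (A + B) \<phi> - supp B \<phi>"
    using assms(1) by (intro supp_least) (force simp: algebra_simps)+
  then show "supp A \<phi> + supp B \<phi> \<le> supp (A + B) \<phi>" by simp
qed

lemma supp_scaleR:
  assumes "A \<noteq> {}" "bounded A" "0 \<le> c"
  shows "supp ((*\<^sub>R) c ` A) \<phi> = c * supp A \<phi>"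
proof (cases "c = 0")
  case True
  then show ?thesis using assms by (simp add: image_constant_conv supp_def blinfun.zero_right)
next
  case False
  then have c: "0 < c" using assms by simp
  have bdd: "bounded ((*\<^sub>R) c ` A)" using assms by (intro bounded_scaling) 
  show ?thesis
  proof (rule antisym)
    show "supp ((*\<^sub>R) c ` A) \<phi> \<le> c * supp A \<phi>"
      using assms by (intro supp_least) (auto simp: blinfun.scaleR_right intro!: mult_left_mono supp_upper)
    have "supp A \<phi> \<le> supp ((*\<^sub>R) c ` A) \<phi> / c"
    proof (rule supp_least[OF assms(1)])
      fix x assume "x \<in> A"
      then show "\<phi> x \<le> supp ((*\<^sub>R) c ` A) \<phi> / c"
        using supp_upper[OF bdd, of "c *\<^sub>R x" \<phi>] c by (simp add: blinfun.scaleR_right field_simps)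
    qed
    then show "c * supp A \<phi> \<le> supp ((*\<^sub>R) c ` A) \<phi>" using c by (simp add: field_simps)
  qed
qed

lemma bounded_convex_singleton [simp]: "{x} \<in> bounded_convex"
  by (simp add: bounded_convex_def)

lemma bounded_convex_plus: "A \<in> bounded_convex \<Longrightarrow> B \<in> bounded_convex \<Longrightarrow> A + B \<in> bounded_convex"
  using bounded_plus[of A B] convex_set_plus[of A B]
  by (auto simp: bounded_convex_def set_plus_image)

lemma bounded_convex_scaleR: "A \<in> bounded_convex \<Longrightarrow> (*\<^sub>R) c ` A \<in> bounded_convex"
  by (auto simp: bounded_convex_def convex_scaling bounded_scaling)

lemma bounded_convex_sum:
  assumes "finite I" "\<And>i. i \<in> I \<Longrightarrow> B i \<in> bounded_convex"
  shows "(\<Sum>i\<in>I. B i) \<in> bounded_convex \<and> supp (\<Sum>i\<in>I. B i) \<phi> = (\<Sum>i\<in>I. supp (B i) \<phi>)"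
  using assms
proof (induction I rule: finite_induct)
  case empty
  then show ?case by (simp add: set_zero blinfun.zero_right)
next
  case (insert i I)
  then have "B i \<in> bounded_convex" "sum B I \<in> bounded_convex" by auto
  then show ?case
    using insert supp_plus[of "B i" "sum B I" \<phi>] bounded_convex_plus[of "B i" "sum B I"]
    by (auto simp: bounded_convex_def)
qed

lemma supp_translation:
  assumes "bounded A" "A \<noteq> {}"
  shows "supp {x - a |x. x \<in> A} \<phi> = supp A \<phi> - blinfun_apply \<phi> a"
proof -
  have "{x - a |x. x \<in> A} = A + {- a}" by (auto simp: set_plus_def)
  then show ?thesis using supp_plus[of A "{- a}" \<phi>] assms by (simp add: blinfun.minus_right)
qed

lemma sublinear_supp:
  assumes "K \<noteq> {}" "bounded K"
  shows "sublinear (supp K)"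
proof (rule sublinearI)
  show "supp K (\<phi> + \<psi>) \<le> supp K \<phi> + supp K \<psi>" for \<phi> \<psi>
    using assms by (intro supp_least) (auto simp: blinfun.add_left intro!: add_mono supp_upper)
  show "supp K 0 = 0" using assms by (simp add: supp_def)
  show "supp K (c *\<^sub>R \<phi>) \<le> c * supp K \<phi>" if "0 < c" for c \<phi>
    using assms that by (intro supp_least) (auto simp: blinfun.scaleR_left intro!: mult_left_mono supp_upper)
qed

section \<open>Hausdorff distance as a uniform distance of support functions\<close>

lemma hausdorff_distance_commute: "hausdorff_distance A B = hausdorff_distance B A"
  by (simp add: hausdorff_distance_def max.commute)

lemma infdist_le_hausdorff:
  fixes A B :: "'a::real_normed_vector set"
  assumes "A \<noteq> {}" "bounded A" "B \<noteq> {}" "bounded B" "a \<in> A"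
  shows "infdist a B \<le> hausdorff_distance A B"
proof -
  obtain b where b: "b \<in> B" using assms by blast
  obtain M where M: "\<And>a. a \<in> A \<Longrightarrow> dist b a \<le> M"
    using assms(2) bounded_any_center[of A b] by auto
  have "bdd_above ((\<lambda>a. infdist a B) ` A)"
    using M infdist_le[OF b] by (intro bdd_aboveI2[of _ _ M]) (force simp: dist_commute intro: order_trans)
  then have "infdist a B \<le> (SUP a\<in>A. infdist a B)" by (intro cSUP_upper assms)
  then show ?thesis by (simp add: hausdorff_distance_def)
qed

lemma hausdorff_distance_nonneg:
  fixes A B :: "'a::real_normed_vector set"
  assumes "A \<noteq> {}" "bounded A" "B \<noteq> {}" "bounded B"
  shows "0 \<le> hausdorff_distance A B"
  using infdist_le_hausdorff[OF assms] infdist_nonneg assms(1) by (metis all_not_in_conv order_trans)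

lemma hausdorff_close_point:
  fixes A B :: "'a::real_normed_vector set"
  assumes "A \<noteq> {}" "bounded A" "B \<noteq> {}" "bounded B" "a \<in> A" "hausdorff_distance A B < e"
  obtains b where "b \<in> B" "dist a b < e"
proof -
  have "infdist a B < e" using infdist_le_hausdorff[OF assms(1-5)] assms(6) by simp
  then have "(INF b\<in>B. dist a b) < e" using assms(3) by (simp add: infdist_def)
  then show ?thesis using that assms(3) cInf_lessD[of "dist a ` B" e] by auto
qed

lemma supp_le_hausdorff:
  assumes "A \<noteq> {}" "bounded A" "B \<noteq> {}" "bounded B"
  shows "supp A \<phi> \<le> supp B \<phi> + hausdorff_distance A B * norm \<phi>"
proof (rule field_le_epsilon)
  fix e :: real assume e: "0 < e"
  \<comment> \<open>A nearest point of \<open>B\<close> need not exist, hence the slack; the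
    \<open>1\<close> allows for \<open>\<phi> = 0\<close>.\<close>
  define e' where "e' = e / (1 + norm \<phi>)"
  have n: "0 < 1 + norm \<phi>" using norm_ge_zero[of \<phi>] by linarith
  have e': "0 < e'" using e n by (simp add: e'_def)
  show "supp A \<phi> \<le> supp B \<phi> + hausdorff_distance A B * norm \<phi> + e"
  proof (rule supp_least[OF assms(1)])
    fix a assume a: "a \<in> A"
    obtain b where b: "b \<in> B" "dist a b < hausdorff_distance A B + e'"
      using hausdorff_close_point[OF assms a, of "hausdorff_distance A B + e'"] e' by auto
    have "\<phi> a = \<phi> b + \<phi> (a - b)" by (simp add: blinfun.diff_right)
    also have "\<dots> \<le> supp B \<phi> + norm \<phi> * norm (a - b)"
      using blinfun_le_norm[of \<phi> "norm \<phi>" "a - b"] assms b by (intro add_mono supp_upper) auto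
    also have "\<dots> \<le> supp B \<phi> + norm \<phi> * (hausdorff_distance A B + e')"
      using b(2) by (intro add_left_mono mult_left_mono) (auto simp: dist_norm)
    also have "norm \<phi> * e' \<le> e" using e n by (simp add: e'_def field_simps)
    then have "supp B \<phi> + norm \<phi> * (hausdorff_distance A B + e') \<le> supp B \<phi> + hausdorff_distance A B * norm \<phi> + e"
      by (simp add: algebra_simps)
    finally show "\<phi> a \<le> supp B \<phi> + hausdorff_distance A B * norm \<phi> + e" .
  qed
qed

lemma abs_supp_diff_le_hausdorff:
  assumes "A \<in> bounded_convex" "B \<in> bounded_convex"
  shows "\<bar>supp A \<phi> - supp B \<phi>\<bar> \<le> hausdorff_distance A B * norm \<phi>"
  using supp_le_hausdorff[of A B \<phi>] supp_le_hausdorff[of B A \<phi>] assms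
  by (auto simp: bounded_convex_def hausdorff_distance_commute[of B A] abs_le_iff)

lemma abs_supp_diff_le_hausdorff':
  assumes "A \<in> bounded_convex" "B \<in> bounded_convex" "norm \<phi> \<le> 1"
  shows "\<bar>supp A \<phi> - supp B \<phi>\<bar> \<le> hausdorff_distance A B"
  using abs_supp_diff_le_hausdorff[OF assms(1,2), of \<phi>] hausdorff_distance_nonneg[of A B]
    mult_left_mono[OF assms(3), of "hausdorff_distance A B"] assms(1,2)
  by (auto simp: bounded_convex_def)

text \<open>The functional separating \<open>a\<close> from \<open>B\<close> with margin
  \<open>infdist a B\<close> lies in the unit ball, so the assumption on supports can be tested on
  it.\<close>

lemma infdist_le_supp_diff:
  assumes "A \<in> bounded_convex" "B \<in> bounded_convex" "a \<in> A"
    and "\<And>\<phi>. norm \<phi> \<le> 1 \<Longrightarrow> supp A \<phi> \<le> supp B \<phi> + e"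
  shows "infdist a B \<le> e"
proof -
  obtain \<phi> :: "'a \<Rightarrow>\<^sub>L real" where \<phi>: "norm \<phi> \<le> 1" "\<And>b. b \<in> B \<Longrightarrow> infdist a B \<le> \<phi> a - \<phi> b"
    using convex_separation_infdist[of B a] assms(2) by (auto simp: bounded_convex_def)
  have "supp B \<phi> \<le> \<phi> a - infdist a B"
    using assms(2) \<phi>(2) by (intro supp_least) (force simp: bounded_convex_def)+
  also have "\<phi> a \<le> supp B \<phi> + e"
    using assms(1,3) assms(4)[OF \<phi>(1)] supp_upper[of A a \<phi>] by (auto simp: bounded_convex_def)
  finally show ?thesis by simp
qed

lemma hausdorff_le:
  assumes "A \<in> bounded_convex" "B \<in> bounded_convex"
    and "\<And>\<phi>. norm \<phi> \<le> 1 \<Longrightarrow> \<bar>supp A \<phi> - supp B \<phi>\<bar> \<le> e"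
  shows "hausdorff_distance A B \<le> e"
proof -
  have "infdist a B \<le> e" if "a \<in> A" for a
    using assms(3) by (intro infdist_le_supp_diff[OF assms(1,2) that]) (force simp: abs_le_iff)
  moreover have "infdist b A \<le> e" if "b \<in> B" for b
    using assms(3) by (intro infdist_le_supp_diff[OF assms(2,1) that]) (force simp: abs_le_iff)
  ultimately show ?thesis
    using assms(1,2) unfolding hausdorff_distance_def bounded_convex_def by (auto intro!: cSUP_least)
qed

text \<open>Lipschitz with a norm bound of \<open>K\<close> as constant. Continuity in the
  functional makes the sets in the Baire argument over the dual closed.\<close>

lemma continuous_supp:
  assumes K: "K \<noteq> {}" "bounded K"
  shows "continuous_on UNIV (supp K)"
proof -
  obtain M where M: "0 < M" "\<And>x. x \<in> K \<Longrightarrow> norm x \<le> M"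
    using K(2) bounded_pos by blast
  have le: "supp K \<phi> \<le> supp K \<psi> + M * norm (\<phi> - \<psi>)" for \<phi> \<psi>
  proof (rule supp_least[OF K(1)])
    fix x assume x: "x \<in> K"
    have "\<phi> x = \<psi> x + (\<phi> - \<psi>) x" by (simp add: blinfun.diff_left)
    also have "\<dots> \<le> supp K \<psi> + norm (\<phi> - \<psi>) * norm x"
      using blinfun_le_norm[of "\<phi> - \<psi>" _ x] K x by (intro add_mono supp_upper) auto
    also have "\<dots> \<le> supp K \<psi> + M * norm (\<phi> - \<psi>)"
      using mult_left_mono[OF M(2)[OF x] norm_ge_zero[of "\<phi> - \<psi>"]] by (simp add: mult.commute)
    finally show "\<phi> x \<le> supp K \<psi> + M * norm (\<phi> - \<psi>)" .
  qed
  have "M-lipschitz_on UNIV (supp K)"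
    using le M(1) by (intro lipschitz_onI) (force simp: dist_norm abs_le_iff norm_minus_commute algebra_simps)+
  then show ?thesis by (rule lipschitz_on_continuous_on)
qed

subsection \<open>Weakly compact convex sets\<close>

lemma topspace_weak_topology [simp]: "topspace weak_topology = (UNIV :: 'a::real_normed_vector set)"
proof -
  have "UNIV = blinfun_apply (0 :: 'a \<Rightarrow>\<^sub>L real) -` UNIV" by simp
  then have "(UNIV :: 'a set) \<in> {blinfun_apply \<phi> -` U |(\<phi> :: 'a \<Rightarrow>\<^sub>L real) U. open U}" by blast
  then show ?thesis unfolding weak_topology_def topology_generated_by_topspace by blast
qed

lemma continuous_map_weak_topology:
  fixes \<phi> :: "'a::real_normed_vector \<Rightarrow>\<^sub>L real"
  shows "continuous_map weak_topology euclidean (blinfun_apply \<phi>)"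
proof -
  have "openin weak_topology {x \<in> topspace weak_topology. \<phi> x \<in> U}" if "open U" for U
  proof -
    have "{x \<in> topspace weak_topology. \<phi> x \<in> U} = blinfun_apply \<phi> -` U" by auto
    then show ?thesis using that
      unfolding weak_topology_def by (auto intro!: topology_generated_by_Basis)
  qed
  then show ?thesis by (auto simp: continuous_map_def)
qed

lemma closedin_weak_le:
  fixes \<phi> :: "'a::real_normed_vector \<Rightarrow>\<^sub>L real"
  shows "closedin weak_topology {x. \<phi> x \<le> c}"
  using closedin_continuous_map_preimage[OF continuous_map_weak_topology[of \<phi>], of "{..c}"]
  by simp

lemma closedin_weak_eq:
  fixes \<phi> :: "'a::real_normed_vector \<Rightarrow>\<^sub>L real"
  shows "closedin weak_topology {x. \<phi> x = c}"
  using closedin_continuous_map_preimage[OF continuous_map_weak_topology[of \<phi>], of "{c}"]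
  by simp

lemma cwk_compact_image:
  assumes "K \<in> cwk" "continuous_map weak_topology euclidean q"
  shows "compact (q ` K)"
  using image_compactin[of weak_topology K euclidean q] assms by (simp add: cwk_def)

lemma cwk_attains_max:
  fixes \<phi> :: "'a::real_normed_vector \<Rightarrow>\<^sub>L real"
  assumes "K \<in> cwk"
  obtains x where "x \<in> K" "\<And>y. y \<in> K \<Longrightarrow> \<phi> y \<le> \<phi> x"
proof -
  have "compact (blinfun_apply \<phi> ` K)"
    by (rule cwk_compact_image[OF assms continuous_map_weak_topology])
  moreover have "blinfun_apply \<phi> ` K \<noteq> {}" using assms by (simp add: cwk_def)
  ultimately obtain s where "s \<in> blinfun_apply \<phi> ` K" "\<forall>t\<in>blinfun_apply \<phi> ` K. t \<le> s"
    using compact_attains_sup by blast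
  then obtain x where "x \<in> K" "\<forall>y\<in>K. \<phi> y \<le> \<phi> x" by blast
  then show ?thesis by (intro that[of x]) blast+
qed

lemma Baire_closed_cover:
  fixes F :: "nat \<Rightarrow> 'a::complete_space set"
  assumes "\<And>n. closed (F n)" "(\<Union>n. F n) = UNIV"
  obtains n x r where "0 < r" "cball x r \<subseteq> F n"
proof (rule ccontr)
  assume "\<not> thesis"
  have "interior (F n) = {}" for n
  proof (rule equals0I)
    fix x assume "x \<in> interior (F n)"
    then obtain r where "0 < r" "cball x r \<subseteq> F n" by (auto simp: mem_interior_cball)
    then show False using that[of r x n] \<open>\<not> thesis\<close> by simp
  qed
  then have "euclidean interior_of \<Union>(range F) = {}"
    using assms(1) by (intro Baire_category_alt) (auto simp: completely_metrizable_space_euclidean)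
  then show False using assms(2) by simp
qed

text \<open>The uniform boundedness principle for the evaluations at points of \<open>K\<close>.
  Baire's theorem is used on the dual, which is complete even if the space is not; weak compactness
  bounds each single functional on \<open>K\<close>.\<close>

lemma cwk_bounded:
  fixes K :: "'a::real_normed_vector set"
  assumes K: "K \<in> cwk"
  shows "bounded K"
proof -
  define F where "F n = {\<phi> :: 'a \<Rightarrow>\<^sub>L real. \<forall>x\<in>K. \<bar>\<phi> x\<bar> \<le> real n}" for n
  have "F n = (\<Inter>x\<in>K. {\<phi>. \<bar>blinfun_apply \<phi> x\<bar> \<le> real n})" for n
    by (auto simp: F_def)
  then have "closed (F n)" for n
    by (auto intro!: closed_INT closed_Collect_le continuous_intros)
  moreover have "(\<Union>n. F n) = UNIV"
  proof -
    have "\<exists>n. \<phi> \<in> F n" for \<phi>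
    proof -
      have "bounded (blinfun_apply \<phi> ` K)"
        by (intro compact_imp_bounded cwk_compact_image[OF K] continuous_map_weak_topology)
      then obtain b where b: "\<And>x. x \<in> K \<Longrightarrow> \<bar>\<phi> x\<bar> \<le> b"
        by (auto simp: bounded_iff)
      obtain n where "b \<le> real n" using real_arch_simple by blast
      then have "\<phi> \<in> F n" using b by (auto simp: F_def intro: order_trans)
      then show ?thesis by blast
    qed
    then show ?thesis by auto
  qed
  ultimately obtain n \<phi> r where r: "0 < r" "cball \<phi> r \<subseteq> F n"
    by (rule Baire_closed_cover[of F])
  have "norm x \<le> 2 * real n / r" if x: "x \<in> K" for x
  proof -
    obtain \<psi> :: "'a \<Rightarrow>\<^sub>L real" where \<psi>: "norm \<psi> \<le> 1" "\<psi> x = norm x"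
      using norming_functional by blast
    \<comment> \<open>The centre of the ball and the point reached from it in the norming direction;
      their difference gives \<open>r * norm x \<le> 2 * n\<close>.\<close>
    have "\<phi> \<in> F n" "\<phi> + r *\<^sub>R \<psi> \<in> F n"
      using r \<psi>(1) by (auto simp: dist_norm intro!: subsetD[OF r(2)] mult_left_le)
    then have "\<bar>\<phi> x\<bar> \<le> n" "\<bar>\<phi> x + r * norm x\<bar> \<le> n"
      using x \<psi>(2) by (auto simp: F_def blinfun.add_left blinfun.scaleR_left)
    then show ?thesis using r by (simp add: field_simps)
  qed
  then show ?thesis by (auto simp: bounded_iff)
qed

lemma cwk_bounded_convex: "K \<in> cwk \<Longrightarrow> K \<in> bounded_convex"
  using cwk_bounded[of K] by (auto simp: cwk_def bounded_convex_def)

lemma closed_convex_mem_iff: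
  assumes "A \<in> bounded_convex" "closed A"
  shows "x \<in> A \<longleftrightarrow> (\<forall>\<phi>. blinfun_apply \<phi> x \<le> supp A \<phi>)"
proof
  show "x \<in> A \<Longrightarrow> \<forall>\<phi>. blinfun_apply \<phi> x \<le> supp A \<phi>"
    using assms(1) supp_upper[of A x] by (auto simp: bounded_convex_def)
next
  assume le: "\<forall>\<phi>. blinfun_apply \<phi> x \<le> supp A \<phi>"
  have "infdist x A \<le> 0"
    using le assms(1) by (intro infdist_le_supp_diff[of "{x}"]) auto
  then have "infdist x A = 0" using infdist_nonneg[of x A] by simp
  then show "x \<in> A"
    using assms in_closed_iff_infdist_zero[of A x] by (auto simp: bounded_convex_def)
qed

text \<open>A closed convex set is an intersection of half-spaces, hence weakly closed.\<close>

lemma cwk_Int_closed_convex: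
  assumes K: "K \<in> cwk" and A: "A \<in> bounded_convex" "closed A" and ne: "K \<inter> A \<noteq> {}"
  shows "K \<inter> A \<in> cwk"
proof -
  have "A = (\<Inter>\<phi>. {x. blinfun_apply \<phi> x \<le> supp A \<phi>})"
    using closed_convex_mem_iff[OF A] by auto
  moreover have "closedin weak_topology (\<Inter>\<phi>. {x. blinfun_apply \<phi> x \<le> supp A \<phi>})"
    by (intro closedin_Inter) (auto simp: closedin_weak_le)
  ultimately have "closedin weak_topology A" by simp
  then have "compactin weak_topology (K \<inter> A)"
    using K closed_Int_compactin[of weak_topology A K] by (simp add: cwk_def Int_commute)
  then show ?thesis using K A(1) ne by (auto simp: cwk_def bounded_convex_def intro: convex_Int)
qed

text \<open>Linear functionals on the dual, with no continuity asked for, stand in for the bidual.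
  The notion is stable under sums, scaling and uniform limits, and all of this is shown without
  touching the weak topology.\<close>

definition represented :: "(('a::real_normed_vector \<Rightarrow>\<^sub>L real) \<Rightarrow> real) \<Rightarrow> bool" where
  "represented p \<longleftrightarrow> sublinear p \<and> (\<forall>\<xi>. linear \<xi> \<longrightarrow> (\<forall>\<phi>. \<xi> \<phi> \<le> p \<phi>) \<longrightarrow> (\<exists>x. \<forall>\<phi>. \<xi> \<phi> = \<phi> x))"

text \<open>Least squares: at a point \<open>x\<close> of \<open>K\<close> that minimizes the
  squared mismatch on \<open>F\<close>, the first-order condition says that the combination
  \<open>\<psi>\<close> of \<open>F\<close>, weighted by the negated mismatches, is maximal over
  \<open>K\<close> at \<open>x\<close>. As \<open>\<xi>\<close> lies below \<open>supp K\<close> at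
  \<open>\<psi>\<close>, the sum of the squared mismatches is at most zero.\<close>

lemma cwk_matches_finitely:
  fixes K :: "'a::real_normed_vector set"
  assumes K: "K \<in> cwk" and \<xi>: "linear \<xi>" "\<And>\<phi>. \<xi> \<phi> \<le> supp K \<phi>" and F: "finite F"
  obtains x where "x \<in> K" "\<And>\<phi>. \<phi> \<in> F \<Longrightarrow> blinfun_apply \<phi> x = \<xi> \<phi>"
proof -
  define q where "q x = (\<Sum>\<phi>\<in>F. (blinfun_apply \<phi> x - \<xi> \<phi>)\<^sup>2)" for x :: 'a
  have "continuous_map weak_topology euclidean q"
    unfolding q_def by (intro continuous_intros continuous_map_weak_topology F)
  then have "compact (q ` K)" by (rule cwk_compact_image[OF K])
  moreover have "q ` K \<noteq> {}" using K by (simp add: cwk_def)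
  ultimately obtain s where "s \<in> q ` K" "\<forall>t\<in>q ` K. s \<le> t"
    using compact_attains_inf by blast
  then obtain x where x: "x \<in> K" "\<And>y. y \<in> K \<Longrightarrow> q x \<le> q y" by blast
  define a where "a \<phi> = blinfun_apply \<phi> x - \<xi> \<phi>" for \<phi>
  define \<psi> where "\<psi> = - (\<Sum>\<phi>\<in>F. a \<phi> *\<^sub>R \<phi>)"
  have \<psi>: "\<psi> y = - (\<Sum>\<phi>\<in>F. a \<phi> * \<phi> y)" for y
    by (simp add: \<psi>_def blinfun.minus_left blinfun.sum_left blinfun.scaleR_left)
  have "\<psi> y \<le> \<psi> x" if y: "y \<in> K" for y
  proof (rule ccontr)
    assume "\<not> \<psi> y \<le> \<psi> x"
    define S where "S = (\<Sum>\<phi>\<in>F. a \<phi> * \<phi> (y - x))"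
    define Q where "Q = (\<Sum>\<phi>\<in>F. (blinfun_apply \<phi> (y - x))\<^sup>2)"
    have S: "S < 0"
      using \<open>\<not> \<psi> y \<le> \<psi> x\<close> by (simp add: S_def \<psi> blinfun.diff_right right_diff_distrib sum_subtractf)
    have Q: "0 \<le> Q" by (simp add: Q_def sum_nonneg)
    \<comment> \<open>A step so small that the negative linear term \<open>2 * t * S\<close> beats
      \<open>t\<^sup>2 * Q\<close>; the \<open>1\<close> keeps the denominator positive.\<close>
    define t where "t = min 1 (- S / (Q + 1))"
    have t: "0 < t" "t \<le> 1" "t * (Q + 1) \<le> - S"
    proof -
      show "0 < t" "t \<le> 1" using S Q by (auto simp: t_def divide_neg_pos)
      have "t \<le> - S / (Q + 1)" by (simp add: t_def)
      then show "t * (Q + 1) \<le> - S" using Q by (simp add: field_simps)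
    qed
    have "(1 - t) *\<^sub>R x + t *\<^sub>R y \<in> K"
      using K x(1) y t by (intro convexD) (auto simp: cwk_def)
    then have "q x \<le> q ((1 - t) *\<^sub>R x + t *\<^sub>R y)" by (rule x(2))
    also have "q ((1 - t) *\<^sub>R x + t *\<^sub>R y) = (\<Sum>\<phi>\<in>F. (a \<phi> + t * \<phi> (y - x))\<^sup>2)"
      by (simp add: q_def a_def blinfun.add_right blinfun.scaleR_right blinfun.diff_right algebra_simps)
    also have "\<dots> = q x + 2 * t * S + t\<^sup>2 * Q"
      by (simp add: q_def a_def[symmetric] S_def Q_def power2_sum power_mult_distrib sum.distrib
          sum_distrib_left mult_ac)
    finally have "0 \<le> t * (2 * S + t * Q)" by (simp add: power2_eq_square algebra_simps)
    then have "0 \<le> 2 * S + t * Q" using t(1) by (simp add: zero_le_mult_iff)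
    then show False using t S Q by (simp add: algebra_simps)
  qed
  then have "supp K \<psi> \<le> \<psi> x" using x(1) by (intro supp_least) auto
  with \<xi>(2)[of \<psi>] have "\<xi> \<psi> \<le> \<psi> x" by simp
  moreover have "\<xi> \<psi> = - (\<Sum>\<phi>\<in>F. a \<phi> * \<xi> \<phi>)"
    using \<xi>(1) by (simp add: \<psi>_def linear_neg linear_sum linear_scale)
  ultimately have "(\<Sum>\<phi>\<in>F. a \<phi> * \<phi> x) \<le> (\<Sum>\<phi>\<in>F. a \<phi> * \<xi> \<phi>)" by (simp add: \<psi>)
  then have "(\<Sum>\<phi>\<in>F. (a \<phi>)\<^sup>2) \<le> 0"
    by (simp add: a_def power2_eq_square right_diff_distrib sum_subtractf)
  then have "(\<Sum>\<phi>\<in>F. (a \<phi>)\<^sup>2) = 0" by (intro antisym sum_nonneg) auto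
  then have "\<forall>\<phi>\<in>F. a \<phi> = 0" using F by (simp add: sum_nonneg_eq_0_iff)
  then show ?thesis using x(1) by (intro that[of x]) (auto simp: a_def)
qed

text \<open>Any finite set of functionals can be matched in \<open>K\<close>; the finite
  intersection property in the weak topology matches all of them at once.\<close>

lemma cwk_represents:
  fixes K :: "'a::real_normed_vector set"
  assumes K: "K \<in> cwk" and \<xi>: "linear \<xi>" "\<And>\<phi>. \<xi> \<phi> \<le> supp K \<phi>"
  obtains x where "x \<in> K" "\<And>\<phi>. \<xi> \<phi> = blinfun_apply \<phi> x"
proof -
  define C where "C \<phi> = {x. blinfun_apply \<phi> x = \<xi> \<phi>}" for \<phi>
  have fin: "K \<inter> \<Inter>\<F> \<noteq> {}" if fin_sub: "finite \<F>" "\<F> \<subseteq> range C" for \<F>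
  proof -
    obtain F where F: "finite F" "\<F> = C ` F" using finite_subset_image[OF fin_sub] by auto
    obtain x where "x \<in> K" "\<And>\<phi>. \<phi> \<in> F \<Longrightarrow> blinfun_apply \<phi> x = \<xi> \<phi>"
      using cwk_matches_finitely[OF K \<xi> F(1)] by blast
    then show ?thesis using F(2) by (auto simp: C_def)
  qed
  have cl: "closedin weak_topology T" if "T \<in> range C" for T
    using that closedin_weak_eq by (auto simp: C_def)
  have "compactin weak_topology K" using K by (simp add: cwk_def)
  then have fip: "\<forall>\<U>. (\<forall>C\<in>\<U>. closedin weak_topology C) \<and> (\<forall>\<F>. finite \<F> \<and> \<F> \<subseteq> \<U> \<longrightarrow> K \<inter> \<Inter>\<F> \<noteq> {}) \<longrightarrow>
      K \<inter> \<Inter>\<U> \<noteq> {}"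
    unfolding compactin_fip by (rule conjunct2)
  have "K \<inter> \<Inter>(range C) \<noteq> {}"
    by (rule fip[THEN spec, THEN mp]) (intro conjI ballI allI impI cl fin; simp)
  then obtain x where "x \<in> K" "\<And>\<phi>. x \<in> C \<phi>" by blast
  then show ?thesis by (intro that[of x]) (auto simp: C_def)
qed

lemma represented_supp:
  assumes K: "K \<in> cwk"
  shows "represented (supp K)"
  unfolding represented_def
proof (intro conjI allI impI)
  show "sublinear (supp K)"
    using cwk_bounded_convex[OF K] by (intro sublinear_supp) (auto simp: bounded_convex_def)
  fix \<xi> assume "linear \<xi>" "\<forall>\<phi>. \<xi> \<phi> \<le> supp K \<phi>"
  then obtain x where "\<And>\<phi>. \<xi> \<phi> = blinfun_apply \<phi> x"
    by (metis cwk_represents[OF K])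
  then show "\<exists>x. \<forall>\<phi>. \<xi> \<phi> = \<phi> x" by blast
qed

lemma representedD:
  assumes "represented p" "linear \<xi>" "\<And>\<phi>. \<xi> \<phi> \<le> p \<phi>"
  obtains x where "\<And>\<phi>. \<xi> \<phi> = blinfun_apply \<phi> x"
  using assms unfolding represented_def by blast

text \<open>The evaluation at a limit point is still below \<open>supp K\<close>, so it is the
  evaluation at a point of \<open>K\<close>, and functionals separate points.\<close>

lemma cwk_closed:
  fixes K :: "'a::real_normed_vector set"
  assumes K: "K \<in> cwk"
  shows "closed K"
proof -
  have "x \<in> K" if x: "x \<in> closure K" for x
  proof -
    have le: "blinfun_apply \<phi> x \<le> supp K \<phi>" for \<phi>
    proof (rule continuous_le_on_closure[OF _ x])
      show "continuous_on (closure K) (blinfun_apply \<phi>)" by (intro continuous_intros)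
      show "blinfun_apply \<phi> y \<le> supp K \<phi>" if "y \<in> K" for y
        using that cwk_bounded[OF K] by (rule supp_upper[rotated])
    qed
    have lin: "linear (\<lambda>\<phi>. blinfun_apply \<phi> x)"
      by (rule linearI) (auto simp: blinfun.add_left blinfun.scaleR_left)
    obtain y where "y \<in> K" "\<And>\<phi> :: 'a \<Rightarrow>\<^sub>L real. \<phi> x = \<phi> y"
      by (rule cwk_represents[OF K lin le]) blast
    then show "x \<in> K" using blinfun_separates[of x y] by auto
  qed
  then show ?thesis using closure_subset_eq by blast
qed

lemma cwk_closed_convex_subset:
  assumes "K \<in> cwk" "A \<subseteq> K" "A \<noteq> {}" "convex A" "closed A"
  shows "A \<in> cwk"
proof -
  have "A \<in> bounded_convex"
    using assms cwk_bounded[of K] bounded_subset by (auto simp: bounded_convex_def)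
  then have "K \<inter> A \<in> cwk" using assms by (intro cwk_Int_closed_convex) auto
  then show ?thesis using assms(2) by (simp add: Int_absorb1)
qed

lemma represented_zero: "represented (\<lambda>_. 0)"
proof -
  have "\<xi> \<phi> = blinfun_apply \<phi> 0" if "linear \<xi>" "\<forall>\<phi>. \<xi> \<phi> \<le> 0" for \<xi> and \<phi> :: "'a \<Rightarrow>\<^sub>L real"
    using that(2)[rule_format, of \<phi>] that(2)[rule_format, of "- \<phi>"] linear_neg[OF that(1), of \<phi>]
    by (simp add: blinfun.zero_right)
  then have "\<exists>x. \<forall>\<phi>. \<xi> \<phi> = blinfun_apply \<phi> x" if "linear \<xi>" "\<forall>\<phi>. \<xi> \<phi> \<le> 0" for \<xi> :: "('a \<Rightarrow>\<^sub>L real) \<Rightarrow> real"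
    using that by blast
  moreover have "sublinear (\<lambda>_::'a \<Rightarrow>\<^sub>L real. 0)" by (intro sublinearI) auto
  ultimately show ?thesis by (simp add: represented_def)
qed

text \<open>The sandwich splits a linear minorant of the sum into minorants of the summands; each is
  an evaluation, and the points add up.\<close>

lemma represented_add:
  assumes "represented p" "represented q"
  shows "represented (\<lambda>\<phi>. p \<phi> + q \<phi>)"
  unfolding represented_def
proof (intro conjI allI impI)
  have sub: "sublinear p" "sublinear q" using assms by (auto simp: represented_def)
  show "sublinear (\<lambda>\<phi>. p \<phi> + q \<phi>)"
  proof (rule sublinearI)
    show "p (x + y) + q (x + y) \<le> p x + q x + (p y + q y)" for x y
      using sublinear_add[OF sub(1), of x y] sublinear_add[OF sub(2), of x y] by simp
  qed (auto simp: sublinear_zero[OF sub(1)] sublinear_zero[OF sub(2)] sublinear_scale[OF sub(1)]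
      sublinear_scale[OF sub(2)] algebra_simps)
  fix \<xi> assume "linear \<xi>" "\<forall>\<phi>. \<xi> \<phi> \<le> p \<phi> + q \<phi>"
  then have "linear \<xi>" "\<And>\<phi>. \<xi> \<phi> \<le> p \<phi> + q \<phi>" by blast+
  then obtain \<xi>1 \<xi>2 where \<xi>: "linear \<xi>1" "linear \<xi>2" "\<And>\<phi>. \<xi>1 \<phi> \<le> p \<phi>" "\<And>\<phi>. \<xi>2 \<phi> \<le> q \<phi>"
      "\<And>\<phi>. \<xi> \<phi> = \<xi>1 \<phi> + \<xi>2 \<phi>"
    by (rule linear_sandwich[OF sub]) blast
  obtain x where "\<And>\<phi>. \<xi>1 \<phi> = \<phi> x" by (rule representedD[OF assms(1) \<xi>(1,3)]) blast
  moreover obtain y where "\<And>\<phi>. \<xi>2 \<phi> = \<phi> y" by (rule representedD[OF assms(2) \<xi>(2,4)]) blast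
  ultimately
  have "\<forall>\<phi>. \<xi> \<phi> = \<phi> (x + y)" using \<xi>(5) by (simp add: blinfun.add_right)
  then show "\<exists>x. \<forall>\<phi>. \<xi> \<phi> = \<phi> x" by blast
qed

lemma represented_scale:
  assumes "represented p" "0 \<le> c"
  shows "represented (\<lambda>\<phi>. c * p \<phi>)"
proof (cases "c = 0")
  case True
  then show ?thesis using represented_zero by simp
next
  case False
  then have c: "0 < c" using assms(2) by simp
  have sub: "sublinear p" using assms by (simp add: represented_def)
  show ?thesis
    unfolding represented_def
  proof (intro conjI allI impI)
    show "sublinear (\<lambda>\<phi>. c * p \<phi>)"
    proof (rule sublinearI)
      show "c * p (x + y) \<le> c * p x + c * p y" for x y
        using mult_left_mono[OF sublinear_add[OF sub, of x y] assms(2)] by (simp add: distrib_left)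
    qed (auto simp: sublinear_zero[OF sub] sublinear_scale[OF sub])
    fix \<xi> assume \<xi>: "linear \<xi>" "\<forall>\<phi>. \<xi> \<phi> \<le> c * p \<phi>"
    have "linear (\<lambda>\<phi>. inverse c * \<xi> \<phi>)"
      using \<xi>(1) by (intro linearI) (auto simp: linear_add linear_scale distrib_left)
    moreover have "inverse c * \<xi> \<phi> \<le> p \<phi>" for \<phi>
      using \<xi>(2) c by (simp add: field_simps)
    ultimately obtain x where x: "\<And>\<phi>. inverse c * \<xi> \<phi> = \<phi> x"
      by (rule representedD[OF assms(1)]) blast
    have "\<forall>\<phi>. \<xi> \<phi> = \<phi> (c *\<^sub>R x)"
      using c by (simp add: blinfun.scaleR_right flip: x)
    then show "\<exists>x. \<forall>\<phi>. \<xi> \<phi> = \<phi> x" by blast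
  qed
qed

lemma represented_sum:
  assumes "finite I" "\<And>i. i \<in> I \<Longrightarrow> represented (p i)"
  shows "represented (\<lambda>\<phi>. \<Sum>i\<in>I. p i \<phi>)"
  using assms by (induction I rule: finite_induct) (auto intro: represented_zero represented_add)

text \<open>The sandwich splits a linear minorant of \<open>p\<close> into a minorant of
  \<open>q\<close>, which is an evaluation, and a rest of size at most
  \<open>e * norm \<phi>\<close>. So the minorant is a uniform limit of evaluations, and
  completeness of the space supplies the limit point.\<close>

lemma represented_limit:
  fixes p :: "('a::banach \<Rightarrow>\<^sub>L real) \<Rightarrow> real"
  assumes p: "sublinear p"
    and ex: "\<And>e. 0 < e \<Longrightarrow> \<exists>q. represented q \<and> (\<forall>\<phi>. p \<phi> \<le> q \<phi> + e * norm \<phi>)"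
  shows "represented p"
  unfolding represented_def
proof (intro conjI allI impI)
  fix \<xi> assume \<xi>: "linear \<xi>" "\<forall>\<phi>. \<xi> \<phi> \<le> p \<phi>"
  have approx: "\<exists>x. \<forall>\<phi>. \<bar>\<xi> \<phi> - \<phi> x\<bar> \<le> e * norm \<phi>" if e: "0 < e" for e
  proof -
    obtain q where q: "represented q" "\<And>\<phi>. p \<phi> \<le> q \<phi> + e * norm \<phi>"
      using ex[OF e] by blast
    have le: "\<xi> \<phi> \<le> q \<phi> + e * norm \<phi>" for \<phi>
      using \<xi>(2) q(2)[of \<phi>] by (meson order_trans)
    have "sublinear q" using q(1) by (simp add: represented_def)
    moreover have "sublinear (\<lambda>\<phi>::'a \<Rightarrow>\<^sub>L real. e * norm \<phi>)" using e by (intro sublinear_norm) simp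
    ultimately obtain \<xi>1 \<xi>2 where \<xi>12: "linear \<xi>1" "linear \<xi>2" "\<And>\<phi>. \<xi>1 \<phi> \<le> q \<phi>" "\<And>\<phi>. \<xi>2 \<phi> \<le> e * norm \<phi>"
        "\<And>\<phi>. \<xi> \<phi> = \<xi>1 \<phi> + \<xi>2 \<phi>"
      by (rule linear_sandwich[OF _ _ \<xi>(1) le]) blast
    obtain x where x: "\<And>\<phi>. \<xi>1 \<phi> = \<phi> x"
      by (rule representedD[OF q(1) \<xi>12(1,3)]) blast
    have "\<bar>\<xi>2 \<phi>\<bar> \<le> e * norm \<phi>" for \<phi>
      using \<xi>12(4)[of \<phi>] \<xi>12(4)[of "- \<phi>"] linear_neg[OF \<xi>12(2), of \<phi>] by (simp add: abs_le_iff)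
    then show ?thesis using \<xi>12(5) x by (intro exI[of _ x]) simp
  qed
  have "\<forall>n. \<exists>x. \<forall>\<phi>. \<bar>\<xi> \<phi> - \<phi> x\<bar> \<le> inverse (real (Suc n)) * norm \<phi>"
    by (intro allI approx) simp
  then obtain X where X: "\<And>n \<phi>. \<bar>\<xi> \<phi> - blinfun_apply \<phi> (X n)\<bar> \<le> inverse (real (Suc n)) * norm \<phi>"
    by metis
  have "norm (X m - X n) \<le> inverse (real (Suc m)) + inverse (real (Suc n))" for m n
  proof -
    obtain \<phi> :: "'a \<Rightarrow>\<^sub>L real" where \<phi>: "norm \<phi> \<le> 1" "\<phi> (X m - X n) = norm (X m - X n)"
      using norming_functional by blast
    have "inverse (real (Suc k)) * norm \<phi> \<le> inverse (real (Suc k))" for k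
      using \<phi>(1) by (intro mult_left_le) auto
    from this[of m] this[of n] X[of \<phi> m] X[of \<phi> n] \<phi>(2) show ?thesis
      unfolding blinfun.diff_right by linarith
  qed
  moreover have "Cauchy X" if le: "\<And>m n. norm (X m - X n) \<le> inverse (real (Suc m)) + inverse (real (Suc n))"
  proof (rule CauchyI)
    fix e :: real assume "0 < e"
    then obtain N where N: "inverse (real (Suc N)) < e / 2"
      using reals_Archimedean[of "e / 2"] by auto
    have "inverse (real (Suc m)) \<le> inverse (real (Suc N))" if "N \<le> m" for m
      using that by (intro le_imp_inverse_le) auto
    then have "norm (X m - X n) < e" if "N \<le> m" "N \<le> n" for m n
      using le[of m n] N that by (smt (verit) field_sum_of_halves)
    then show "\<exists>M. \<forall>m\<ge>M. \<forall>n\<ge>M. norm (X m - X n) < e" by blast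
  qed
  ultimately have "convergent X" by (simp add: Cauchy_convergent_iff)
  then obtain x where x: "X \<longlonglongrightarrow> x" by (auto simp: convergent_def)
  have "\<xi> \<phi> = \<phi> x" for \<phi>
  proof -
    have lim: "(\<lambda>n. inverse (real (Suc n)) * norm \<phi>) \<longlonglongrightarrow> 0"
      by (rule tendsto_mult_left_zero[OF LIMSEQ_inverse_real_of_nat])
    have "\<forall>n. norm (\<xi> \<phi> - blinfun_apply \<phi> (X n)) \<le> inverse (real (Suc n)) * norm \<phi>"
      using X[of \<phi>] unfolding real_norm_def by blast
    then have "(\<lambda>n. \<xi> \<phi> - blinfun_apply \<phi> (X n)) \<longlonglongrightarrow> 0"
      by (rule Lim_null_comparison[OF always_eventually lim])
    moreover have "(\<lambda>n. \<xi> \<phi> - blinfun_apply \<phi> (X n)) \<longlonglongrightarrow> \<xi> \<phi> - \<phi> x"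
      by (intro tendsto_intros x)
    ultimately show ?thesis using LIMSEQ_unique by fastforce
  qed
  then show "\<exists>x. \<forall>\<phi>. \<xi> \<phi> = \<phi> x" by blast
qed (rule p)

text \<open>Banach-Alaoglu in the pointwise topology: the value at \<open>x\<close> lies between
  \<open>- p (- x)\<close> and \<open>p x\<close>, the product of these intervals is compact by
  Tychonoff's theorem, and linearity is a closed condition in it.\<close>

lemma compact_linear_minorants:
  fixes p :: "'a::real_vector \<Rightarrow> real"
  shows "compact {\<xi>. linear \<xi> \<and> (\<forall>x. \<xi> x \<le> p x)}"
proof -
  define T where "T = {\<xi>. linear \<xi> \<and> (\<forall>x. \<xi> x \<le> p x)}"
  define R where "R = PiE UNIV (\<lambda>x. {- p (- x)..p x})"
  have "compactin (product_topology (\<lambda>_. euclidean) UNIV) R"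
    unfolding R_def compactin_PiE by auto
  then have "compact R" by (simp add: euclidean_product_topology)
  moreover have "T = R \<inter> ((\<Inter>x. \<Inter>y. {\<xi>. \<xi> (x + y) = \<xi> x + \<xi> y}) \<inter> (\<Inter>c. \<Inter>x. {\<xi>. \<xi> (c *\<^sub>R x) = c * \<xi> x}))"
    (is "_ = _ \<inter> ?L")
  proof -
    have "\<xi> \<in> R" if "linear \<xi>" "\<forall>x. \<xi> x \<le> p x" for \<xi>
    proof -
      have "- p (- x) \<le> \<xi> x" for x
        using that(2)[rule_format, of "- x"] linear_neg[OF that(1), of x] by simp
      then show ?thesis using that(2) by (auto simp: R_def)
    qed
    then show ?thesis
      by (auto simp: T_def R_def linear_add linear_scale PiE_iff intro!: linearI)
  qed
  moreover have "closed ?L"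
    by (intro closed_Int closed_INT ballI closed_Collect_eq continuous_intros continuous_on_product_coordinates)
  ultimately show ?thesis by (simp add: T_def compact_Int_closed)
qed

text \<open>Sending a minorant to the point that represents it is continuous from the pointwise to
  the weak topology, so the compact set of minorants is carried onto a weakly compact set.\<close>

theorem represented_cwk:
  fixes p :: "('a::real_normed_vector \<Rightarrow>\<^sub>L real) \<Rightarrow> real"
  assumes p: "represented p"
  obtains S where "S \<in> cwk" "\<And>\<phi>. supp S \<phi> = p \<phi>"
proof -
  define S where "S = {x. \<forall>\<phi>. blinfun_apply \<phi> x \<le> p \<phi>}"
  define T where "T = {\<xi>. linear \<xi> \<and> (\<forall>\<phi>. \<xi> \<phi> \<le> p \<phi>)}"
  define g where "g \<xi> = (SOME x. \<forall>\<phi>. \<xi> \<phi> = blinfun_apply \<phi> x)" for \<xi> :: "('a \<Rightarrow>\<^sub>L real) \<Rightarrow> real"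
  have sub: "sublinear p" using p by (simp add: represented_def)
  have g: "\<xi> \<phi> = blinfun_apply \<phi> (g \<xi>)" if "\<xi> \<in> T" for \<xi> \<phi>
  proof -
    have "\<exists>x. \<forall>\<phi>. \<xi> \<phi> = blinfun_apply \<phi> x" using p that by (auto simp: represented_def T_def)
    then have "\<forall>\<phi>. \<xi> \<phi> = blinfun_apply \<phi> (g \<xi>)" unfolding g_def by (rule someI_ex)
    then show ?thesis by blast
  qed
  have ev: "(\<lambda>\<phi>. blinfun_apply \<phi> x) \<in> T" if "x \<in> S" for x
    using that by (auto simp: T_def S_def blinfun.add_left blinfun.scaleR_left intro!: linearI)
  have gT: "g ` T = S"
  proof
    show "g ` T \<subseteq> S" using g by (force simp: S_def T_def)
    show "S \<subseteq> g ` T"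
    proof
      fix x assume "x \<in> S"
      from ev[OF this] have T: "(\<lambda>\<phi>. blinfun_apply \<phi> x) \<in> T" .
      have "x = g (\<lambda>\<phi>. blinfun_apply \<phi> x)"
        by (rule blinfun_separates) (rule g[OF T])
      with T show "x \<in> g ` T" by blast
    qed
  qed
  have "continuous_map (top_of_set T) weak_topology g"
    unfolding weak_topology_def
  proof (rule continuous_on_generated_topo)
    fix U assume "U \<in> {blinfun_apply \<phi> -` V |(\<phi> :: 'a \<Rightarrow>\<^sub>L real) V. open V}"
    then obtain \<phi> :: "'a \<Rightarrow>\<^sub>L real" and V where V: "U = blinfun_apply \<phi> -` V" "open V" by blast
    have "g -` U \<inter> topspace (top_of_set T) = T \<inter> (\<lambda>\<xi>. \<xi> \<phi>) -` V"
      using g by (auto simp: V)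
    moreover have "open ((\<lambda>\<xi>. \<xi> \<phi>) -` V)"
      using V(2) by (intro open_vimage continuous_on_product_coordinates)
    ultimately show "openin (top_of_set T) (g -` U \<inter> topspace (top_of_set T))"
      by (simp add: openin_open_Int)
  next
    show "g ` topspace (top_of_set T) \<subseteq> \<Union> {blinfun_apply \<phi> -` V |(\<phi> :: 'a \<Rightarrow>\<^sub>L real) V. open V}"
      using topspace_weak_topology unfolding weak_topology_def topology_generated_by_topspace by blast
  qed
  moreover have "compactin (top_of_set T) T"
    using compact_linear_minorants[of p] by (simp add: compactin_subtopology T_def)
  ultimately have "compactin weak_topology S"
    using image_compactin gT by blast
  moreover have "convex S"
    unfolding convex_def
  proof (intro ballI allI impI)
    fix x y and u v :: real
    assume *: "x \<in> S" "y \<in> S" "0 \<le> u" "0 \<le> v" "u + v = 1"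
    have "blinfun_apply \<phi> (u *\<^sub>R x + v *\<^sub>R y) \<le> p \<phi>" for \<phi>
    proof -
      have "u * \<phi> x + v * \<phi> y \<le> u * p \<phi> + v * p \<phi>"
        using * by (intro add_mono mult_left_mono) (auto simp: S_def)
      also have "\<dots> = p \<phi>" using * by (simp flip: distrib_right)
      finally show ?thesis by (simp add: blinfun.add_right blinfun.scaleR_right)
    qed
    then show "u *\<^sub>R x + v *\<^sub>R y \<in> S" by (simp add: S_def)
  qed
  \<comment> \<open>A linear minorant touching \<open>p\<close> at \<open>\<phi>\<close> yields a
    point of \<open>S\<close>; so \<open>S\<close> is non-empty and its support function is not
    below \<open>p\<close>.\<close>
  moreover have ex: "\<exists>x\<in>S. p \<phi> \<le> blinfun_apply \<phi> x" for \<phi>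
  proof -
    obtain \<xi> where \<xi>: "linear \<xi>" "\<And>\<psi>. \<xi> \<psi> \<le> p \<psi>" "p \<phi> \<le> \<xi> \<phi>"
      using Mazur_Orlicz[OF sub, of "{\<phi>}" "p \<phi>"] by auto
    then have "\<xi> \<in> T" by (simp add: T_def)
    then show ?thesis using g[of \<xi> \<phi>] gT \<xi>(3) by force
  qed
  then have "S \<noteq> {}" by blast
  ultimately have S: "S \<in> cwk" by (simp add: cwk_def)
  have "supp S \<phi> = p \<phi>" for \<phi>
  proof (rule antisym)
    show "supp S \<phi> \<le> p \<phi>" using \<open>S \<noteq> {}\<close> by (intro supp_least) (auto simp: S_def)
    show "p \<phi> \<le> supp S \<phi>"
      using ex[of \<phi>] supp_upper[OF cwk_bounded[OF S]] by (force intro: order_trans)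
  qed
  with S show ?thesis by (rule that)
qed

lemma cwk_translation:
  assumes "K \<in> cwk"
  shows "{x - a |x. x \<in> K} \<in> cwk"
proof -
  have "{x - a |x. x \<in> K} = (\<lambda>x. x - a) ` K" by auto
  moreover have "continuous_map weak_topology weak_topology (\<lambda>x. x - a)"
  proof (unfold weak_topology_def, rule continuous_on_generated_topo, fold weak_topology_def)
    fix U assume "U \<in> {blinfun_apply \<phi> -` V |(\<phi> :: 'a \<Rightarrow>\<^sub>L real) V. open V}"
    then obtain \<phi> :: "'a \<Rightarrow>\<^sub>L real" and V where V: "U = blinfun_apply \<phi> -` V" "open V" by blast
    have "(\<lambda>x. x - a) -` U \<inter> topspace weak_topology = blinfun_apply \<phi> -` ((\<lambda>r. r - \<phi> a) -` V)"
      unfolding V(1) topspace_weak_topology by (simp add: vimage_def blinfun.diff_right)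
    moreover have "open ((\<lambda>r. r - \<phi> a) -` V)"
      using V(2) by (intro open_vimage continuous_intros)
    moreover have "openin weak_topology (blinfun_apply \<phi> -` W)" if "open W" for W
      unfolding weak_topology_def using that by (intro topology_generated_by_Basis) blast
    ultimately show "openin weak_topology ((\<lambda>x. x - a) -` U \<inter> topspace weak_topology)" by simp
  next
    show "(\<lambda>x. x - a) ` topspace weak_topology \<subseteq> \<Union> {blinfun_apply \<phi> -` V |(\<phi> :: 'a \<Rightarrow>\<^sub>L real) V. open V}"
      using topspace_weak_topology unfolding weak_topology_def topology_generated_by_topspace by blast
  qed
  ultimately show ?thesis
    using assms image_compactin[of weak_topology K weak_topology "\<lambda>x. x - a"]
    by (auto simp: cwk_def convex_translation_subtract_eq)
qed

subsection \<open>Dentability and strongly exposed points\<close>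

text \<open>If \<open>supp K\<close> is attained near \<open>x\<close> for all functionals close to \<open>\<phi>\<close>, then perturbing \<open>\<phi>\<close> by a functional
  that norms \<open>y - x\<close> shows that the slice of \<open>K\<close> cut by \<open>\<phi>\<close> itself is small.\<close>

lemma small_slice_of_local_maximizers:
  fixes K :: "'a::real_normed_vector set"
  assumes K: "bounded K" and r: "0 < r"
    and max: "\<And>\<phi>. dist \<phi>0 \<phi> \<le> r \<Longrightarrow> \<exists>z\<in>K. dist z x \<le> e \<and> blinfun_apply \<phi> z = supp K \<phi>"
    and y: "y \<in> K" "supp K \<phi>0 - r * e < \<phi>0 y"
  shows "dist y x \<le> 2 * e"
proof -
  obtain \<eta> :: "'a \<Rightarrow>\<^sub>L real" where \<eta>: "norm \<eta> \<le> 1" "\<eta> (y - x) = norm (y - x)"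
    using norming_functional by blast
  define \<phi> where "\<phi> = \<phi>0 + r *\<^sub>R \<eta>"
  have "dist \<phi>0 \<phi> \<le> r" using \<eta>(1) r by (simp add: \<phi>_def dist_norm mult_left_le)
  then obtain z where z: "z \<in> K" "dist z x \<le> e" "\<phi> z = supp K \<phi>" using max by blast
  have "\<eta> (z - x) \<le> 1 * norm (z - x)" by (rule blinfun_le_norm[OF \<eta>(1)])
  then have "\<eta> (z - x) \<le> e" using z(2) by (simp add: dist_norm)
  then have 1: "r * \<eta> (z - x) \<le> r * e" using r by (intro mult_left_mono) auto
  have "\<phi> y \<le> \<phi> z" using supp_upper[OF K y(1)] z(3) by simp
  then have "\<phi>0 y + r * \<eta> y \<le> \<phi>0 z + r * \<eta> z"
    by (simp add: \<phi>_def blinfun.add_left blinfun.scaleR_left)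
  moreover have "\<phi>0 z \<le> supp K \<phi>0" by (rule supp_upper[OF K z(1)])
  ultimately have "r * norm (y - x) < r * (2 * e)"
    using 1 y(2) unfolding \<eta>(2)[symmetric] by (simp add: blinfun.diff_right algebra_simps)
  then show ?thesis using r by (simp add: dist_norm)
qed

text \<open>Every functional attains its maximum over \<open>K\<close> in one of countably many
  balls. By Baire's theorem one ball serves all functionals near some \<open>\<phi>\<close>, and
  then the points of a slice of \<open>K\<close> by \<open>\<phi>\<close> are within
  \<open>2 * e\<close> of the centre of that ball.\<close>

lemma cwk_slice_of_countable_cover:
  fixes K :: "'a::banach set" and x :: "nat \<Rightarrow> 'a"
  assumes K: "K \<in> cwk" and cover: "K \<subseteq> (\<Union>n. cball (x n) e)" and e: "0 < e"
  obtains \<phi> :: "'a \<Rightarrow>\<^sub>L real" and c where "c < supp K \<phi>"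
    "\<And>y z. y \<in> K \<Longrightarrow> z \<in> K \<Longrightarrow> c < \<phi> y \<Longrightarrow> c < \<phi> z \<Longrightarrow> dist y z \<le> 4 * e"
proof -
  have bK: "bounded K" by (rule cwk_bounded[OF K])
  define L where "L n = K \<inter> cball (x n) e" for n
  have L: "L n \<in> cwk" if "L n \<noteq> {}" for n
    unfolding L_def
  proof (rule cwk_Int_closed_convex[OF K])
    show "cball (x n) e \<in> bounded_convex" using e by (simp add: bounded_convex_def)
  qed (use that in \<open>auto simp: L_def\<close>)
  define F where "F n = {\<phi>. L n \<noteq> {} \<and> supp (L n) \<phi> = supp K \<phi>}" for n
  have "closed (F n)" for n
  proof (cases "L n = {}")
    case False
    have "closed {\<phi>. supp (L n) \<phi> = supp K \<phi>}"
      using cwk_bounded_convex[OF K] cwk_bounded_convex[OF L[OF False]]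
      by (intro closed_Collect_eq continuous_supp) (auto simp: bounded_convex_def)
    then show ?thesis using False by (simp add: F_def)
  qed (simp add: F_def)
  moreover have "(\<Union>n. F n) = UNIV"
  proof -
    have "\<exists>n. \<phi> \<in> F n" for \<phi> :: "'a \<Rightarrow>\<^sub>L real"
    proof -
      obtain y where y: "y \<in> K" "\<And>z. z \<in> K \<Longrightarrow> \<phi> z \<le> \<phi> y" by (rule cwk_attains_max[OF K]) blast
      obtain n where "y \<in> cball (x n) e" using cover y(1) by blast
      then have yL: "y \<in> L n" using y(1) by (simp add: L_def)
      have bL: "bounded (L n)" using bK by (auto simp: L_def intro: bounded_subset)
      have "supp K \<phi> \<le> \<phi> y" using y by (intro supp_least) auto
      also have "\<phi> y \<le> supp (L n) \<phi>" by (rule supp_upper[OF bL yL])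
      finally have "supp (L n) \<phi> = supp K \<phi>"
        using yL supp_mono[of "L n" K \<phi>] bK by (force simp: L_def)
      then show ?thesis using yL by (auto simp: F_def)
    qed
    then show ?thesis by blast
  qed
  ultimately obtain n \<phi> r where r: "0 < r" "cball \<phi> r \<subseteq> F n"
    by (rule Baire_closed_cover)
  have max: "\<exists>z\<in>K. dist z (x n) \<le> e \<and> blinfun_apply \<psi> z = supp K \<psi>" if "dist \<phi> \<psi> \<le> r" for \<psi>
  proof -
    have "\<psi> \<in> F n" using that r(2) by auto
    then have ne: "L n \<noteq> {}" and eq: "supp (L n) \<psi> = supp K \<psi>" by (auto simp: F_def)
    obtain z where z: "z \<in> L n" "\<And>y. y \<in> L n \<Longrightarrow> \<psi> y \<le> \<psi> z"
      by (rule cwk_attains_max[OF L[OF ne]]) blast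
    have "supp (L n) \<psi> \<le> \<psi> z" using ne z(2) by (intro supp_least) auto
    then have "\<psi> z = supp K \<psi>"
      using eq supp_upper[OF bK, of z \<psi>] z(1) by (simp add: L_def)
    then show ?thesis using z(1) by (auto simp: L_def dist_commute)
  qed
  show ?thesis
  proof (rule that)
    show "supp K \<phi> - r * e < supp K \<phi>" using r e by simp
    fix y z assume *: "y \<in> K" "z \<in> K" "supp K \<phi> - r * e < \<phi> y" "supp K \<phi> - r * e < \<phi> z"
    have "dist y (x n) \<le> 2 * e" "dist z (x n) \<le> 2 * e"
      using * by (auto intro!: small_slice_of_local_maximizers[OF bK r(1) max])
    then show "dist y z \<le> 4 * e" using dist_triangle2[of y z "x n"] by simp
  qed
qed

text \<open>All finite rational combinations are taken, convex or not: only a countable set with the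
  hull in its closure is wanted.\<close>

lemma countable_dense_in_hull:
  fixes D :: "'a::real_normed_vector set"
  assumes "countable D"
  obtains R where "countable R" "convex hull D \<subseteq> closure R"
proof -
  define R where "R = (\<lambda>l. sum_list (map (\<lambda>(q, x). q *\<^sub>R x) l)) ` lists (\<rat> \<times> D)"
  have cR: "countable R"
    unfolding R_def using assms countable_rat by (intro countable_image countable_lists countable_SIGMA)
  have "0 = sum_list (map (\<lambda>(q, x). q *\<^sub>R x) ([] :: (real \<times> 'a) list))" by simp
  then have zero: "0 \<in> R" unfolding R_def by (intro image_eqI[of _ _ "[]"]) auto
  have add: "a + b \<in> R" if ab: "a \<in> R" "b \<in> R" for a b
  proof -
    obtain l l' where l: "a = sum_list (map (\<lambda>(q, x). q *\<^sub>R x) l)" "l \<in> lists (\<rat> \<times> D)"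
        "b = sum_list (map (\<lambda>(q, x). q *\<^sub>R x) l')" "l' \<in> lists (\<rat> \<times> D)"
      using ab unfolding R_def by blast
    show ?thesis unfolding R_def by (rule image_eqI[of _ _ "l @ l'"]) (use l in auto)
  qed
  have cl_add: "a + b \<in> closure R" if "a \<in> closure R" "b \<in> closure R" for a b
  proof -
    have "a + b \<in> closure R + closure R" using that by (rule set_plus_intro)
    also have "\<dots> \<subseteq> closure (R + R)" by (rule closure_sum)
    also have "\<dots> \<subseteq> closure R" using add by (intro closure_mono) (auto simp: set_plus_def)
    finally show ?thesis .
  qed
  have scale: "r *\<^sub>R x \<in> closure R" if x: "x \<in> D" for r x
  proof -
    have "closed {r. r *\<^sub>R x \<in> closure R}"
      using continuous_closed_vimage[OF closed_closure, of "\<lambda>r. r *\<^sub>R x" R]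
      by (simp add: vimage_def)
    moreover have "\<rat> \<subseteq> {r. r *\<^sub>R x \<in> closure R}"
    proof
      fix q :: real assume "q \<in> \<rat>"
      then have "q *\<^sub>R x \<in> R"
        unfolding R_def using x by (intro image_eqI[of _ _ "[(q, x)]"]) auto
      then show "q \<in> {r. r *\<^sub>R x \<in> closure R}" using closure_subset by blast
    qed
    ultimately have "closure \<rat> \<subseteq> {r. r *\<^sub>R x \<in> closure R}" by (rule closure_minimal[rotated])
    moreover have "r \<in> closure \<rat>"
      unfolding closure_approachable
    proof (intro allI impI)
      fix e :: real assume "0 < e"
      then obtain q where "q \<in> \<rat>" "r < q" "q < r + e" using Rats_dense_in_real[of r "r + e"] by auto
      then show "\<exists>q\<in>\<rat>. dist q r < e" by (intro bexI[of _ q]) (auto simp: dist_real_def)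
    qed
    ultimately show ?thesis by blast
  qed
  have "(\<Sum>v\<in>S. u v *\<^sub>R v) \<in> closure R" if "finite S" "S \<subseteq> D" for S and u :: "'a \<Rightarrow> real"
    using that
  proof (induction S rule: finite_induct)
    case empty
    then show ?case using zero closure_subset by auto
  qed (auto intro: cl_add scale)
  then have "convex hull D \<subseteq> closure R"
    unfolding convex_hull_explicit by blast
  with cR show ?thesis by (rule that)
qed

text \<open>The separable reduction in the proof of dentability: countably many rounds of adding
  countable sets.\<close>

lemma countable_set_closed_under:
  assumes T: "\<And>x. x \<in> D \<Longrightarrow> countable (T x)" "\<And>x. x \<in> D \<Longrightarrow> T x \<subseteq> D" and d: "d \<in> D"
  obtains E where "countable E" "d \<in> E" "E \<subseteq> D" "\<And>x. x \<in> E \<Longrightarrow> T x \<subseteq> E"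
proof -
  define E where "E = rec_nat {d} (\<lambda>_ A. A \<union> (\<Union>x\<in>A. T x))"
  have E0: "E 0 = {d}" and ES: "E (Suc n) = E n \<union> (\<Union>x\<in>E n. T x)" for n
    by (simp_all add: E_def)
  have E: "countable (E n) \<and> E n \<subseteq> D" for n
  proof (induction n)
    case (Suc n)
    then have "countable (\<Union>x\<in>E n. T x)" using T(1) by (intro countable_UN) auto
    with Suc show ?case using T(2) by (auto simp: ES)
  qed (simp add: E0 d)
  show ?thesis
  proof (rule that)
    show "countable (\<Union>n. E n)" using E by (intro countable_UN) auto
    show "d \<in> (\<Union>n. E n)" using E0 by blast
    show "(\<Union>n. E n) \<subseteq> D" using E by blast
    show "T x \<subseteq> (\<Union>n. E n)" if "x \<in> (\<Union>n. E n)" for x using that ES by blast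
  qed
qed

text \<open>If every slice of \<open>D\<close> were wider than \<open>e\<close>, each point of
  \<open>D\<close> would lie in the closed hull of countably many companions in \<open>D\<close> at
  distance above \<open>e / 2\<close>. A countable \<open>E\<close> containing the companions of all
  its points has a separable closed hull \<open>K0\<close>, in which Baire's theorem cuts a narrow
  slice. A point of \<open>E\<close> in that slice has all companions outside it, so it cannot lie
  in their closed hull.\<close>

theorem cwk_dentable:
  fixes K :: "'a::banach set"
  assumes K: "K \<in> cwk" and D: "D \<subseteq> K" "D \<noteq> {}" and e: "0 < e"
  obtains \<phi> :: "'a \<Rightarrow>\<^sub>L real" and c x where "x \<in> D" "c < \<phi> x"
    "\<And>y z. y \<in> D \<Longrightarrow> z \<in> D \<Longrightarrow> c < \<phi> y \<Longrightarrow> c < \<phi> z \<Longrightarrow> dist y z \<le> e"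
proof (rule ccontr)
  assume neg: "\<not> thesis"
  note slice = that
  have no_slice: "\<exists>y\<in>D. \<exists>z\<in>D. c < \<phi> y \<and> c < \<phi> z \<and> e < dist y z"
    if "x \<in> D" "c < \<phi> x" for \<phi> :: "'a \<Rightarrow>\<^sub>L real" and c x
  proof (rule ccontr)
    assume "\<not> ?thesis"
    then have "dist y z \<le> e" if "y \<in> D" "z \<in> D" "c < \<phi> y" "c < \<phi> z" for y z
      using that by (meson not_le)
    from slice[OF that this] neg show False by simp
  qed
  define B where "B x = {y \<in> D. e / 2 < dist x y}" for x
  have "\<exists>C. countable C \<and> C \<subseteq> B x \<and> x \<in> closure (convex hull C)" if x: "x \<in> D" for x
  proof -
    have small: "dist y z \<le> e" if "y \<in> D - B x" "z \<in> D - B x" for y z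
    proof -
      have "dist x y \<le> e / 2" "dist x z \<le> e / 2" using that by (auto simp: B_def)
      then show ?thesis using dist_triangle3[of y z x] by simp
    qed
    \<comment> \<open>The zero functional with threshold \<open>-1\<close> cuts out all of
      \<open>D\<close>, which is therefore too wide to lie within \<open>e / 2\<close> of
      \<open>x\<close>.\<close>
    have B: "convex hull B x \<noteq> {}"
      using no_slice[OF x, of "-1" 0] small by fastforce
    have 0: "infdist x (convex hull B x) = 0"
    proof (rule ccontr)
      assume "infdist x (convex hull B x) \<noteq> 0"
      then have pos: "0 < infdist x (convex hull B x)" using infdist_nonneg[of x "convex hull B x"] by simp
      obtain \<phi> :: "'a \<Rightarrow>\<^sub>L real" where
        \<phi>: "\<And>b. b \<in> convex hull B x \<Longrightarrow> infdist x (convex hull B x) \<le> \<phi> x - \<phi> b"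
        by (rule convex_separation_infdist[OF convex_convex_hull B, of x]) blast
      obtain y z where yz: "y \<in> D" "z \<in> D" "e < dist y z"
          "\<phi> x - infdist x (convex hull B x) < \<phi> y" "\<phi> x - infdist x (convex hull B x) < \<phi> z"
        using no_slice[OF x, of "\<phi> x - infdist x (convex hull B x)" \<phi>] pos by auto
      \<comment> \<open>By the margin, \<open>B x\<close> stays outside the slice; a wide slice
        would thus consist of points within \<open>e / 2\<close> of \<open>x\<close>, hence within
        \<open>e\<close> of each other.\<close>
      have "y \<notin> B x" "z \<notin> B x"
        using \<phi>[of y] \<phi>[of z] yz(4,5) hull_inc[of _ "B x" convex] by force+
      then show False using small[of y z] yz by auto
    qed
    have "\<exists>C. finite C \<and> C \<subseteq> B x \<and> (\<exists>z\<in>convex hull C. dist x z < inverse (Suc k))" for k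
    proof -
      have "(INF z\<in>convex hull B x. dist x z) < inverse (real (Suc k))"
        using 0 B by (simp add: infdist_def)
      then obtain z where z: "z \<in> convex hull B x" "dist x z < inverse (real (Suc k))"
        using cInf_lessD[of "dist x ` (convex hull B x)"] B by auto
      obtain C u where C: "finite C" "C \<subseteq> B x" "\<forall>v\<in>C. 0 \<le> u v" "sum u C = (1::real)"
          "(\<Sum>v\<in>C. u v *\<^sub>R v) = z"
        using z(1) unfolding convex_hull_explicit by blast
      then have "z \<in> convex hull C"
        unfolding convex_hull_explicit by blast
      then show ?thesis using C z(2) by blast
    qed
    then obtain C where C: "\<And>k. finite (C k)" "\<And>k. C k \<subseteq> B x"
        "\<And>k. \<exists>z\<in>convex hull C k. dist x z < inverse (Suc k)"
      by metis
    have "x \<in> closure (convex hull (\<Union>k. C k))"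
      unfolding closure_approachable
    proof (intro allI impI)
      fix d :: real assume "0 < d"
      then obtain k where k: "inverse (real (Suc k)) < d" using reals_Archimedean by blast
      obtain z where "z \<in> convex hull C k" "dist x z < inverse (real (Suc k))" using C(3) by blast
      moreover have "convex hull C k \<subseteq> convex hull (\<Union>k. C k)" by (intro hull_mono) blast
      ultimately show "\<exists>y\<in>convex hull (\<Union>k. C k). dist y x < d"
        using k by (intro bexI[of _ z]) (auto simp: dist_commute)
    qed
    moreover have "countable (\<Union>k. C k)" using C(1) by (intro countable_UN) (auto intro: countable_finite)
    ultimately show ?thesis using C(2) by blast
  qed
  then obtain T where T: "\<And>x. x \<in> D \<Longrightarrow> countable (T x)" "\<And>x. x \<in> D \<Longrightarrow> T x \<subseteq> B x"
      "\<And>x. x \<in> D \<Longrightarrow> x \<in> closure (convex hull T x)"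
    by metis
  obtain d where d: "d \<in> D" using D(2) by blast
  have TD: "T x \<subseteq> D" if "x \<in> D" for x using T(2)[OF that] by (auto simp: B_def)
  obtain E where E: "countable E" "d \<in> E" "E \<subseteq> D" "\<And>x. x \<in> E \<Longrightarrow> T x \<subseteq> E"
    using countable_set_closed_under[of D T d, OF T(1) TD d] by blast
  define K0 where "K0 = closure (convex hull E)"
  have sub: "E \<subseteq> K0" unfolding K0_def by (rule order_trans[OF hull_subset closure_subset])
  have "convex hull E \<subseteq> K" using E(3) D(1) K by (intro hull_minimal) (auto simp: cwk_def)
  then have K0K: "K0 \<subseteq> K" unfolding K0_def using cwk_closed[OF K] by (rule closure_minimal)
  have K0: "K0 \<in> cwk"
    using E(2) sub by (intro cwk_closed_convex_subset[OF K K0K])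
      (auto simp: K0_def intro: convex_closure)
  obtain R where R: "countable R" "convex hull E \<subseteq> closure R"
    by (rule countable_dense_in_hull[OF E(1)])
  have K0R: "K0 \<subseteq> closure R" unfolding K0_def using R(2) by (intro closure_minimal) auto
  then have "R \<noteq> {}" using E(2) sub by auto
  then have rangeR: "range (from_nat_into R) = R" using R(1) by (rule range_from_nat_into)
  \<comment> \<open>With radius \<open>e / 16\<close> the slice has diameter at most
    \<open>e / 4\<close>, less than the distance \<open>e / 2\<close> to the companions.\<close>
  have "K0 \<subseteq> (\<Union>n. cball (from_nat_into R n) (e / 16))"
  proof
    fix y assume "y \<in> K0"
    then obtain z where "z \<in> R" "dist z y < e / 16"
      using K0R e closure_approachable[of y R] by (meson divide_pos_pos subsetD zero_less_numeral)
    moreover from this(1) obtain n where "z = from_nat_into R n" using rangeR by (metis rangeE)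
    ultimately show "y \<in> (\<Union>n. cball (from_nat_into R n) (e / 16))"
      by (intro UN_I[of n]) auto
  qed
  then obtain \<phi> :: "'a \<Rightarrow>\<^sub>L real" and c where c: "c < supp K0 \<phi>" and
    sl: "\<And>y z. y \<in> K0 \<Longrightarrow> z \<in> K0 \<Longrightarrow> c < \<phi> y \<Longrightarrow> c < \<phi> z \<Longrightarrow> dist y z \<le> 4 * (e / 16)"
    using e by (elim cwk_slice_of_countable_cover[OF K0]) auto
  obtain x where x: "x \<in> E" "c < \<phi> x"
  proof (rule ccontr)
    assume "\<not> thesis"
    then have "E \<subseteq> {x. \<phi> x \<le> c}" using \<open>\<not> thesis\<close> that by (force simp: not_less)
    moreover have "convex {x. \<phi> x \<le> c}"
      by (auto simp: convex_def blinfun.add_right blinfun.scaleR_right intro!: convex_bound_le)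
    moreover have "closed {x. \<phi> x \<le> c}" by (intro closed_Collect_le continuous_intros)
    ultimately have "K0 \<subseteq> {x. \<phi> x \<le> c}" unfolding K0_def by (intro closure_minimal hull_minimal)
    then have "supp K0 \<phi> \<le> c" using E(2) sub by (intro supp_least) auto
    then show False using c by simp
  qed
  have xD: "x \<in> D" using x(1) E(3) by blast
  have "T x \<subseteq> {y. \<phi> y \<le> c}"
  proof
    fix y assume y: "y \<in> T x"
    then have "e / 2 < dist x y" using T(2)[OF xD] by (auto simp: B_def)
    moreover have "y \<in> K0" using y E(4)[OF x(1)] sub by blast
    ultimately show "y \<in> {y. \<phi> y \<le> c}" using sl[of x y] x sub e by force
  qed
  moreover have "convex {x. \<phi> x \<le> c}"
    by (auto simp: convex_def blinfun.add_right blinfun.scaleR_right intro!: convex_bound_le)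
  moreover have "closed {x. \<phi> x \<le> c}" by (intro closed_Collect_le continuous_intros)
  ultimately have "closure (convex hull T x) \<subseteq> {x. \<phi> x \<le> c}" by (intro closure_minimal hull_minimal)
  then show False using T(3)[OF xD] x(2) by auto
qed

text \<open>\<open>U e\<close> collects the functionals with a slice of diameter at most
  \<open>e\<close>. It is open because on a bounded \<open>K\<close> a small change of the
  functional changes its values little, and dense by dentability. A functional in \<open>U e\<close>
  for all small \<open>e\<close> strongly exposes the point where it is maximal.\<close>

theorem cwk_strongly_exposed:
  fixes K :: "'a::banach set"
  assumes K: "K \<in> cwk"
  obtains \<phi> :: "'a \<Rightarrow>\<^sub>L real" and x where "x \<in> K" "\<phi> x = supp K \<phi>"
    "\<And>e. 0 < e \<Longrightarrow> \<exists>\<alpha>>0. \<forall>y\<in>K. supp K \<phi> - \<alpha> < \<phi> y \<longrightarrow> dist y x \<le> e"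
proof -
  have bK: "bounded K" and neK: "K \<noteq> {}" using cwk_bounded_convex[OF K] by (auto simp: bounded_convex_def)
  obtain M where M: "0 < M" "\<And>x. x \<in> K \<Longrightarrow> norm x \<le> M" using bK bounded_pos by blast
  have diff: "\<phi> x \<le> \<psi> x + M * dist \<phi> \<psi>" if "x \<in> K" for x and \<phi> \<psi> :: "'a \<Rightarrow>\<^sub>L real"
  proof -
    have "(\<phi> - \<psi>) x \<le> dist \<phi> \<psi> * norm x" using blinfun_le_norm[of "\<phi> - \<psi>" _ x] by (simp add: dist_norm)
    also have "\<dots> \<le> dist \<phi> \<psi> * M" using M(2)[OF that] by (intro mult_left_mono) auto
    finally show ?thesis by (simp add: blinfun.diff_left algebra_simps)
  qed
  have supp_diff: "supp K \<phi> \<le> supp K \<psi> + M * dist \<phi> \<psi>" for \<phi> \<psi>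
  proof (rule supp_least[OF neK])
    fix x assume "x \<in> K"
    then show "\<phi> x \<le> supp K \<psi> + M * dist \<phi> \<psi>"
      using diff[of x \<phi> \<psi>] supp_upper[OF bK, of x \<psi>] by simp
  qed
  define Q where "Q e \<alpha> \<phi> \<longleftrightarrow> (\<forall>x\<in>K. \<forall>y\<in>K. supp K \<phi> - \<alpha> < \<phi> x \<longrightarrow> supp K \<phi> - \<alpha> < \<phi> y \<longrightarrow> dist x y \<le> e)"
    for e \<alpha> and \<phi> :: "'a \<Rightarrow>\<^sub>L real"
  define U where "U e = {\<phi>. \<exists>\<alpha>>0. Q e \<alpha> \<phi>}" for e
  have open_U: "open (U e)" for e
    unfolding open_dist
  proof (intro ballI)
    fix \<phi> assume "\<phi> \<in> U e"
    then obtain \<alpha> where \<alpha>: "0 < \<alpha>" "Q e \<alpha> \<phi>" by (auto simp: U_def)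
    have "\<psi> \<in> U e" if \<psi>: "dist \<psi> \<phi> < \<alpha> / (4 * M)" for \<psi>
    proof -
      have M4: "M * dist \<psi> \<phi> < \<alpha> / 4" using \<psi> M(1) by (simp add: field_simps)
      have "supp K \<phi> - \<alpha> < \<phi> x" if "x \<in> K" "supp K \<psi> - \<alpha> / 2 < \<psi> x" for x
        using diff[OF that(1), of \<psi> \<phi>] supp_diff[of \<phi> \<psi>] that(2) M4 by (simp add: dist_commute)
      then have "Q e (\<alpha> / 2) \<psi>" using \<alpha>(2) unfolding Q_def by blast
      then show ?thesis using \<alpha>(1) unfolding U_def by (intro CollectI exI[of _ "\<alpha> / 2"]) simp
    qed
    then show "\<exists>d>0. \<forall>\<psi>. dist \<psi> \<phi> < d \<longrightarrow> \<psi> \<in> U e"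
      using \<alpha>(1) M(1) by (intro exI[of _ "\<alpha> / (4 * M)"]) auto
  qed
  have dense_U: "closure (U e) = UNIV" if e: "0 < e" for e
  proof -
    have "\<exists>\<psi>\<in>U e. dist \<psi> \<phi>0 < r" if r: "0 < r" for \<phi>0 r
    proof -
      \<comment> \<open>Dentability is applied not to \<open>K\<close> but to the maximizers of
        functionals near \<open>\<phi>0\<close>: after the tilt below, nearby functionals still have
        their maximizers in \<open>D\<close>, and in its narrow slice.\<close>
      define D where "D = {x\<in>K. \<exists>\<phi>. dist \<phi> \<phi>0 < r \<and> \<phi> x = supp K \<phi>}"
      have attained: "\<exists>y\<in>K. \<phi> y = supp K \<phi>" for \<phi> :: "'a \<Rightarrow>\<^sub>L real"
      proof -
        obtain y where y: "y \<in> K" "\<And>z. z \<in> K \<Longrightarrow> \<phi> z \<le> \<phi> y" by (rule cwk_attains_max[OF K]) blast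
        have "supp K \<phi> \<le> \<phi> y" by (rule supp_least[OF neK y(2)])
        then show ?thesis using supp_upper[OF bK y(1), of \<phi>] y(1) by force
      qed
      have D: "D \<subseteq> K" "D \<noteq> {}" using attained[of \<phi>0] r by (force simp: D_def)+
      have e4: "0 < e / 4" using e by simp
      obtain \<psi> :: "'a \<Rightarrow>\<^sub>L real" and c x where x: "x \<in> D" "c < \<psi> x" and
        sl: "\<And>y z. y \<in> D \<Longrightarrow> z \<in> D \<Longrightarrow> c < \<psi> y \<Longrightarrow> c < \<psi> z \<Longrightarrow> dist y z \<le> e / 4"
        by (rule cwk_dentable[OF K D e4]) blast
      obtain \<phi> where \<phi>: "dist \<phi> \<phi>0 < r" "\<phi> x = supp K \<phi>" using x(1) by (auto simp: D_def)
      have xK: "x \<in> K" using x(1) by (simp add: D_def)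
      \<comment> \<open>The tilt by \<open>t *\<^sub>R \<psi>\<close> uses at most half of the room
        that \<open>\<phi>\<close> has in the ball of radius \<open>r\<close> around
        \<open>\<phi>0\<close>.\<close>
      define t where "t = (r - dist \<phi> \<phi>0) / (2 * (norm \<psi> + 1))"
      have n1: "0 < norm \<psi> + 1" using norm_ge_zero[of \<psi>] by linarith
      have t: "0 < t" using \<phi>(1) n1 by (simp add: t_def)
      define \<phi>' where "\<phi>' = \<phi> + t *\<^sub>R \<psi>"
      have "dist \<phi>' \<phi> = t * norm \<psi>" using t by (simp add: \<phi>'_def dist_norm)
      also have "\<dots> \<le> t * (norm \<psi> + 1)" using t by simp
      also have "\<dots> = (r - dist \<phi> \<phi>0) / 2" using n1 by (simp add: t_def field_simps)
      finally have near: "dist \<phi>' \<phi>0 + (r - dist \<phi> \<phi>0) / 2 \<le> r"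
        using dist_triangle[of \<phi>' \<phi>0 \<phi>] by (simp add: field_simps)
      \<comment> \<open>The first bound keeps all functionals within \<open>\<rho>\<close> of
        \<open>\<phi>'\<close> inside the ball around \<open>\<phi>0\<close>. The second keeps the
        perturbation error \<open>2 * (M * \<rho>)\<close> below \<open>t * (\<psi> x - c)\<close>,
        so that their maximizers lie in the slice of \<open>D\<close>.\<close>
      define \<rho> where "\<rho> = min ((r - dist \<phi> \<phi>0) / 4) (t * (\<psi> x - c) / (4 * M))"
      have \<rho>: "0 < \<rho>" "\<rho> \<le> (r - dist \<phi> \<phi>0) / 4" "\<rho> \<le> t * (\<psi> x - c) / (4 * M)"
      proof -
        show "0 < \<rho>" using \<phi>(1) t x(2) M(1) by (simp add: \<rho>_def)
      qed (simp_all only: \<rho>_def min.cobounded1 min.cobounded2)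
      have \<rho>M: "2 * (M * \<rho>) < t * (\<psi> x - c)"
      proof -
        have "0 < t * (\<psi> x - c)" using t x(2) by simp
        moreover have "4 * (M * \<rho>) \<le> t * (\<psi> x - c)" using \<rho>(3) M(1) by (simp add: field_simps)
        ultimately show ?thesis by simp
      qed
      have max: "\<exists>z\<in>K. dist z x \<le> e / 4 \<and> blinfun_apply \<eta> z = supp K \<eta>" if \<eta>: "dist \<phi>' \<eta> \<le> \<rho>" for \<eta>
      proof -
        obtain z where z: "z \<in> K" "\<eta> z = supp K \<eta>" using attained by blast
        have "dist \<eta> \<phi>0 < r"
          using dist_triangle[of \<eta> \<phi>0 \<phi>'] \<eta>[unfolded dist_commute[of \<phi>']] near \<rho>(2) \<phi>(1) by argo
        then have zD: "z \<in> D" using z by (auto simp: D_def)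
        have "M * dist \<phi>' \<eta> \<le> M * \<rho>" using \<eta> M(1) by (intro mult_left_mono) auto
        moreover have "supp K \<phi>' \<le> supp K \<eta> + M * dist \<phi>' \<eta>" by (rule supp_diff)
        moreover have "\<eta> z \<le> \<phi>' z + M * dist \<phi>' \<eta>" using diff[OF z(1), of \<eta> \<phi>'] by (simp add: dist_commute)
        moreover have "\<phi>' x \<le> supp K \<phi>'" by (rule supp_upper[OF bK xK])
        moreover have "\<phi> z \<le> \<phi> x" using supp_upper[OF bK z(1), of \<phi>] \<phi>(2) by simp
        ultimately have "t * \<psi> x \<le> t * \<psi> z + 2 * (M * \<rho>)"
          using z(2) by (simp add: \<phi>'_def blinfun.add_left blinfun.scaleR_left)
        with \<rho>M have "t * c < t * \<psi> z" by (simp add: right_diff_distrib)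
        then have "c < \<psi> z" using t by simp
        then show ?thesis using sl[OF zD x(1)] x(2) z by blast
      qed
      have near_x: "dist y x \<le> 2 * (e / 4)" if "y \<in> K" "supp K \<phi>' - \<rho> * (e / 4) < \<phi>' y" for y
        by (rule small_slice_of_local_maximizers[OF bK \<rho>(1) max that])
      have "Q e (\<rho> * (e / 4)) \<phi>'"
        unfolding Q_def
      proof (intro ballI impI)
        fix y z
        assume "y \<in> K" "z \<in> K" "supp K \<phi>' - \<rho> * (e / 4) < \<phi>' y" "supp K \<phi>' - \<rho> * (e / 4) < \<phi>' z"
        then show "dist y z \<le> e"
          using near_x[of y] near_x[of z] dist_triangle2[of y z x] by simp
      qed
      then have "\<phi>' \<in> U e" using \<rho>(1) e by (auto simp: U_def intro!: exI[of _ "\<rho> * (e / 4)"])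
      moreover have "dist \<phi>' \<phi>0 < r" using near \<phi>(1) by argo
      ultimately show ?thesis by blast
    qed
    then show ?thesis by (auto simp: closure_approachable)
  qed
  have "euclidean closure_of \<Inter>(range (\<lambda>n. U (inverse (real (Suc n))))) = topspace (euclidean :: ('a \<Rightarrow>\<^sub>L real) topology)"
    using open_U dense_U by (intro Baire_category) (auto simp: completely_metrizable_space_euclidean)
  then have "(\<Inter>n. U (inverse (real (Suc n)))) \<noteq> {}" by force
  then obtain \<phi> where \<phi>: "\<And>n. \<phi> \<in> U (inverse (real (Suc n)))" by blast
  obtain x where x: "x \<in> K" "\<And>z. z \<in> K \<Longrightarrow> \<phi> z \<le> \<phi> x" by (rule cwk_attains_max[OF K]) blast
  have \<phi>x: "\<phi> x = supp K \<phi>"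
    using supp_least[OF neK x(2)] supp_upper[OF bK x(1), of \<phi>] by force
  have "\<exists>\<alpha>>0. \<forall>y\<in>K. supp K \<phi> - \<alpha> < \<phi> y \<longrightarrow> dist y x \<le> e" if "0 < e" for e
  proof -
    obtain n where n: "inverse (real (Suc n)) < e" using reals_Archimedean[OF \<open>0 < e\<close>] by blast
    obtain \<alpha> where \<alpha>: "0 < \<alpha>" "Q (inverse (real (Suc n))) \<alpha> \<phi>" using \<phi>[of n] unfolding U_def by blast
    have "dist y x \<le> e" if "y \<in> K" "supp K \<phi> - \<alpha> < \<phi> y" for y
    proof -
      have "dist y x \<le> inverse (real (Suc n))"
        using \<alpha> that x(1) \<phi>x unfolding Q_def by simp
      then show ?thesis using n by simp
    qed
    then show ?thesis using \<alpha>(1) by blast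
  qed
  with x(1) \<phi>x show ?thesis by (rule that)
qed

text \<open>A weak form of the Orlicz--Pettis theorem: adding one far-out term to a finite sum lying in a small slice
  does not leave the slice.\<close>

theorem cwk_finite_sums_small_term:
  fixes x :: "nat \<Rightarrow> 'a::banach"
  assumes K: "K \<in> cwk" and sums: "\<And>F. finite F \<Longrightarrow> (\<Sum>n\<in>F. x n) \<in> K" and e: "0 < e"
  obtains n where "norm (x n) \<le> e"
proof -
  define D where "D = {(\<Sum>n\<in>F. x n) |F. finite F}"
  have D: "D \<subseteq> K" "D \<noteq> {}" using sums by (auto simp: D_def)
  obtain \<phi> :: "'a \<Rightarrow>\<^sub>L real" and c d where d: "d \<in> D" "c < \<phi> d" and
    sl: "\<And>y z. y \<in> D \<Longrightarrow> z \<in> D \<Longrightarrow> c < \<phi> y \<Longrightarrow> c < \<phi> z \<Longrightarrow> dist y z \<le> e"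
    by (rule cwk_dentable[OF K D e]) blast
  obtain F where F: "finite F" "d = (\<Sum>n\<in>F. x n)" using d(1) by (auto simp: D_def)
  define \<delta> where "\<delta> = \<phi> d - c"
  have \<delta>: "0 < \<delta>" using d(2) by (simp add: \<delta>_def)
  \<comment> \<open>Otherwise \<open>- \<phi>\<close> would gain at least \<open>\<delta>\<close>
    with every term outside \<open>F\<close> and be unbounded on finite sums, which all lie in
    \<open>K\<close>.\<close>
  have "\<exists>n. n \<notin> F \<and> - \<delta> < \<phi> (x n)"
  proof (rule ccontr)
    assume none: "\<not> ?thesis"
    obtain N where N: "supp K (- \<phi>) < real N * \<delta>" using reals_Archimedean3[OF \<delta>] by blast
    obtain G where G: "finite G" "card G = N" "G \<subseteq> - F"
      using infinite_arbitrarily_large[of "- F" N] F(1) by (auto simp: finite_compl)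
    have "(\<Sum>n\<in>G. \<phi> (x n)) \<le> (\<Sum>n\<in>G. - \<delta>)" using none G(3) by (intro sum_mono) force
    then have "real N * \<delta> \<le> (- \<phi>) (\<Sum>n\<in>G. x n)"
      using G(2) by (simp add: blinfun.minus_left blinfun.sum_right sum_negf)
    also have "\<dots> \<le> supp K (- \<phi>)" by (rule supp_upper[OF cwk_bounded[OF K] sums[OF G(1)]])
    finally show False using N by simp
  qed
  then obtain n where n: "n \<notin> F" "- \<delta> < \<phi> (x n)" by blast
  have "(\<Sum>k\<in>insert n F. x k) \<in> D" unfolding D_def using F(1) by (intro CollectI exI[of _ "insert n F"]) auto
  then have "d + x n \<in> D" using F n(1) by (simp add: add.commute)
  moreover have "c < \<phi> (d + x n)" using n(2) by (simp add: \<delta>_def blinfun.add_right)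
  ultimately have "dist (d + x n) d \<le> e" by (rule sl[OF _ d(1) _ d(2)])
  then show ?thesis by (intro that[of n]) (simp add: dist_norm)
qed

subsection \<open>The \<open>\<H>\<close>-integral through support functions\<close>

definition perron :: "(real \<Rightarrow> real) \<Rightarrow> (real \<times> real set) set \<Rightarrow> bool" where
  "perron \<delta> p \<longleftrightarrow> p tagged_division_of {0..1} \<and> (\<lambda>t. {t - \<delta> t<..<t + \<delta> t}) fine p"

lemma perron_tag: "perron \<delta> p \<Longrightarrow> (t, I) \<in> p \<Longrightarrow> t \<in> {0..1}"
  unfolding perron_def using tagged_division_ofD(2,3) by blast

lemma perron_finite: "perron \<delta> p \<Longrightarrow> finite p"
  unfolding perron_def using tagged_division_of_finite by blast

lemma perron_mono:
  assumes "perron \<delta> p" "\<And>t. t \<in> {0..1} \<Longrightarrow> \<delta> t \<le> \<delta>' t"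
  shows "perron \<delta>' p"
  unfolding perron_def fine_def
proof (intro conjI ballI, goal_cases)
  case 1
  show ?case using assms(1) by (simp add: perron_def)
next
  case (2 x)
  obtain t I where x: "x = (t, I)" by (cases x)
  have "I \<subseteq> {t - \<delta> t<..<t + \<delta> t}" using assms(1) 2 x by (auto simp: perron_def fine_def)
  moreover have "\<delta> t \<le> \<delta>' t" using assms perron_tag 2 x by blast
  ultimately show ?case using x by force
qed

lemma measurable_gauge_min:
  assumes "measurable_gauge \<delta>" "measurable_gauge \<delta>'"
  shows "measurable_gauge (\<lambda>t. min (\<delta> t) (\<delta>' t))"
  using assms by (auto simp: measurable_gauge_def)

lemma supp_perron_sum:
  assumes "perron \<delta> p" and G: "\<And>t. t \<in> {0..1} \<Longrightarrow> \<Gamma> t \<in> bounded_convex"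
  shows "(\<Sum>(t, I)\<in>p. (*\<^sub>R) (measure lborel I) ` \<Gamma> t) \<in> bounded_convex"
    and "supp (\<Sum>(t, I)\<in>p. (*\<^sub>R) (measure lborel I) ` \<Gamma> t) \<phi> = (\<Sum>(t, I)\<in>p. measure lborel I * supp (\<Gamma> t) \<phi>)"
proof -
  have *: "(*\<^sub>R) (measure lborel (snd x)) ` \<Gamma> (fst x) \<in> bounded_convex \<and>
      supp ((*\<^sub>R) (measure lborel (snd x)) ` \<Gamma> (fst x)) \<phi> = measure lborel (snd x) * supp (\<Gamma> (fst x)) \<phi>"
    if "x \<in> p" for x
  proof -
    have "\<Gamma> (fst x) \<in> bounded_convex" using assms perron_tag[of \<delta> p "fst x" "snd x"] that by simp
    then show ?thesis
      by (intro conjI bounded_convex_scaleR supp_scaleR) (auto simp: bounded_convex_def)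
  qed
  show "(\<Sum>(t, I)\<in>p. (*\<^sub>R) (measure lborel I) ` \<Gamma> t) \<in> bounded_convex"
    using bounded_convex_sum[OF perron_finite[OF assms(1)], of "\<lambda>x. (*\<^sub>R) (measure lborel (snd x)) ` \<Gamma> (fst x)"] *
    by (simp add: case_prod_unfold)
  show "supp (\<Sum>(t, I)\<in>p. (*\<^sub>R) (measure lborel I) ` \<Gamma> t) \<phi> = (\<Sum>(t, I)\<in>p. measure lborel I * supp (\<Gamma> t) \<phi>)"
    using bounded_convex_sum[OF perron_finite[OF assms(1)], of "\<lambda>x. (*\<^sub>R) (measure lborel (snd x)) ` \<Gamma> (fst x)" \<phi>] *
    by (simp add: case_prod_unfold)
qed

lemma sum_mem_set_sum:
  assumes "finite I" "\<And>i. i \<in> I \<Longrightarrow> g i \<in> B i"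
  shows "(\<Sum>i\<in>I. g i) \<in> (\<Sum>i\<in>I. B i)"
  using assms by (induction I rule: finite_induct) (auto simp: set_zero intro: set_plus_intro)

lemma has_H_integralD:
  assumes "has_H_integral \<Gamma> \<Phi>" "0 < \<epsilon>"
  shows "\<exists>\<delta>. measurable_gauge \<delta> \<and> (\<forall>p. perron \<delta> p \<longrightarrow>
    hausdorff_distance \<Phi> (\<Sum>(t, I)\<in>p. (*\<^sub>R) (measure lborel I) ` \<Gamma> t) < \<epsilon>)"
  using assms unfolding has_H_integral_def perron_def by blast

text \<open>One gauge serves the whole dual ball. The inequality is non-strict because strict bounds
  survive a supremum only as non-strict ones; the half in the proof makes up for it.\<close>

lemma has_H_integral_iff_supp:
  assumes G: "\<And>t. t \<in> {0..1} \<Longrightarrow> \<Gamma> t \<in> bounded_convex" and \<Phi>: "\<Phi> \<in> bounded_convex"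
  shows "has_H_integral \<Gamma> \<Phi> \<longleftrightarrow> (\<forall>\<epsilon>>0. \<exists>\<delta>. measurable_gauge \<delta> \<and> (\<forall>p \<phi>. perron \<delta> p \<longrightarrow> norm \<phi> \<le> 1 \<longrightarrow>
    \<bar>supp \<Phi> \<phi> - (\<Sum>(t, I)\<in>p. measure lborel I * supp (\<Gamma> t) \<phi>)\<bar> \<le> \<epsilon>))"
    (is "_ \<longleftrightarrow> ?R")
proof
  assume H: "has_H_integral \<Gamma> \<Phi>"
  show ?R
  proof (intro allI impI)
    fix \<epsilon> :: real assume e: "0 < \<epsilon>"
    obtain \<delta> where \<delta>: "measurable_gauge \<delta>" "\<And>p. perron \<delta> p \<Longrightarrow>
        hausdorff_distance \<Phi> (\<Sum>(t, I)\<in>p. (*\<^sub>R) (measure lborel I) ` \<Gamma> t) < \<epsilon>"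
      using has_H_integralD[OF H e] by blast
    have "\<bar>supp \<Phi> \<phi> - (\<Sum>(t, I)\<in>p. measure lborel I * supp (\<Gamma> t) \<phi>)\<bar> \<le> \<epsilon>"
      if "perron \<delta> p" "norm \<phi> \<le> 1" for p \<phi>
      using abs_supp_diff_le_hausdorff'[OF \<Phi> supp_perron_sum(1)[OF that(1) G] that(2)]
        supp_perron_sum(2)[OF that(1) G] \<delta>(2)[OF that(1)] by fastforce
    with \<delta>(1) show "\<exists>\<delta>. measurable_gauge \<delta> \<and> (\<forall>p \<phi>. perron \<delta> p \<longrightarrow> norm \<phi> \<le> 1 \<longrightarrow>
      \<bar>supp \<Phi> \<phi> - (\<Sum>(t, I)\<in>p. measure lborel I * supp (\<Gamma> t) \<phi>)\<bar> \<le> \<epsilon>)" by blast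
  qed
next
  assume R: ?R
  show "has_H_integral \<Gamma> \<Phi>"
    unfolding has_H_integral_def perron_def[symmetric]
  proof (intro allI impI)
    fix \<epsilon> :: real assume e: "0 < \<epsilon>"
    then have "0 < \<epsilon> / 2" by simp
    then obtain \<delta> where \<delta>: "measurable_gauge \<delta>" "\<And>p \<phi>. perron \<delta> p \<Longrightarrow> norm \<phi> \<le> 1 \<Longrightarrow>
      \<bar>supp \<Phi> \<phi> - (\<Sum>(t, I)\<in>p. measure lborel I * supp (\<Gamma> t) \<phi>)\<bar> \<le> \<epsilon> / 2"
      using R by blast
    have "hausdorff_distance \<Phi> (\<Sum>(t, I)\<in>p. (*\<^sub>R) (measure lborel I) ` \<Gamma> t) < \<epsilon>" if p: "perron \<delta> p" for p
    proof -
      have "hausdorff_distance \<Phi> (\<Sum>(t, I)\<in>p. (*\<^sub>R) (measure lborel I) ` \<Gamma> t) \<le> \<epsilon> / 2"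
        by (rule hausdorff_le[OF \<Phi> supp_perron_sum(1)[OF p G]])
          (use \<delta>(2)[OF p] supp_perron_sum(2)[OF p G] in auto)
      then show ?thesis using e by simp
    qed
    with \<delta>(1) show "\<exists>\<delta>. measurable_gauge \<delta> \<and> (\<forall>p. perron \<delta> p \<longrightarrow>
        hausdorff_distance \<Phi> (\<Sum>(t, I)\<in>p. (*\<^sub>R) (measure lborel I) ` \<Gamma> t) < \<epsilon>)" by blast
  qed
qed

text \<open>The selection picks maximizers of a functional that strongly exposes the integral: its Riemann sums
  nearly maximize that functional on sets close to \<open>\<Phi>\<close>, hence are close to the exposed point.\<close>

theorem H_selections_nonempty:
  fixes \<Gamma> :: "real \<Rightarrow> 'a::banach set"
  assumes G: "\<And>t. t \<in> {0..1} \<Longrightarrow> \<Gamma> t \<in> cwk" and H: "H_integrable \<Gamma>"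
  shows "H_selections \<Gamma> \<noteq> {}"
proof -
  obtain \<Phi> where \<Phi>: "\<Phi> \<in> cwk" "has_H_integral \<Gamma> \<Phi>" using H by (auto simp: H_integrable_def)
  have Gb: "\<Gamma> t \<in> bounded_convex" if "t \<in> {0..1}" for t using G[OF that] by (rule cwk_bounded_convex)
  have \<Phi>b: "\<Phi> \<noteq> {}" "bounded \<Phi>" using cwk_bounded_convex[OF \<Phi>(1)] by (auto simp: bounded_convex_def)
  obtain \<phi> :: "'a \<Rightarrow>\<^sub>L real" and x where x: "x \<in> \<Phi>" "\<phi> x = supp \<Phi> \<phi>"
    "\<And>e. 0 < e \<Longrightarrow> \<exists>\<alpha>>0. \<forall>y\<in>\<Phi>. supp \<Phi> \<phi> - \<alpha> < \<phi> y \<longrightarrow> dist y x \<le> e"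
    by (rule cwk_strongly_exposed[OF \<Phi>(1)]) blast
  have "\<exists>y\<in>\<Gamma> t. \<phi> y = supp (\<Gamma> t) \<phi>" if t: "t \<in> {0..1}" for t
  proof -
    obtain y where y: "y \<in> \<Gamma> t" "\<And>z. z \<in> \<Gamma> t \<Longrightarrow> \<phi> z \<le> \<phi> y" by (rule cwk_attains_max[OF G[OF t]]) blast
    have "supp (\<Gamma> t) \<phi> \<le> \<phi> y" using y by (intro supp_least) auto
    moreover have "\<phi> y \<le> supp (\<Gamma> t) \<phi>" by (rule supp_upper[OF cwk_bounded[OF G[OF t]] y(1)])
    ultimately show ?thesis using y(1) by force
  qed
  then obtain f where f: "\<And>t. t \<in> {0..1} \<Longrightarrow> f t \<in> \<Gamma> t" "\<And>t. t \<in> {0..1} \<Longrightarrow> \<phi> (f t) = supp (\<Gamma> t) \<phi>"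
    by metis
  have "H_integrable_fun f"
    unfolding H_integrable_fun_iff perron_def[symmetric]
  proof (intro exI[of _ x] allI impI)
    fix \<epsilon> :: real assume e: "0 < \<epsilon>"
    then have "0 < \<epsilon> / 2" by simp
    then obtain \<alpha> where \<alpha>: "0 < \<alpha>" "\<And>y. y \<in> \<Phi> \<Longrightarrow> supp \<Phi> \<phi> - \<alpha> < \<phi> y \<Longrightarrow> dist y x \<le> \<epsilon> / 2"
      using x(3) by blast
    \<comment> \<open>The first bound controls the distance of the Riemann sum from
      \<open>\<Phi>\<close>. The second keeps two errors of size
      \<open>\<eta> * norm \<phi>\<close>, one between supports and one between points, below
      \<open>\<alpha>\<close>.\<close>
    define \<eta> where "\<eta> = min (\<epsilon> / 2) (\<alpha> / (2 * (norm \<phi> + 1)))"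
    have n1: "0 < norm \<phi> + 1" using norm_ge_zero[of \<phi>] by linarith
    have \<eta>: "0 < \<eta>" "\<eta> \<le> \<epsilon> / 2" using e \<alpha>(1) n1 unfolding \<eta>_def by (simp_all only: min.cobounded1) simp
    have "\<eta> \<le> \<alpha> / (2 * (norm \<phi> + 1))" by (simp add: \<eta>_def)
    then have "2 * (\<eta> * (norm \<phi> + 1)) \<le> \<alpha>" using n1 by (simp add: field_simps)
    then have \<eta>\<alpha>: "2 * (\<eta> * norm \<phi>) < \<alpha>" using \<eta>(1) by (simp add: algebra_simps)
    obtain \<delta> where \<delta>: "measurable_gauge \<delta>" "\<And>p. perron \<delta> p \<Longrightarrow>
        hausdorff_distance \<Phi> (\<Sum>(t, I)\<in>p. (*\<^sub>R) (measure lborel I) ` \<Gamma> t) < \<eta>"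
      using has_H_integralD[OF \<Phi>(2) \<eta>(1)] by blast
    have "norm (x - (\<Sum>(t, I)\<in>p. measure lborel I *\<^sub>R f t)) < \<epsilon>" if p: "perron \<delta> p" for p
    proof -
      define S where "S = (\<Sum>(t, I)\<in>p. (*\<^sub>R) (measure lborel I) ` \<Gamma> t)"
      define z where "z = (\<Sum>(t, I)\<in>p. measure lborel I *\<^sub>R f t)"
      have S: "S \<in> bounded_convex" unfolding S_def by (rule supp_perron_sum(1)[OF p Gb])
      have dS: "hausdorff_distance \<Phi> S < \<eta>" unfolding S_def by (rule \<delta>(2)[OF p])
      have "z \<in> S"
        unfolding S_def z_def case_prod_unfold
      proof (rule sum_mem_set_sum)
        show "finite p" by (rule perron_finite[OF p])
        show "measure lborel (snd u) *\<^sub>R f (fst u) \<in> (*\<^sub>R) (measure lborel (snd u)) ` \<Gamma> (fst u)" if "u \<in> p" for u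
          using perron_tag[OF p, of "fst u" "snd u"] that f(1) by auto
      qed
      then obtain y where y: "y \<in> \<Phi>" "dist z y < \<eta>"
        using hausdorff_close_point[of S \<Phi> z \<eta>] S \<Phi>b dS
        by (auto simp: bounded_convex_def hausdorff_distance_commute)
      have "\<phi> z = (\<Sum>(t, I)\<in>p. measure lborel I * supp (\<Gamma> t) \<phi>)"
        unfolding z_def case_prod_unfold blinfun.sum_right blinfun.scaleR_right
        by (intro sum.cong) (use perron_tag[OF p] f(2) in auto)
      moreover have "supp S \<phi> = (\<Sum>(t, I)\<in>p. measure lborel I * supp (\<Gamma> t) \<phi>)"
        unfolding S_def by (rule supp_perron_sum(2)[OF p Gb])
      ultimately have "\<phi> z = supp S \<phi>" by simp
      moreover have "supp \<Phi> \<phi> \<le> supp S \<phi> + hausdorff_distance \<Phi> S * norm \<phi>"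
        using S \<Phi>b by (intro supp_le_hausdorff) (auto simp: bounded_convex_def)
      moreover have "hausdorff_distance \<Phi> S * norm \<phi> \<le> \<eta> * norm \<phi>" using dS by (intro mult_right_mono) auto
      moreover have "\<phi> (z - y) \<le> \<eta> * norm \<phi>"
        using blinfun_le_norm[of \<phi> "norm \<phi>" "z - y"] mult_left_mono[of "norm (z - y)" \<eta> "norm \<phi>"] y(2)
        by (simp add: dist_norm mult.commute)
      ultimately have "supp \<Phi> \<phi> - \<alpha> < \<phi> y" using \<eta>\<alpha> by (simp add: blinfun.diff_right)
      then have "dist y x \<le> \<epsilon> / 2" by (rule \<alpha>(2)[OF y(1)])
      then have "dist x z < \<epsilon>"
        using dist_triangle[of x z y] y(2) \<eta>(2) by (simp add: dist_commute)
      then show ?thesis by (simp add: dist_norm z_def)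
    qed
    with \<delta>(1) show "\<exists>\<delta>. measurable_gauge \<delta> \<and> (\<forall>p. perron \<delta> p \<longrightarrow>
        norm (x - (\<Sum>(t, I)\<in>p. measure lborel I *\<^sub>R f t)) < \<epsilon>)" by blast
  qed
  then have "f \<in> H_selections \<Gamma>" using f(1) unfolding H_selections_def by blast
  then show ?thesis by blast
qed

text \<open>Used with \<open>c = 1\<close> and \<open>c = -1\<close>, to add and to remove the
  integral of a selection. The relations are put on support functions because Minkowski addition has
  no subtraction.\<close>

lemma has_H_integral_combine:
  assumes "\<And>t. t \<in> {0..1} \<Longrightarrow> A t \<in> bounded_convex" "\<And>t. t \<in> {0..1} \<Longrightarrow> B t \<in> bounded_convex"
      "\<And>t. t \<in> {0..1} \<Longrightarrow> C t \<in> bounded_convex"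
    and "\<Phi> \<in> bounded_convex" "\<Psi> \<in> bounded_convex" "\<Theta> \<in> bounded_convex"
    and c: "\<bar>c\<bar> \<le> 1"
    and C: "\<And>t \<phi>. t \<in> {0..1} \<Longrightarrow> supp (C t) \<phi> = supp (A t) \<phi> + c * supp (B t) \<phi>"
    and \<Theta>: "\<And>\<phi>. supp \<Theta> \<phi> = supp \<Phi> \<phi> + c * supp \<Psi> \<phi>"
    and A: "has_H_integral A \<Phi>" and B: "has_H_integral B \<Psi>"
  shows "has_H_integral C \<Theta>"
proof (rule has_H_integral_iff_supp[OF assms(3,6), THEN iffD2], assumption, intro allI impI)
  fix \<epsilon> :: real assume "0 < \<epsilon>"
  then have e: "0 < \<epsilon> / 2" by simp
  obtain \<delta>1 where \<delta>1: "measurable_gauge \<delta>1" "\<And>p \<phi>. perron \<delta>1 p \<Longrightarrow> norm \<phi> \<le> 1 \<Longrightarrow>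
      \<bar>supp \<Phi> \<phi> - (\<Sum>(t, I)\<in>p. measure lborel I * supp (A t) \<phi>)\<bar> \<le> \<epsilon> / 2"
    using has_H_integral_iff_supp[OF assms(1,4), THEN iffD1, rule_format, OF _ A e] by blast
  obtain \<delta>2 where \<delta>2: "measurable_gauge \<delta>2" "\<And>p \<phi>. perron \<delta>2 p \<Longrightarrow> norm \<phi> \<le> 1 \<Longrightarrow>
      \<bar>supp \<Psi> \<phi> - (\<Sum>(t, I)\<in>p. measure lborel I * supp (B t) \<phi>)\<bar> \<le> \<epsilon> / 2"
    using has_H_integral_iff_supp[OF assms(2,5), THEN iffD1, rule_format, OF _ B e] by blast
  define \<delta> where "\<delta> t = min (\<delta>1 t) (\<delta>2 t)" for t
  have "\<bar>supp \<Theta> \<phi> - (\<Sum>(t, I)\<in>p. measure lborel I * supp (C t) \<phi>)\<bar> \<le> \<epsilon>"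
    if p: "perron \<delta> p" and \<phi>: "norm \<phi> \<le> 1" for p \<phi>
  proof -
    have "perron \<delta>1 p" "perron \<delta>2 p" by (rule perron_mono[OF p]; simp add: \<delta>_def)+
    note le = \<delta>1(2)[OF this(1) \<phi>] \<delta>2(2)[OF this(2) \<phi>]
    have "(\<Sum>(t, I)\<in>p. measure lborel I * supp (C t) \<phi>) =
        (\<Sum>(t, I)\<in>p. measure lborel I * supp (A t) \<phi> + c * (measure lborel I * supp (B t) \<phi>))"
      by (intro sum.cong) (use perron_tag[OF p] C in \<open>auto simp: algebra_simps\<close>)
    also have "\<dots> = (\<Sum>(t, I)\<in>p. measure lborel I * supp (A t) \<phi>) + c * (\<Sum>(t, I)\<in>p. measure lborel I * supp (B t) \<phi>)"
      by (simp add: case_prod_unfold sum.distrib sum_distrib_left)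
    finally have "supp \<Theta> \<phi> - (\<Sum>(t, I)\<in>p. measure lborel I * supp (C t) \<phi>) =
        (supp \<Phi> \<phi> - (\<Sum>(t, I)\<in>p. measure lborel I * supp (A t) \<phi>)) +
        c * (supp \<Psi> \<phi> - (\<Sum>(t, I)\<in>p. measure lborel I * supp (B t) \<phi>))"
      by (simp add: \<Theta> algebra_simps)
    moreover have "\<bar>c * (supp \<Psi> \<phi> - (\<Sum>(t, I)\<in>p. measure lborel I * supp (B t) \<phi>))\<bar> \<le> 1 * (\<epsilon> / 2)"
      unfolding abs_mult using c le(2) by (intro mult_mono) auto
    ultimately show ?thesis using le(1) by linarith
  qed
  moreover have "measurable_gauge \<delta>" unfolding \<delta>_def by (rule measurable_gauge_min[OF \<delta>1(1) \<delta>2(1)])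
  ultimately show "\<exists>\<delta>. measurable_gauge \<delta> \<and> (\<forall>p \<phi>. perron \<delta> p \<longrightarrow> norm \<phi> \<le> 1 \<longrightarrow>
      \<bar>supp \<Theta> \<phi> - (\<Sum>(t, I)\<in>p. measure lborel I * supp (C t) \<phi>)\<bar> \<le> \<epsilon>)" by blast
qed

lemma H_integrable_translate_iff:
  fixes \<Gamma> :: "real \<Rightarrow> 'a::banach set"
  assumes G: "\<And>t. t \<in> {0..1} \<Longrightarrow> \<Gamma> t \<in> cwk" and f: "H_integrable_fun f"
  shows "H_integrable (translate_by \<Gamma> f) \<longleftrightarrow> H_integrable \<Gamma>"
proof -
  obtain x where x: "has_H_integral (\<lambda>t. {f t}) {x}" using f by (auto simp: H_integrable_fun_def)
  have Gb: "\<Gamma> t \<in> bounded_convex" if "t \<in> {0..1}" for t using G[OF that] by (rule cwk_bounded_convex)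
  have Tb: "translate_by \<Gamma> f t \<in> bounded_convex" if "t \<in> {0..1}" for t
    unfolding translate_by_def by (rule cwk_bounded_convex[OF cwk_translation[OF G[OF that]]])
  have T: "supp (translate_by \<Gamma> f t) \<phi> = supp (\<Gamma> t) \<phi> - \<phi> (f t)" if "t \<in> {0..1}" for t \<phi>
    using Gb[OF that] unfolding translate_by_def by (intro supp_translation) (auto simp: bounded_convex_def)
  have shift: "supp {y - a |y. y \<in> \<Phi>} \<phi> = supp \<Phi> \<phi> - \<phi> a" if "\<Phi> \<in> cwk" for \<Phi> and a :: 'a and \<phi>
    using cwk_bounded_convex[OF that] by (intro supp_translation) (auto simp: bounded_convex_def)
  show ?thesis
  proof
    assume "H_integrable (translate_by \<Gamma> f)"
    then obtain \<Phi> where \<Phi>: "\<Phi> \<in> cwk" "has_H_integral (translate_by \<Gamma> f) \<Phi>" by (auto simp: H_integrable_def)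
    have cwk: "{y - (- x) |y. y \<in> \<Phi>} \<in> cwk" by (rule cwk_translation[OF \<Phi>(1)])
    have "has_H_integral \<Gamma> {y - (- x) |y. y \<in> \<Phi>}"
      by (rule has_H_integral_combine[where c = 1, OF Tb _ Gb cwk_bounded_convex[OF \<Phi>(1)] _
          cwk_bounded_convex[OF cwk] _ _ _ \<Phi>(2) x]) (auto simp: T shift[OF \<Phi>(1), of "- x", simplified] blinfun.minus_right)
    with cwk show "H_integrable \<Gamma>" unfolding H_integrable_def by blast
  next
    assume "H_integrable \<Gamma>"
    then obtain \<Phi> where \<Phi>: "\<Phi> \<in> cwk" "has_H_integral \<Gamma> \<Phi>" by (auto simp: H_integrable_def)
    have cwk: "{y - x |y. y \<in> \<Phi>} \<in> cwk" by (rule cwk_translation[OF \<Phi>(1)])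
    have "has_H_integral (translate_by \<Gamma> f) {y - x |y. y \<in> \<Phi>}"
      by (rule has_H_integral_combine[where c = "-1", OF Gb _ Tb cwk_bounded_convex[OF \<Phi>(1)] _
          cwk_bounded_convex[OF cwk] _ _ _ \<Phi>(2) x]) (auto simp: T shift[OF \<Phi>(1)])
    with cwk show "H_integrable (translate_by \<Gamma> f)" unfolding H_integrable_def by blast
  qed
qed

subsection \<open>From the Birkhoff integral to the \<open>\<H>\<close>-integral\<close>

lemma measure_split:
  assumes "A \<in> lmeasurable" "B \<in> sets lebesgue"
  shows "measure lebesgue A = measure lebesgue (A \<inter> B) + measure lebesgue (A - B)"
proof -
  have "A \<inter> B \<in> lmeasurable" using assms by (rule fmeasurable_Int_fmeasurable)
  from measure_Un2[OF this assms(1)] show ?thesis by (simp add: Un_absorb1 Diff_Int)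
qed

lemma tagged_division_measure_Int:
  assumes p: "p tagged_division_of {a..b::real}" and q: "q \<subseteq> p" and E: "E \<in> lmeasurable"
  shows "(\<Sum>(t, I)\<in>q. measure lebesgue (I \<inter> E)) \<le> measure lebesgue E"
    and "q = p \<Longrightarrow> E \<subseteq> {a..b} \<Longrightarrow> (\<Sum>(t, I)\<in>q. measure lebesgue (I \<inter> E)) = measure lebesgue E"
proof -
  have fin: "finite q" using tagged_division_of_finite[OF p] q by (rule finite_subset[rotated])
  have I: "snd x \<in> lmeasurable \<and> convex (snd x)" if "x \<in> q" for x
  proof -
    have "(fst x, snd x) \<in> p" using that q by auto
    then obtain a b where "snd x = cbox a b" using tagged_division_ofD(4)[OF p] by blast
    then show ?thesis by (simp add: convex_box)
  qed
  have IE: "snd x \<inter> E \<in> lmeasurable" if "x \<in> q" for x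
    using I[OF that] E by (intro fmeasurable.Int) auto
  have neg: "pairwise (\<lambda>x y. negligible ((snd x \<inter> E) \<inter> (snd y \<inter> E))) q"
  proof (rule pairwiseI)
    fix x y assume xy: "x \<in> q" "y \<in> q" "x \<noteq> y"
    have "interior (snd x) \<inter> interior (snd y) = {}"
      using tagged_division_ofD(5)[OF p, of "fst x" "snd x" "fst y" "snd y"] xy q by auto
    then have "negligible (snd x \<inter> snd y)"
      using I[OF xy(1)] I[OF xy(2)] by (subst negligible_convex_interior) (auto intro: convex_Int)
    then show "negligible ((snd x \<inter> E) \<inter> (snd y \<inter> E))"
      by (rule negligible_subset) auto
  qed
  have eq: "measure lebesgue (\<Union>x\<in>q. snd x \<inter> E) = (\<Sum>x\<in>q. measure lebesgue (snd x \<inter> E))"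
    by (rule measure_negligible_finite_Union_image[OF fin IE neg])
  have "measure lebesgue (\<Union>x\<in>q. snd x \<inter> E) \<le> measure lebesgue E"
  proof (rule measure_mono_fmeasurable)
    show "(\<Union>x\<in>q. snd x \<inter> E) \<in> sets lebesgue"
      using IE by (intro sets.finite_UN fin fmeasurableD) auto
  qed (use E in auto)
  then show "(\<Sum>(t, I)\<in>q. measure lebesgue (I \<inter> E)) \<le> measure lebesgue E"
    using eq by (simp add: case_prod_unfold)
  assume qp: "q = p" and E01: "E \<subseteq> {a..b}"
  have "(\<Union>x\<in>q. snd x) = {a..b}"
    using tagged_division_ofD(6)[OF p] qp by force
  then have "(\<Union>x\<in>q. snd x \<inter> E) = E" using E01 by blast
  then show "(\<Sum>(t, I)\<in>q. measure lebesgue (I \<inter> E)) = measure lebesgue E"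
    using eq by (simp add: case_prod_unfold)
qed

lemma sum_half_powers_le: "finite J \<Longrightarrow> 0 \<le> \<epsilon> \<Longrightarrow> (\<Sum>i\<in>J. \<epsilon> * (1/2) ^ Suc i) \<le> (\<epsilon>::real)"
proof -
  assume J: "finite J" and e: "0 \<le> \<epsilon>"
  have "(\<Sum>i\<in>J. (1/2::real) ^ Suc i) \<le> (\<Sum>i. (1/2) ^ Suc i)"
    using J power_half_series by (intro sum_le_suminf) (auto simp: sums_iff)
  also have "\<dots> = 1" using power_half_series by (rule sums_unique[symmetric])
  finally show "(\<Sum>i\<in>J. \<epsilon> * (1/2) ^ Suc i) \<le> \<epsilon>"
    using e mult_left_mono[of _ 1 \<epsilon>] by (simp add: sum_distrib_left[symmetric] del: power_Suc)
qed

definition tags_of :: "(nat \<Rightarrow> real set) \<Rightarrow> (nat \<Rightarrow> real) \<Rightarrow> bool" where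
  "tags_of A t \<longleftrightarrow> (\<forall>n. A n \<noteq> {} \<longrightarrow> t n \<in> A n)"

text \<open>The comparison for one functional: \<open>s\<close> is its support function along the
  multifunction and \<open>c\<close> its support at the integral. With tags grouped by pieces, the
  lengths outside the pieces cost \<open>\<epsilon>\<close>, replacing the tags by
  \<open>a i\<close> costs \<open>2 * \<epsilon>\<close>, and passing from the covered parts of the
  pieces to the integral costs \<open>3 * \<epsilon>\<close>. The data \<open>M\<close>,
  \<open>\<tau>\<close> and \<open>N\<close> come from outside so that they can be common to all
  functionals.\<close>

lemma perron_sum_near_partition_sum:
  fixes s :: "real \<Rightarrow> real" and M \<tau> :: "nat \<Rightarrow> real"
  assumes p: "p tagged_division_of {0..1}"
    and Q: "countable_partition Q" and idx: "\<And>t. t \<in> {0..1} \<Longrightarrow> t \<in> Q (idx t)"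
    and V: "\<And>i. V i - Q i \<in> lmeasurable" "\<And>i. measure lebesgue (V i - Q i) \<le> \<tau> i"
    and sub: "\<And>t I. (t, I) \<in> p \<Longrightarrow> I \<subseteq> V (idx t)"
    and s0: "\<And>t. t \<in> {0..1} \<Longrightarrow> 0 \<le> s t" and sM: "\<And>i t. t \<in> Q i \<Longrightarrow> s t \<le> M i" and M0: "\<And>i. 0 \<le> M i"
    and \<tau>M: "\<And>i. M i * \<tau> i \<le> \<epsilon> * (1/2) ^ Suc i" "\<And>i. (\<Sum>j<N. M j) * \<tau> i \<le> \<epsilon> * (1/2) ^ Suc i"
    and sums: "\<And>u. tags_of Q u \<Longrightarrow> \<exists>\<sigma>. (\<lambda>i. measure lebesgue (Q i) * s (u i)) sums \<sigma> \<and> \<bar>\<sigma> - c\<bar> \<le> \<epsilon>"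
    and a: "tags_of Q a" and tail: "\<And>n. (\<Sum>i\<in>{N..<n}. measure lebesgue (Q i) * s (a i)) \<le> \<epsilon>"
  shows "\<bar>(\<Sum>(t, I)\<in>p. measure lborel I * s t) - c\<bar> \<le> 6 * \<epsilon>"
proof -
  let ?m = "measure lebesgue"
  define g where "g x = idx (fst x)" for x :: "real \<times> real set"
  define J where "J = g ` p"
  have fin: "finite p" by (rule tagged_division_of_finite[OF p])
  have finJ: "finite J" using fin by (simp add: J_def)
  have tag: "fst x \<in> {0..1} \<and> fst x \<in> Q (g x)" if "x \<in> p" for x
    using tagged_division_ofD(2,3)[OF p, of "fst x" "snd x"] that idx by (auto simp: g_def)
  have Qm: "Q i \<in> lmeasurable" and Q01: "Q i \<subseteq> {0..1}" for i
  proof -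
    show sub: "Q i \<subseteq> {0..1}" using Q by (auto simp: countable_partition_def)
    show "Q i \<in> lmeasurable"
      using Q sub by (intro bounded_set_imp_lmeasurable bounded_subset[OF bounded_closed_interval])
        (auto simp: countable_partition_def)
  qed
  have Qdisj: "Q i \<inter> Q j = {}" if "i \<noteq> j" for i j
    using Q that by (auto simp: countable_partition_def disjoint_family_on_def)
  have Im: "snd x \<in> lmeasurable \<and> measure lborel (snd x) = ?m (snd x)" if "x \<in> p" for x
  proof -
    have "(fst x, snd x) \<in> p" using that by simp
    then obtain a b where "snd x = cbox a b" using tagged_division_ofD(4)[OF p] by blast
    then show ?thesis by simp
  qed
  have s_tag: "0 \<le> s (u i)" if "tags_of Q u" "Q i \<noteq> {}" for u i
  proof (rule s0)
    have "u i \<in> Q i" using that unfolding tags_of_def by blast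
    then show "u i \<in> {0..1}" using Q01[of i] by blast
  qed
  have s_nonneg: "0 \<le> ?m (Q i) * s (u i)" if "tags_of Q u" for u i
    using s_tag[OF that, of i] by (cases "Q i = {}") auto
  have group: "(\<Sum>i\<in>J. \<Sum>x\<in>{x\<in>p. g x = i}. h x) = (\<Sum>x\<in>p. h x)" for h :: "real \<times> real set \<Rightarrow> real"
    by (rule sum.group[OF fin finJ]) (simp add: J_def)
  have part_le: "(\<Sum>x\<in>{x\<in>p. g x = i}. ?m (snd x \<inter> E)) \<le> ?m E" if "E \<in> lmeasurable" for E i
    using tagged_division_measure_Int(1)[OF p _ that, of "{x\<in>p. g x = i}"] by (simp add: case_prod_unfold)
  define c' where "c' i = (\<Sum>x\<in>{x\<in>p. g x = i}. ?m (snd x \<inter> Q i))" for i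
  have c'0: "0 \<le> c' i" and c'le: "c' i \<le> ?m (Q i)" for i
    by (auto simp: c'_def intro!: sum_nonneg part_le Qm)
  have c'J: "c' i = 0" if "i \<notin> J" for i
  proof -
    have "{x\<in>p. g x = i} = {}" using that by (auto simp: J_def)
    then show ?thesis by (simp only: c'_def sum.empty)
  qed
  have outside: "(\<Sum>x\<in>{x\<in>p. g x = i}. ?m (snd x - Q i)) \<le> \<tau> i" for i
  proof -
    have "(\<Sum>x\<in>{x\<in>p. g x = i}. ?m (snd x - Q i)) \<le> (\<Sum>x\<in>{x\<in>p. g x = i}. ?m (snd x \<inter> (V i - Q i)))"
    proof (rule sum_mono)
      fix x assume x: "x \<in> {x\<in>p. g x = i}"
      then have "snd x \<subseteq> V i" using sub[of "fst x" "snd x"] by (auto simp: g_def)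
      then have "snd x - Q i = snd x \<inter> (V i - Q i)" by blast
      then show "?m (snd x - Q i) \<le> ?m (snd x \<inter> (V i - Q i))" by simp
    qed
    also have "\<dots> \<le> ?m (V i - Q i)" by (rule part_le[OF V(1)])
    finally show ?thesis using V(2)[of i] by simp
  qed
  have sums_bound: "sum h J \<le> \<epsilon>" if "\<And>i. h i \<le> \<epsilon> * (1/2) ^ Suc i" for h :: "nat \<Rightarrow> real"
  proof -
    have "0 \<le> \<epsilon>" using sums[OF a] by force
    then show ?thesis
      using sum_mono[of J h "\<lambda>i. \<epsilon> * (1/2) ^ Suc i"] sum_half_powers_le[OF finJ, of \<epsilon>] that by (meson order_trans)
  qed
  define E1 where "E1 = (\<Sum>x\<in>p. ?m (snd x - Q (g x)) * s (fst x))"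
  define main where "main = (\<Sum>x\<in>p. ?m (snd x \<inter> Q (g x)) * s (fst x))"
  have total: "(\<Sum>(t, I)\<in>p. measure lborel I * s t) = main + E1"
  proof -
    have "measure lborel (snd x) * s (fst x) = ?m (snd x \<inter> Q (g x)) * s (fst x) + ?m (snd x - Q (g x)) * s (fst x)"
      if "x \<in> p" for x
      using measure_split[of "snd x" "Q (g x)"] Im[OF that] Qm[of "g x"]
      by (simp add: distrib_right fmeasurableD)
    then show ?thesis by (simp add: main_def E1_def case_prod_unfold sum.distrib[symmetric])
  qed
  have "0 \<le> E1" unfolding E1_def using tag s0 by (intro sum_nonneg) auto
  moreover have "E1 \<le> \<epsilon>"
  proof -
    have "E1 = (\<Sum>i\<in>J. \<Sum>x\<in>{x\<in>p. g x = i}. ?m (snd x - Q i) * s (fst x))"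
      unfolding E1_def group[symmetric] by (intro sum.cong) auto
    also have "\<dots> \<le> (\<Sum>i\<in>J. M i * \<tau> i)"
    proof (rule sum_mono)
      fix i
      have "(\<Sum>x\<in>{x\<in>p. g x = i}. ?m (snd x - Q i) * s (fst x)) \<le> (\<Sum>x\<in>{x\<in>p. g x = i}. ?m (snd x - Q i) * M i)"
        using tag sM by (intro sum_mono mult_left_mono) auto
      also have "\<dots> = M i * (\<Sum>x\<in>{x\<in>p. g x = i}. ?m (snd x - Q i))"
        by (simp add: sum_distrib_left mult.commute)
      also have "\<dots> \<le> M i * \<tau> i" by (rule mult_left_mono[OF outside M0])
      finally show "(\<Sum>x\<in>{x\<in>p. g x = i}. ?m (snd x - Q i) * s (fst x)) \<le> M i * \<tau> i" .
    qed
    also have "\<dots> \<le> \<epsilon>" by (rule sums_bound[OF \<tau>M(1)])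
    finally show ?thesis .
  qed
  moreover have "\<bar>main - (\<Sum>i\<in>J. c' i * s (a i))\<bar> \<le> 2 * \<epsilon>"
  proof -
    \<comment> \<open>In each piece the tag whose value deviates most from that at
      \<open>a i\<close> is singled out, so that one choice \<open>u\<close> of tags dominates all
      of them.\<close>
    have "\<exists>x\<in>p. g x = i \<and> (\<forall>y\<in>p. g y = i \<longrightarrow> \<bar>s (fst y) - s (a i)\<bar> \<le> \<bar>s (fst x) - s (a i)\<bar>)" if "i \<in> J" for i
    proof -
      have "finite {x\<in>p. g x = i}" "{x\<in>p. g x = i} \<noteq> {}" using fin that by (auto simp: J_def)
      moreover define S where "S = (\<lambda>x. \<bar>s (fst x) - s (a i)\<bar>) ` {x\<in>p. g x = i}"
      ultimately have "finite S" "S \<noteq> {}" by simp_all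
      then have S: "Max S \<in> S" "\<And>r. r \<in> S \<Longrightarrow> r \<le> Max S" by simp_all
      then obtain x where x: "x \<in> {x\<in>p. g x = i}" "Max S = \<bar>s (fst x) - s (a i)\<bar>"
        unfolding S_def by blast
      have "\<bar>s (fst y) - s (a i)\<bar> \<le> \<bar>s (fst x) - s (a i)\<bar>" if "y \<in> p" "g y = i" for y
        unfolding x(2)[symmetric] using that by (intro S(2)) (auto simp: S_def)
      then show ?thesis using x(1) by blast
    qed
    then obtain X where X: "\<And>i. i \<in> J \<Longrightarrow> X i \<in> p" "\<And>i. i \<in> J \<Longrightarrow> g (X i) = i"
      "\<And>i y. i \<in> J \<Longrightarrow> y \<in> p \<Longrightarrow> g y = i \<Longrightarrow> \<bar>s (fst y) - s (a i)\<bar> \<le> \<bar>s (fst (X i)) - s (a i)\<bar>"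
      by metis
    define u where "u i = (if i \<in> J then fst (X i) else a i)" for i
    \<comment> \<open>With the larger value in \<open>v\<close> on every piece, the absolute
      deviations become the difference of two partition sums, both within \<open>\<epsilon>\<close>
      of \<open>c\<close>.\<close>
    define v where "v i = (if s (u i) \<le> s (a i) then a i else u i)" for i
    define w where "w i = (if s (u i) \<le> s (a i) then u i else a i)" for i
    have "u i \<in> Q i" if "Q i \<noteq> {}" for i
    proof (cases "i \<in> J")
      case True
      then show ?thesis using tag[OF X(1)[OF True]] X(2)[OF True] by (simp add: u_def)
    next
      case False
      then show ?thesis using a that by (simp add: u_def tags_of_def)
    qed
    then have vw: "tags_of Q v" "tags_of Q w" using a by (auto simp: tags_of_def v_def w_def)
    obtain \<sigma>v where \<sigma>v: "(\<lambda>i. ?m (Q i) * s (v i)) sums \<sigma>v" "\<bar>\<sigma>v - c\<bar> \<le> \<epsilon>" using sums[OF vw(1)] by blast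
    obtain \<sigma>w where \<sigma>w: "(\<lambda>i. ?m (Q i) * s (w i)) sums \<sigma>w" "\<bar>\<sigma>w - c\<bar> \<le> \<epsilon>" using sums[OF vw(2)] by blast
    have vw_abs: "s (v i) - s (w i) = \<bar>s (u i) - s (a i)\<bar>" for i by (auto simp: v_def w_def)
    have diff: "(\<lambda>i. ?m (Q i) * \<bar>s (u i) - s (a i)\<bar>) sums (\<sigma>v - \<sigma>w)"
      using sums_diff[OF \<sigma>v(1) \<sigma>w(1)] by (simp add: right_diff_distrib[symmetric] vw_abs)
    have "main = (\<Sum>i\<in>J. \<Sum>x\<in>{x\<in>p. g x = i}. ?m (snd x \<inter> Q i) * s (fst x))"
      unfolding main_def group[symmetric] by (intro sum.cong) auto
    then have "main - (\<Sum>i\<in>J. c' i * s (a i)) =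
        (\<Sum>i\<in>J. \<Sum>x\<in>{x\<in>p. g x = i}. ?m (snd x \<inter> Q i) * (s (fst x) - s (a i)))"
      by (simp add: c'_def sum_distrib_right sum_subtractf[symmetric] right_diff_distrib)
    also have "\<bar>\<dots>\<bar> \<le> (\<Sum>i\<in>J. \<Sum>x\<in>{x\<in>p. g x = i}. ?m (snd x \<inter> Q i) * \<bar>s (u i) - s (a i)\<bar>)"
    proof (rule order_trans[OF sum_abs sum_mono])
      fix i assume i: "i \<in> J"
      show "\<bar>\<Sum>x\<in>{x\<in>p. g x = i}. ?m (snd x \<inter> Q i) * (s (fst x) - s (a i))\<bar> \<le>
          (\<Sum>x\<in>{x\<in>p. g x = i}. ?m (snd x \<inter> Q i) * \<bar>s (u i) - s (a i)\<bar>)"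
        using X(3)[OF i] i by (intro order_trans[OF sum_abs sum_mono]) (auto simp: abs_mult u_def intro!: mult_left_mono)
    qed
    also have "\<dots> = (\<Sum>i\<in>J. c' i * \<bar>s (u i) - s (a i)\<bar>)"
      by (simp add: c'_def sum_distrib_right)
    also have "\<dots> \<le> (\<Sum>i\<in>J. ?m (Q i) * \<bar>s (u i) - s (a i)\<bar>)"
      by (intro sum_mono mult_right_mono c'le) auto
    also have "\<dots> \<le> (\<Sum>i. ?m (Q i) * \<bar>s (u i) - s (a i)\<bar>)"
      using diff by (intro sum_le_suminf finJ) (auto simp: sums_iff)
    also have "\<dots> = \<sigma>v - \<sigma>w" using diff by (simp add: sums_iff)
    also have "\<dots> \<le> 2 * \<epsilon>" using \<sigma>v(2) \<sigma>w(2) by (simp add: abs_le_iff)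
    finally show ?thesis .
  qed
  moreover have "\<bar>(\<Sum>i\<in>J. c' i * s (a i)) - c\<bar> \<le> 3 * \<epsilon>"
  proof -
    obtain \<sigma> where \<sigma>: "(\<lambda>i. ?m (Q i) * s (a i)) sums \<sigma>" "\<bar>\<sigma> - c\<bar> \<le> \<epsilon>" using sums[OF a] by blast
    have ca: "c' i * s (a i) \<le> ?m (Q i) * s (a i) \<and> 0 \<le> c' i * s (a i)" for i
    proof (cases "Q i = {}")
      case True
      then show ?thesis using c'0[of i] c'le[of i] by simp
    next
      case False
      then have "0 \<le> s (a i)" by (rule s_tag[OF a])
      then show ?thesis using c'0[of i] c'le[of i] by (auto intro: mult_right_mono)
    qed
    have "(\<Sum>i\<in>J. c' i * s (a i)) \<le> (\<Sum>i\<in>J. ?m (Q i) * s (a i))" using ca by (intro sum_mono) auto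
    also have "\<dots> \<le> (\<Sum>i. ?m (Q i) * s (a i))"
      using \<sigma>(1) s_nonneg[OF a] by (intro sum_le_suminf finJ) (auto simp: sums_iff)
    finally have upper: "(\<Sum>i\<in>J. c' i * s (a i)) \<le> \<sigma>" using \<sigma>(1) by (simp add: sums_iff)
    have "(\<Sum>i<n. ?m (Q i) * s (a i)) \<le> (\<Sum>i<N. ?m (Q i) * s (a i)) + \<epsilon>" if "N \<le> n" for n
    proof -
      have "{..<n} = {..<N} \<union> {N..<n}" using that by auto
      then have "(\<Sum>i<n. ?m (Q i) * s (a i)) = (\<Sum>i<N. ?m (Q i) * s (a i)) + (\<Sum>i\<in>{N..<n}. ?m (Q i) * s (a i))"
        by (simp add: sum.union_disjoint[symmetric] ivl_disj_int)
      then show ?thesis using tail[of n] by simp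
    qed
    then have tail': "\<sigma> \<le> (\<Sum>i<N. ?m (Q i) * s (a i)) + \<epsilon>"
      using \<sigma>(1) unfolding sums_def by (intro LIMSEQ_le_const2) blast+
    \<comment> \<open>What is missing of a piece is covered by intervals tagged in other pieces,
      hence by their protruding parts, of total measure at most \<open>R\<close>. By the tail
      estimate only the first \<open>N\<close> pieces need this, which is why \<open>\<tau>\<close>
      is measured against the sum of the first \<open>N\<close> bounds.\<close>
    define R where "R = (\<Sum>j\<in>J. \<tau> j)"
    have missing: "?m (Q i) - c' i \<le> R" for i
    proof -
      have "?m (Q i) = (\<Sum>x\<in>p. ?m (snd x \<inter> Q i))"
        using tagged_division_measure_Int(2)[OF p subset_refl Qm refl Q01, of i] by (simp add: case_prod_unfold)
      also have "\<dots> = (\<Sum>x\<in>{x\<in>p. g x = i}. ?m (snd x \<inter> Q i)) + (\<Sum>x\<in>{x\<in>p. g x \<noteq> i}. ?m (snd x \<inter> Q i))"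
        using sum.Int_Diff[OF fin, of "\<lambda>x. ?m (snd x \<inter> Q i)" "{x. g x = i}"]
        by (simp add: Collect_conj_eq[symmetric] set_diff_eq Int_def)
      also have "(\<Sum>x\<in>{x\<in>p. g x \<noteq> i}. ?m (snd x \<inter> Q i)) \<le> (\<Sum>x\<in>{x\<in>p. g x \<noteq> i}. ?m (snd x - Q (g x)))"
      proof (rule sum_mono)
        fix x assume x: "x \<in> {x\<in>p. g x \<noteq> i}"
        then have "snd x \<inter> Q i \<subseteq> snd x - Q (g x)" using Qdisj[of i "g x"] by blast
        moreover have "snd x \<inter> Q i \<in> lmeasurable" "snd x - Q (g x) \<in> lmeasurable"
          using Im[of x] Qm[of i] Qm[of "g x"] x by (auto intro: fmeasurable.Int fmeasurable.Diff)
        ultimately show "?m (snd x \<inter> Q i) \<le> ?m (snd x - Q (g x))"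
          by (intro measure_mono_fmeasurable) auto
      qed
      also have "\<dots> \<le> (\<Sum>x\<in>p. ?m (snd x - Q (g x)))" using fin by (intro sum_mono2) auto
      also have "\<dots> = (\<Sum>j\<in>J. \<Sum>x\<in>{x\<in>p. g x = j}. ?m (snd x - Q j))"
        unfolding group[symmetric] by (intro sum.cong) auto
      also have "\<dots> \<le> R" unfolding R_def by (intro sum_mono outside)
      finally show ?thesis by (simp add: c'_def)
    qed
    have R0: "0 \<le> R" unfolding R_def by (intro sum_nonneg order_trans[OF measure_nonneg V(2)])
    have "(\<Sum>i<N. ?m (Q i) * s (a i)) - (\<Sum>i<N. c' i * s (a i)) = (\<Sum>i<N. (?m (Q i) - c' i) * s (a i))"
      by (simp add: sum_subtractf left_diff_distrib)
    also have "\<dots> \<le> (\<Sum>i<N. M i * R)"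
    proof (rule sum_mono)
      fix i
      show "(?m (Q i) - c' i) * s (a i) \<le> M i * R"
      proof (cases "Q i = {}")
        case True
        then show ?thesis using c'0[of i] c'le[of i] M0[of i] R0 by simp
      next
        case False
        then have "0 \<le> s (a i)" "s (a i) \<le> M i" using s_tag[OF a, of i] a sM by (auto simp: tags_of_def)
        then have "(?m (Q i) - c' i) * s (a i) \<le> R * M i"
          using missing[of i] c'le[of i] R0 by (intro mult_mono) auto
        then show ?thesis by (simp add: mult.commute)
      qed
    qed
    also have "\<dots> = (\<Sum>j\<in>J. (\<Sum>i<N. M i) * \<tau> j)"
      by (simp add: R_def sum_distrib_left[symmetric] sum_distrib_right[symmetric])
    also have "\<dots> \<le> \<epsilon>" by (rule sums_bound[OF \<tau>M(2)])
    finally have "(\<Sum>i<N. ?m (Q i) * s (a i)) \<le> (\<Sum>i<N. c' i * s (a i)) + \<epsilon>" by simp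
    also have "(\<Sum>i<N. c' i * s (a i)) \<le> (\<Sum>i\<in>J \<union> {..<N}. c' i * s (a i))"
      using ca finJ by (intro sum_mono2) auto
    also have "\<dots> = (\<Sum>i\<in>J. c' i * s (a i))"
      using finJ c'J by (intro sum.mono_neutral_right) auto
    finally show ?thesis using upper tail' \<sigma>(2) by linarith
  qed
  ultimately show ?thesis unfolding total by linarith
qed

section \<open>Birkhoff sums and series of sets read off support functions\<close>

lemma countable_partition_subset: "countable_partition A \<Longrightarrow> A n \<subseteq> {0..1}"
  by (auto simp: countable_partition_def)

lemma countable_partition_lmeasurable:
  assumes "countable_partition A"
  shows "A n \<in> lmeasurable"
proof (rule bounded_set_imp_lmeasurable)
  show "bounded (A n)"
    by (rule bounded_subset[OF bounded_closed_interval countable_partition_subset[OF assms]])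
  show "A n \<in> sets lebesgue" using assms by (simp add: countable_partition_def)
qed

lemma birkhoff_term_supp:
  assumes A: "countable_partition A" "tags_of A t" and G: "\<And>t. t \<in> {0..1} \<Longrightarrow> G t \<in> bounded_convex"
  shows "birkhoff_term G A t n \<in> bounded_convex"
    and "supp (birkhoff_term G A t n) \<phi> = measure lebesgue (A n) * supp (G (t n)) \<phi>"
proof -
  have "birkhoff_term G A t n \<in> bounded_convex \<and>
    supp (birkhoff_term G A t n) \<phi> = measure lebesgue (A n) * supp (G (t n)) \<phi>"
  proof (cases "A n = {}")
    case True
    then show ?thesis by (simp add: birkhoff_term_def blinfun.zero_right)
  next
    case False
    then have "t n \<in> {0..1}"
      using A(2) countable_partition_subset[OF A(1), of n] unfolding tags_of_def by blast
    then have "G (t n) \<in> bounded_convex" by (rule G)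
    with False show ?thesis
      unfolding birkhoff_term_def if_not_P[OF False]
      by (intro conjI bounded_convex_scaleR supp_scaleR) (auto simp: bounded_convex_def)
  qed
  then show "birkhoff_term G A t n \<in> bounded_convex"
    "supp (birkhoff_term G A t n) \<phi> = measure lebesgue (A n) * supp (G (t n)) \<phi>" by auto
qed

text \<open>One \<open>N\<close> for the whole dual ball, so that a tail bound can be fixed before
  the gauge is chosen.\<close>

lemma set_sums_supp_uniform:
  assumes B: "\<And>n. B n \<in> bounded_convex" and S: "set_sums B S" and e: "0 < e"
  obtains N where "\<And>n \<phi>. N \<le> n \<Longrightarrow> norm \<phi> \<le> 1 \<Longrightarrow> \<bar>(\<Sum>k<n. supp (B k) \<phi>) - supp S \<phi>\<bar> \<le> e"
proof -
  have S': "S \<in> bounded_convex" using S by (simp add: set_sums_def cwk_bounded_convex)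
  have "(\<lambda>N. hausdorff_distance (\<Sum>n<N. B n) S) \<longlonglongrightarrow> 0" using S by (simp add: set_sums_def)
  then have "eventually (\<lambda>n. hausdorff_distance (\<Sum>k<n. B k) S < e) sequentially"
    using e by (rule order_tendstoD(2))
  then obtain N where N: "\<And>n. N \<le> n \<Longrightarrow> hausdorff_distance (\<Sum>k<n. B k) S < e"
    unfolding eventually_sequentially by blast
  show ?thesis
  proof (rule that)
    fix n and \<phi> :: "'a \<Rightarrow>\<^sub>L real"
    assume n: "N \<le> n" and \<phi>: "norm \<phi> \<le> 1"
    have sum: "(\<Sum>k<n. B k) \<in> bounded_convex" "supp (\<Sum>k<n. B k) \<phi> = (\<Sum>k<n. supp (B k) \<phi>)"
      using bounded_convex_sum[of "{..<n}" B \<phi>] B by auto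
    show "\<bar>(\<Sum>k<n. supp (B k) \<phi>) - supp S \<phi>\<bar> \<le> e"
      using abs_supp_diff_le_hausdorff'[OF sum(1) S' \<phi>] N[OF n] sum(2) by simp
  qed
qed

lemma set_sums_supp:
  assumes B: "\<And>n. B n \<in> bounded_convex" and S: "set_sums B S" and \<phi>: "norm \<phi> \<le> 1"
  shows "(\<lambda>n. supp (B n) \<phi>) sums supp S \<phi>"
  unfolding sums_def
proof (rule LIMSEQ_I)
  fix r :: real assume r: "0 < r"
  then have "0 < r / 2" by simp
  then obtain N where N: "\<And>n \<phi>. N \<le> n \<Longrightarrow> norm \<phi> \<le> 1 \<Longrightarrow> \<bar>(\<Sum>k<n. supp (B k) \<phi>) - supp S \<phi>\<bar> \<le> r / 2"
    by (rule set_sums_supp_uniform[OF B S]) blast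
  have "norm ((\<Sum>k<n. supp (B k) \<phi>) - supp S \<phi>) < r" if "N \<le> n" for n
    using N[OF that \<phi>] r by simp
  then show "\<exists>no. \<forall>n\<ge>no. norm ((\<Sum>k<n. supp (B k) \<phi>) - supp S \<phi>) < r" by blast
qed

lemma set_sumsI:
  assumes B: "\<And>n. B n \<in> bounded_convex" and S: "S \<in> cwk"
    and lim: "\<And>e. 0 < e \<Longrightarrow> \<exists>N. \<forall>n\<ge>N. \<forall>\<phi>. norm \<phi> \<le> 1 \<longrightarrow> \<bar>(\<Sum>k<n. supp (B k) \<phi>) - supp S \<phi>\<bar> \<le> e"
  shows "set_sums B S"
  unfolding set_sums_def
proof (intro conjI S LIMSEQ_I)
  fix r :: real assume r: "0 < r"
  then have "0 < r / 2" by simp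
  then obtain N where N: "\<And>n \<phi>. N \<le> n \<Longrightarrow> norm \<phi> \<le> 1 \<Longrightarrow> \<bar>(\<Sum>k<n. supp (B k) \<phi>) - supp S \<phi>\<bar> \<le> r / 2"
    using lim by blast
  have "norm (hausdorff_distance (\<Sum>k<n. B k) S - 0) < r" if n: "N \<le> n" for n
  proof -
    have sum: "(\<Sum>k<n. B k) \<in> bounded_convex" and supp: "supp (\<Sum>k<n. B k) \<phi> = (\<Sum>k<n. supp (B k) \<phi>)" for \<phi>
      using bounded_convex_sum[of "{..<n}" B \<phi>] B by auto
    have S': "S \<in> bounded_convex" by (rule cwk_bounded_convex[OF S])
    have "hausdorff_distance (\<Sum>k<n. B k) S \<le> r / 2"
      by (rule hausdorff_le[OF sum S']) (unfold supp, rule N[OF n])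
    moreover have "0 \<le> hausdorff_distance (\<Sum>k<n. B k) S"
      using sum S' by (intro hausdorff_distance_nonneg) (auto simp: bounded_convex_def)
    ultimately show ?thesis using r by simp
  qed
  then show "\<exists>no. \<forall>n\<ge>no. norm (hausdorff_distance (\<Sum>k<n. B k) S - 0) < r" by blast
qed

lemma countable_partition_index:
  assumes "countable_partition Q"
  obtains idx where "\<And>t. t \<in> {0..1} \<Longrightarrow> t \<in> Q (idx t)" "\<And>t i. t \<in> Q i \<Longrightarrow> idx t = i"
    "idx \<in> measurable (lebesgue_on {0..1}) (count_space UNIV)"
proof -
  have "\<exists>i. t \<in> Q i" if "t \<in> {0..1}" for t
    using assms that unfolding countable_partition_def by blast
  then obtain idx where idx: "\<And>t. t \<in> {0..1} \<Longrightarrow> t \<in> Q (idx t)" by metis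
  have uniq: "idx t = i" if "t \<in> Q i" for t i
  proof (rule ccontr)
    assume "idx t \<noteq> i"
    then have "Q (idx t) \<inter> Q i = {}"
      using assms unfolding countable_partition_def disjoint_family_on_def by blast
    moreover have "t \<in> {0..1}" using countable_partition_subset[OF assms] that by blast
    ultimately show False using idx that by blast
  qed
  have "idx -` {i} \<inter> space (lebesgue_on {0..1}) = Q i" for i
    using idx uniq countable_partition_subset[OF assms, of i] by (auto simp: space_restrict_space)
  moreover have "Q i \<in> sets (lebesgue_on {0..1})" for i
    using assms countable_partition_subset[OF assms, of i]
    by (auto simp: sets_restrict_space_iff countable_partition_def)
  ultimately have "idx \<in> measurable (lebesgue_on {0..1}) (count_space UNIV)"
    by (subst measurable_count_space_eq2_countable) auto
  with idx uniq show ?thesis by (rule that)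
qed

text \<open>On each piece the gauge is the distance to a closed set, which is continuous; gluing
  countably many such functions along measurable pieces gives a measurable one. An interval closer
  to its tag than this distance cannot leave \<open>V (idx t)\<close>.\<close>

lemma open_cover_gauge:
  assumes Q: "countable_partition Q" and V: "\<And>i. open (V i)" "\<And>i. Q i \<subseteq> V i"
  obtains \<delta> idx where "measurable_gauge \<delta>" "\<And>t. t \<in> {0..1} \<Longrightarrow> t \<in> Q (idx t)"
    "\<And>p t I. perron \<delta> p \<Longrightarrow> (t, I) \<in> p \<Longrightarrow> I \<subseteq> V (idx t)"
proof -
  obtain idx where idx: "\<And>t. t \<in> {0..1} \<Longrightarrow> t \<in> Q (idx t)" "\<And>t i. t \<in> Q i \<Longrightarrow> idx t = i"
    "idx \<in> measurable (lebesgue_on {0..1}) (count_space UNIV)"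
    by (rule countable_partition_index[OF Q]) blast
  \<comment> \<open>Intersecting with a bounded set keeps the complement non-empty, since \<open>infdist\<close> to \<open>{}\<close> is \<open>0\<close>.\<close>
  define W where "W i = V i \<inter> {-1<..<2}" for i
  define \<delta> where "\<delta> t = infdist t (- W (idx t))" for t
  have W: "closed (- W i)" "- W i \<noteq> {}" for i
  proof -
    show "closed (- W i)" using V(1)[of i] by (simp add: W_def closed_def open_Int)
    have "(3::real) \<in> - W i" by (simp add: W_def)
    then show "- W i \<noteq> {}" by blast
  qed
  have "0 < \<delta> t" if "t \<in> {0..1}" for t
  proof -
    have "t \<in> W (idx t)" using idx(1)[OF that] V(2)[of "idx t"] that by (auto simp: W_def)
    then have "infdist t (- W (idx t)) \<noteq> 0" using in_closed_iff_infdist_zero[OF W] by blast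
    then show ?thesis using infdist_nonneg[of t "- W (idx t)"] by (simp add: \<delta>_def)
  qed
  moreover have "\<delta> \<in> borel_measurable (lebesgue_on {0..1})"
    unfolding \<delta>_def
  proof (rule measurable_compose_countable[OF _ idx(3)])
    fix i
    have "continuous_on {0..1} (\<lambda>t. infdist t (- W i))" by (intro continuous_intros)
    then show "(\<lambda>t. infdist t (- W i)) \<in> borel_measurable (lebesgue_on {0..1})"
      by (rule continuous_imp_measurable_on_sets_lebesgue) simp
  qed
  ultimately have "measurable_gauge \<delta>" by (simp add: measurable_gauge_def)
  moreover have "I \<subseteq> V (idx t)" if "perron \<delta> p" "(t, I) \<in> p" for p t I
  proof
    fix y assume "y \<in> I"
    moreover have "I \<subseteq> {t - \<delta> t<..<t + \<delta> t}" using that by (auto simp: perron_def fine_def)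
    ultimately have "y \<in> {t - \<delta> t<..<t + \<delta> t}" by blast
    then have y: "\<bar>y - t\<bar> < \<delta> t" by (auto simp: abs_less_iff)
    show "y \<in> V (idx t)"
    proof (rule ccontr)
      assume "y \<notin> V (idx t)"
      then have "\<delta> t \<le> dist t y" unfolding \<delta>_def by (intro infdist_le) (simp add: W_def)
      then show False using y by (simp add: dist_real_def)
    qed
  qed
  ultimately show ?thesis using idx(1) that by blast
qed

text \<open>A null set contributes nothing to a Birkhoff sum, so only on null pieces can the values be unbounded;
  cutting these pieces along the values of \<open>b\<close> removes the problem.\<close>

lemma partition_null_refinement:
  fixes b :: "real \<Rightarrow> nat"
  assumes P: "countable_partition P"
  obtains Q k where "countable_partition Q" "finer Q P"
    "\<And>i t. measure lebesgue (Q i) = 0 \<Longrightarrow> t \<in> Q i \<Longrightarrow> b t = k i"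
proof -
  define R where "R n k = (if measure lebesgue (P n) = 0 then {t \<in> P n. b t = k} else if k = 0 then P n else {})" for n k
  define Q where "Q i = R (fst (prod_decode i)) (snd (prod_decode i))" for i
  have RP: "R n k \<subseteq> P n" for n k by (auto simp: R_def)
  have R_disj: "R n k \<inter> R n' k' = {}" if "(n, k) \<noteq> (n', k')" for n k n' k'
  proof (cases "n = n'")
    case True
    then show ?thesis using that by (auto simp: R_def)
  next
    case False
    then have "P n \<inter> P n' = {}" using P by (auto simp: countable_partition_def disjoint_family_on_def)
    then show ?thesis using RP[of n k] RP[of n' k'] by blast
  qed
  \<comment> \<open>\<open>b\<close> is arbitrary; its level sets inside a null piece are Lebesgue
    measurable because all subsets of null sets are.\<close>
  have R_meas: "R n k \<in> sets lebesgue" for n k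
  proof (cases "measure lebesgue (P n) = 0")
    case True
    then have "P n \<in> null_sets lebesgue"
      using countable_partition_lmeasurable[OF P, of n] by (auto simp: null_sets_def emeasure_eq_measure2)
    then have "negligible (P n)" by (simp add: negligible_iff_null_sets)
    then have "negligible (R n k)" using RP by (rule negligible_subset)
    then show ?thesis by (simp add: negligible_imp_sets)
  next
    case False
    have "P n \<in> sets lebesgue" using P by (simp add: countable_partition_def)
    then show ?thesis using False by (simp add: R_def)
  qed
  have R_union: "\<exists>k. t \<in> R n k" if "t \<in> P n" for t n
    using that by (cases "measure lebesgue (P n) = 0") (auto simp: R_def)
  have "countable_partition Q"
    unfolding countable_partition_def
  proof (intro conjI allI)
    show "Q i \<in> sets lebesgue" for i unfolding Q_def by (rule R_meas)
    show "disjoint_family Q"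
      unfolding disjoint_family_on_def
    proof (intro ballI impI)
      fix i j :: nat assume "i \<noteq> j"
      then have "prod_decode i \<noteq> prod_decode j" by simp
      then show "Q i \<inter> Q j = {}" unfolding Q_def by (intro R_disj) (simp add: prod_eq_iff)
    qed
    show "(\<Union>i. Q i) = {0..1}"
    proof
      show "(\<Union>i. Q i) \<subseteq> {0..1}"
        using RP countable_partition_subset[OF P] unfolding Q_def by blast
      show "{0..1} \<subseteq> (\<Union>i. Q i)"
      proof
        fix t :: real assume "t \<in> {0..1}"
        then obtain n where "t \<in> P n" using P unfolding countable_partition_def by blast
        then obtain k where "t \<in> R n k" using R_union by blast
        then have "t \<in> Q (prod_encode (n, k))" by (simp add: Q_def)
        then show "t \<in> (\<Union>i. Q i)" by blast
      qed
    qed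
  qed
  moreover have "finer Q P" unfolding finer_def Q_def using RP by blast
  moreover have "b t = snd (prod_decode i)" if "measure lebesgue (Q i) = 0" "t \<in> Q i" for i t
    using that by (auto simp: Q_def R_def split: if_splits)
  ultimately show ?thesis by (rule that)
qed

text \<open>For one fixed partition the values on each piece are bounded uniformly over the dual
  ball; the open sets around the pieces are then so tight that the protruding parts of intervals are
  negligible against these bounds.\<close>

theorem birkhoff_imp_H_integrable:
  fixes G :: "real \<Rightarrow> 'a::banach set"
  assumes G: "\<And>t. t \<in> {0..1} \<Longrightarrow> G t \<in> cwk" and G0: "\<And>t. t \<in> {0..1} \<Longrightarrow> 0 \<in> G t"
    and "birkhoff_integrable G"
  shows "H_integrable G"
proof -
  obtain \<Phi> where \<Phi>: "\<Phi> \<in> cwk" and birkhoff: "has_birkhoff_integral G \<Phi>"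
    using assms(3) by (auto simp: birkhoff_integrable_def)
  have Gb: "G t \<in> bounded_convex" if "t \<in> {0..1}" for t using G[OF that] by (rule cwk_bounded_convex)
  have \<Phi>b: "\<Phi> \<in> bounded_convex" by (rule cwk_bounded_convex[OF \<Phi>])
  have s_nonneg: "0 \<le> supp (G t) \<phi>" if "t \<in> {0..1}" for t \<phi>
    using Gb[OF that] G0[OF that] by (intro supp_nonneg) (auto simp: bounded_convex_def)
  have "\<exists>m::nat. \<forall>\<phi>. norm \<phi> \<le> 1 \<longrightarrow> supp (G t) \<phi> \<le> m" if t: "t \<in> {0..1}" for t
  proof -
    obtain m where m: "\<And>x. x \<in> G t \<Longrightarrow> norm x \<le> m" using cwk_bounded[OF G[OF t]] by (auto simp: bounded_iff)
    obtain k :: nat where k: "m \<le> k" using real_arch_simple by blast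
    have "supp (G t) \<phi> \<le> k" if "norm \<phi> \<le> 1" for \<phi>
    proof (rule supp_least)
      show "G t \<noteq> {}" using G0[OF t] by blast
      fix x assume "x \<in> G t"
      then show "\<phi> x \<le> k" using blinfun_le_norm[OF that, of x] m[of x] k by simp
    qed
    then show ?thesis by blast
  qed
  then obtain b :: "real \<Rightarrow> nat" where b: "\<And>t \<phi>. t \<in> {0..1} \<Longrightarrow> norm \<phi> \<le> 1 \<Longrightarrow> supp (G t) \<phi> \<le> b t" by metis
  obtain C where C: "\<And>\<phi>. norm \<phi> \<le> 1 \<Longrightarrow> supp \<Phi> \<phi> \<le> C"
  proof -
    obtain m where m: "\<And>x. x \<in> \<Phi> \<Longrightarrow> norm x \<le> m" using cwk_bounded[OF \<Phi>] by (auto simp: bounded_iff)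
    have "supp \<Phi> \<phi> \<le> m" if "norm \<phi> \<le> 1" for \<phi>
    proof (rule supp_least)
      show "\<Phi> \<noteq> {}" using \<Phi>b by (simp add: bounded_convex_def)
      fix x assume "x \<in> \<Phi>"
      then show "\<phi> x \<le> m" using blinfun_le_norm[OF that, of x] m[of x] by simp
    qed
    then show ?thesis by (rule that)
  qed
  have "\<exists>\<delta>. measurable_gauge \<delta> \<and> (\<forall>p \<phi>. perron \<delta> p \<longrightarrow> norm \<phi> \<le> 1 \<longrightarrow>
    \<bar>supp \<Phi> \<phi> - (\<Sum>(t, I)\<in>p. measure lborel I * supp (G t) \<phi>)\<bar> \<le> 6 * \<epsilon>)" if e: "0 < \<epsilon>" for \<epsilon>
  proof -
    obtain P where P: "countable_partition P" and PA: "\<And>A t. countable_partition A \<Longrightarrow> finer A P \<Longrightarrow> tags_of A t \<Longrightarrow>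
        \<exists>S. set_sums (birkhoff_term G A t) S \<and> hausdorff_distance \<Phi> S < \<epsilon>"
    proof -
      obtain P where P: "countable_partition P" "\<forall>A t. countable_partition A \<and> finer A P \<and> tags_of A t \<longrightarrow>
          unconditionally_convergent (birkhoff_term G A t) \<and>
          (\<exists>S. set_sums (birkhoff_term G A t) S \<and> hausdorff_distance \<Phi> S < \<epsilon>)"
        using birkhoff[unfolded has_birkhoff_integral_def, rule_format, OF e] unfolding tags_of_def by (elim exE conjE)
      show ?thesis by (rule that[OF P(1)]) (use P(2) in simp)
    qed
    obtain Q k where Q: "countable_partition Q" "finer Q P"
        and k: "\<And>i t. measure lebesgue (Q i) = 0 \<Longrightarrow> t \<in> Q i \<Longrightarrow> b t = k i"
      by (rule partition_null_refinement[OF P, of b]) blast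
    have Q01: "Q i \<subseteq> {0..1}" for i by (rule countable_partition_subset[OF Q(1)])
    have bt: "supp (birkhoff_term G Q u i) \<phi> = measure lebesgue (Q i) * supp (G (u i)) \<phi>"
      if "tags_of Q u" for u i \<phi>
      by (rule birkhoff_term_supp(2)[OF Q(1) that Gb])
    have sums: "\<exists>\<sigma>. (\<lambda>i. measure lebesgue (Q i) * supp (G (u i)) \<phi>) sums \<sigma> \<and> \<bar>\<sigma> - supp \<Phi> \<phi>\<bar> \<le> \<epsilon>"
      if u: "tags_of Q u" and \<phi>: "norm \<phi> \<le> 1" for u \<phi>
    proof -
      obtain S where S: "set_sums (birkhoff_term G Q u) S" "hausdorff_distance \<Phi> S < \<epsilon>"
        using PA[OF Q u] by blast
      have S': "S \<in> bounded_convex" using S(1) by (simp add: set_sums_def cwk_bounded_convex)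
      have "(\<lambda>i. supp (birkhoff_term G Q u i) \<phi>) sums supp S \<phi>"
        by (rule set_sums_supp[OF birkhoff_term_supp(1)[OF Q(1) u Gb] S(1) \<phi>])
      moreover have "\<bar>supp S \<phi> - supp \<Phi> \<phi>\<bar> \<le> \<epsilon>"
        using abs_supp_diff_le_hausdorff'[OF \<Phi>b S' \<phi>] S(2) by (simp add: abs_minus_commute)
      ultimately show ?thesis unfolding bt[OF u] by blast
    qed
    define a where "a i = (SOME t. t \<in> Q i)" for i
    have a: "tags_of Q a" unfolding tags_of_def a_def by (simp add: some_in_eq)
    \<comment> \<open>On a piece of positive measure one term of a non-negative series is at most
      its sum, hence at most \<open>C + \<epsilon>\<close>; on a null piece the refinement makes
      \<open>b\<close> constant. The absolute value spares a discussion of the sign of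
      \<open>C\<close>.\<close>
    define M where "M i = (if measure lebesgue (Q i) = 0 then real (k i) else \<bar>C + \<epsilon>\<bar> / measure lebesgue (Q i))" for i
    have M0: "0 \<le> M i" for i by (simp add: M_def)
    have sM: "supp (G t) \<phi> \<le> M i" if t: "t \<in> Q i" and \<phi>: "norm \<phi> \<le> 1" for i t \<phi>
    proof (cases "measure lebesgue (Q i) = 0")
      case True
      have "t \<in> {0..1}" using t Q01 by blast
      from b[OF this \<phi>] show ?thesis using k[OF True t] True by (simp add: M_def)
    next
      case False
      then have pos: "0 < measure lebesgue (Q i)" by (simp add: less_le)
      \<comment> \<open>Every \<open>t\<close> of the piece may be its tag, so bounding this one
        term bounds all values on the piece.\<close>
      define u where "u = a(i := t)"
      have u: "tags_of Q u" using a t by (auto simp: tags_of_def u_def)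
      obtain \<sigma> where \<sigma>: "(\<lambda>i. measure lebesgue (Q i) * supp (G (u i)) \<phi>) sums \<sigma>" "\<bar>\<sigma> - supp \<Phi> \<phi>\<bar> \<le> \<epsilon>"
        using sums[OF u \<phi>] by blast
      have nn: "0 \<le> measure lebesgue (Q j) * supp (G (u j)) \<phi>" for j
      proof (cases "Q j = {}")
        case False
        then have "u j \<in> {0..1}" using u Q01[of j] unfolding tags_of_def by blast
        then show ?thesis using s_nonneg by simp
      qed simp
      have "measure lebesgue (Q i) * supp (G (u i)) \<phi> = (\<Sum>j\<in>{i}. measure lebesgue (Q j) * supp (G (u j)) \<phi>)" by simp
      also have "\<dots> \<le> (\<Sum>j. measure lebesgue (Q j) * supp (G (u j)) \<phi>)"
        using \<sigma>(1) nn by (intro sum_le_suminf) (auto simp: sums_iff)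
      also have "\<dots> = \<sigma>" using \<sigma>(1) by (simp add: sums_iff)
      also have "\<sigma> \<le> \<bar>C + \<epsilon>\<bar>" using \<sigma>(2) C[OF \<phi>] by linarith
      finally show ?thesis using pos by (simp add: M_def u_def field_simps)
    qed
    obtain N where N: "\<And>n \<phi>. norm \<phi> \<le> 1 \<Longrightarrow> (\<Sum>i\<in>{N..<n}. measure lebesgue (Q i) * supp (G (a i)) \<phi>) \<le> \<epsilon>"
    proof -
      obtain S where S: "set_sums (birkhoff_term G Q a) S" using PA[OF Q a] by blast
      have bt_a: "birkhoff_term G Q a i \<in> bounded_convex" for i
        by (rule birkhoff_term_supp(1)[OF Q(1) a Gb])
      have "0 < \<epsilon> / 2" using e by simp
      then obtain N where N: "\<And>n \<phi>. N \<le> n \<Longrightarrow> norm \<phi> \<le> 1 \<Longrightarrow>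
          \<bar>(\<Sum>i<n. supp (birkhoff_term G Q a i) \<phi>) - supp S \<phi>\<bar> \<le> \<epsilon> / 2"
        by (rule set_sums_supp_uniform[OF bt_a S]) blast
      have "(\<Sum>i\<in>{N..<n}. measure lebesgue (Q i) * supp (G (a i)) \<phi>) \<le> \<epsilon>" if \<phi>: "norm \<phi> \<le> 1" for n \<phi>
      proof (cases "N \<le> n")
        case True
        have "(\<Sum>i\<in>{N..<n}. supp (birkhoff_term G Q a i) \<phi>) =
            (\<Sum>i<n. supp (birkhoff_term G Q a i) \<phi>) - (\<Sum>i<N. supp (birkhoff_term G Q a i) \<phi>)"
          using sum_diff_nat_ivl[of 0 N n "\<lambda>i. supp (birkhoff_term G Q a i) \<phi>"] True by (simp add: atLeast0LessThan)
        also have "\<dots> \<le> \<epsilon>" using N[OF True \<phi>] N[OF order_refl \<phi>] by linarith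
        finally show ?thesis by (simp only: bt[OF a])
      qed (use e in simp)
      then show ?thesis by (rule that)
    qed
    \<comment> \<open>\<open>K + M i\<close> exceeds both \<open>M i\<close> and the sum of the
      first \<open>N\<close> bounds, so a single \<open>\<tau> i\<close> meets both smallness
      conditions; the \<open>1\<close> keeps the denominator positive.\<close>
    define K where "K = 1 + (\<Sum>j<N. M j)"
    have K: "1 \<le> K" using M0 by (simp add: K_def sum_nonneg)
    define \<tau> where "\<tau> i = \<epsilon> * (1/2) ^ Suc i / (K + M i)" for i
    have KM: "0 < K + M i" for i using K M0[of i] by linarith
    have \<tau>: "0 < \<tau> i" for i using e KM[of i] by (simp add: \<tau>_def)
    have \<tau>_le: "c * \<tau> i \<le> \<epsilon> * (1/2) ^ Suc i" if "c \<le> K + M i" for c i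
    proof -
      have "c * \<tau> i \<le> (K + M i) * \<tau> i" using that \<tau>[of i] by (intro mult_right_mono) auto
      also have "(K + M i) * \<tau> i = \<epsilon> * (1/2) ^ Suc i"
        unfolding \<tau>_def using KM[of i] by (simp del: power_Suc)
      finally show ?thesis .
    qed
    have \<tau>M: "M i * \<tau> i \<le> \<epsilon> * (1/2) ^ Suc i" "(\<Sum>j<N. M j) * \<tau> i \<le> \<epsilon> * (1/2) ^ Suc i" for i
      using K M0[of i] by (intro \<tau>_le; simp add: K_def)+
    have "\<exists>V. open V \<and> Q i \<subseteq> V \<and> V - Q i \<in> lmeasurable \<and> measure lebesgue (V - Q i) \<le> \<tau> i" for i
    proof -
      have "Q i \<in> sets lebesgue" using Q(1) by (simp add: countable_partition_def)
      from sets_lebesgue_outer_open[OF this \<tau>[of i]] obtain V where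
        V: "open V" "Q i \<subseteq> V" "V - Q i \<in> lmeasurable" "emeasure lebesgue (V - Q i) < ennreal (\<tau> i)" by blast
      then have "measure lebesgue (V - Q i) \<le> \<tau> i"
        using \<tau>[of i] by (simp add: emeasure_eq_measure2 ennreal_less_iff)
      then show ?thesis using V by blast
    qed
    then obtain V where V: "\<And>i. open (V i)" "\<And>i. Q i \<subseteq> V i" "\<And>i. V i - Q i \<in> lmeasurable"
        "\<And>i. measure lebesgue (V i - Q i) \<le> \<tau> i" by metis
    obtain \<delta> idx where \<delta>: "measurable_gauge \<delta>" "\<And>t. t \<in> {0..1} \<Longrightarrow> t \<in> Q (idx t)"
        "\<And>p t I. perron \<delta> p \<Longrightarrow> (t, I) \<in> p \<Longrightarrow> I \<subseteq> V (idx t)"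
      by (rule open_cover_gauge[OF Q(1) V(1,2)]) blast
    have "\<bar>supp \<Phi> \<phi> - (\<Sum>(t, I)\<in>p. measure lborel I * supp (G t) \<phi>)\<bar> \<le> 6 * \<epsilon>"
      if p: "perron \<delta> p" and \<phi>: "norm \<phi> \<le> 1" for p \<phi>
    proof -
      have "p tagged_division_of {0..1}" using p by (simp add: perron_def)
      then have "\<bar>(\<Sum>(t, I)\<in>p. measure lborel I * supp (G t) \<phi>) - supp \<Phi> \<phi>\<bar> \<le> 6 * \<epsilon>"
        by (rule perron_sum_near_partition_sum[where s = "\<lambda>t. supp (G t) \<phi>", OF _ Q(1) \<delta>(2) V(3,4) \<delta>(3)[OF p]
            s_nonneg sM[OF _ \<phi>] M0 \<tau>M sums[OF _ \<phi>] a N[OF \<phi>]])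
      then show ?thesis by (simp add: abs_minus_commute)
    qed
    with \<delta>(1) show ?thesis by blast
  qed
  note * = this
  have "has_H_integral G \<Phi>"
  proof (rule has_H_integral_iff_supp[OF Gb \<Phi>b, THEN iffD2], assumption, intro allI impI)
    fix \<epsilon> :: real assume "0 < \<epsilon>"
    then show "\<exists>\<delta>. measurable_gauge \<delta> \<and> (\<forall>p \<phi>. perron \<delta> p \<longrightarrow> norm \<phi> \<le> 1 \<longrightarrow>
      \<bar>supp \<Phi> \<phi> - (\<Sum>(t, I)\<in>p. measure lborel I * supp (G t) \<phi>)\<bar> \<le> \<epsilon>)"
      using *[of "\<epsilon> / 6"] by simp
  qed
  with \<Phi> show ?thesis unfolding H_integrable_def by blast
qed

subsection \<open>From the \<open>\<H>\<close>-integral to the Birkhoff integral\<close>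

text \<open>The choices from the sets \<open>D j\<close> are independent, so suprema can be taken
  one summand at a time. A bound for every choice of tags thus becomes a bound for the sum of
  oscillations, which come out finite as well.\<close>

lemma sum_Sup_le:
  fixes D :: "'i \<Rightarrow> real set"
  assumes "finite J" "\<And>j. j \<in> J \<Longrightarrow> D j \<noteq> {}"
    and "\<And>d. (\<And>j. j \<in> J \<Longrightarrow> d j \<in> D j) \<Longrightarrow> (\<Sum>j\<in>J. d j) \<le> C"
  shows "(\<forall>j\<in>J. bdd_above (D j)) \<and> (\<Sum>j\<in>J. Sup (D j)) \<le> C"
  using assms
proof (induction J arbitrary: C rule: finite_induct)
  case empty
  then show ?case by simp
next
  case (insert a J)
  have IH: "(\<forall>j\<in>J. bdd_above (D j)) \<and> (\<Sum>j\<in>J. Sup (D j)) \<le> C - v" if v: "v \<in> D a" for v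
  proof (rule insert.IH)
    show "D j \<noteq> {}" if "j \<in> J" for j using insert.prems(1) that by blast
    fix d assume d: "\<And>j. j \<in> J \<Longrightarrow> d j \<in> D j"
    have "(\<Sum>j\<in>insert a J. (d(a := v)) j) \<le> C"
      by (rule insert.prems(2)) (use d v in auto)
    moreover have "(\<Sum>j\<in>J. (d(a := v)) j) = (\<Sum>j\<in>J. d j)"
      using insert.hyps(2) by (intro sum.cong) auto
    ultimately show "(\<Sum>j\<in>J. d j) \<le> C - v"
      using insert.hyps by simp
  qed
  have ne: "D a \<noteq> {}" using insert.prems(1) by blast
  have le: "v \<le> C - (\<Sum>j\<in>J. Sup (D j))" if "v \<in> D a" for v
    using IH[OF that] by simp
  then have "bdd_above (D a)" by (rule bdd_aboveI)
  moreover have "Sup (D a) \<le> C - (\<Sum>j\<in>J. Sup (D j))" by (rule cSup_least[OF ne le])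
  moreover obtain v where "v \<in> D a" using ne by blast
  then have "\<forall>j\<in>J. bdd_above (D j)" using IH[of v] by simp
  ultimately show ?case using insert.hyps by simp
qed

text \<open>\<open>\<delta>\<close> may be non-positive outside the unit interval, where a gauge
  still needs open neighbourhoods; tags never lie there.\<close>

lemma gauge_fine_iff:
  assumes "measurable_gauge \<delta>"
  obtains \<gamma> where "gauge \<gamma>"
    "\<And>p. p tagged_partial_division_of {0..1} \<Longrightarrow> \<gamma> fine p \<longleftrightarrow> (\<lambda>t. {t - \<delta> t<..<t + \<delta> t}) fine p"
proof -
  define \<gamma> where "\<gamma> t = (if t \<in> {0..1} then {t - \<delta> t<..<t + \<delta> t} else UNIV)" for t
  have "gauge \<gamma>" using assms by (auto simp: gauge_def \<gamma>_def measurable_gauge_def)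
  moreover have "\<gamma> fine p \<longleftrightarrow> (\<lambda>t. {t - \<delta> t<..<t + \<delta> t}) fine p"
    if p: "p tagged_partial_division_of {0..1}" for p
  proof -
    have "\<gamma> t = {t - \<delta> t<..<t + \<delta> t}" if "(t, I) \<in> p" for t I
    proof -
      have "t \<in> {0..1}" using p that unfolding tagged_partial_division_of_def by blast
      then show ?thesis unfolding \<gamma>_def by (rule if_P)
    qed
    then show ?thesis unfolding fine_def by fastforce
  qed
  ultimately show ?thesis by (rule that)
qed

section \<open>Henstock's lemma and oscillation on the cells of a grid\<close>

lemma has_integral_perron:
  fixes f :: "real \<Rightarrow> real"
  assumes "\<And>\<epsilon>. 0 < \<epsilon> \<Longrightarrow> \<exists>\<delta>. measurable_gauge \<delta> \<and>
    (\<forall>p. perron \<delta> p \<longrightarrow> \<bar>y - (\<Sum>(t, I)\<in>p. measure lborel I * f t)\<bar> \<le> \<epsilon>)"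
  shows "(f has_integral y) {0..1}"
proof -
  have "(f has_integral y) (cbox 0 1)"
    unfolding has_integral
  proof (intro allI impI)
    fix e :: real assume e: "0 < e"
    then have "0 < e / 2" by simp
    then obtain \<delta> where \<delta>: "measurable_gauge \<delta>"
      "\<And>p. perron \<delta> p \<Longrightarrow> \<bar>y - (\<Sum>(t, I)\<in>p. measure lborel I * f t)\<bar> \<le> e / 2"
      using assms by blast
    obtain \<gamma> where \<gamma>: "gauge \<gamma>"
      "\<And>p. p tagged_partial_division_of {0..1} \<Longrightarrow> \<gamma> fine p \<longleftrightarrow> (\<lambda>t. {t - \<delta> t<..<t + \<delta> t}) fine p"
      by (rule gauge_fine_iff[OF \<delta>(1)]) blast
    show "\<exists>\<gamma>. gauge \<gamma> \<and> (\<forall>p. p tagged_division_of cbox 0 1 \<and> \<gamma> fine p \<longrightarrow>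
        norm ((\<Sum>(x, k)\<in>p. measure lborel k *\<^sub>R f x) - y) < e)"
    proof (intro exI[of _ \<gamma>] conjI allI impI \<gamma>(1); elim conjE)
      fix p assume p: "p tagged_division_of cbox 0 (1::real)" "\<gamma> fine p"
      have "p tagged_division_of {0..1}" using p(1) by simp
      then have "perron \<delta> p"
        using \<gamma>(2)[of p] p(2) unfolding perron_def tagged_division_of_def by blast
      from \<delta>(2)[OF this] show "norm ((\<Sum>(x, k)\<in>p. measure lborel k *\<^sub>R f x) - y) < e"
        using e by (simp add: abs_minus_commute)
    qed
  qed
  then show ?thesis by simp
qed

text \<open>The real-valued lemma is applied to one functional at a time; the result is uniform over
  the dual ball since \<open>\<delta>\<close> and \<open>e\<close> can be the same for all of
  them.\<close>

lemma Henstock_lemma_perron: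
  fixes f :: "real \<Rightarrow> real"
  assumes f: "(f has_integral y) {0..1}" and \<delta>: "measurable_gauge \<delta>" and e: "0 < e"
    and le: "\<And>p. perron \<delta> p \<Longrightarrow> \<bar>y - (\<Sum>(t, I)\<in>p. measure lborel I * f t)\<bar> < e"
    and q: "q tagged_partial_division_of {0..1}" "(\<lambda>t. {t - \<delta> t<..<t + \<delta> t}) fine q"
  shows "\<bar>\<Sum>(t, I)\<in>q. measure lborel I * f t - integral I f\<bar> \<le> e"
proof -
  obtain \<gamma> where \<gamma>: "gauge \<gamma>"
    "\<And>p. p tagged_partial_division_of {0..1} \<Longrightarrow> \<gamma> fine p \<longleftrightarrow> (\<lambda>t. {t - \<delta> t<..<t + \<delta> t}) fine p"
    by (rule gauge_fine_iff[OF \<delta>]) blast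
  have "(f has_integral y) (cbox 0 1)" using f by simp
  then have int: "f integrable_on cbox 0 1" "integral (cbox 0 1) f = y"
    by (auto simp: integral_unique integrable_on_def)
  have "norm (\<Sum>(t, I)\<in>q. measure lborel I *\<^sub>R f t - integral I f) \<le> e"
  proof (rule Henstock_lemma_part1[OF int(1) e \<gamma>(1)])
    show "q tagged_partial_division_of cbox 0 1" using q(1) by simp
    show "\<gamma> fine q" using \<gamma>(2)[OF q(1)] q(2) by blast
    fix p assume p: "p tagged_division_of cbox 0 (1::real)" "\<gamma> fine p"
    then have "perron \<delta> p"
      using \<gamma>(2)[of p] unfolding perron_def tagged_division_of_def by simp
    from le[OF this] show "norm ((\<Sum>(x, K)\<in>p. measure lborel K *\<^sub>R f x) - integral (cbox 0 1) f) < e"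
      unfolding int(2) by (simp add: abs_minus_commute)
  qed
  then show ?thesis by simp
qed

text \<open>Half-open, so that the cells of one grid are disjoint; the cells with
  \<open>j < K\<close> miss the point \<open>1\<close>, a null set.\<close>

definition cell :: "nat \<Rightarrow> nat \<Rightarrow> real set" where
  "cell K j = {real j / real K..<real (Suc j) / real K}"

lemma cells_tagged_partial_division:
  assumes K: "0 < K" and J: "J \<subseteq> {..<K}" and x: "\<And>j. j \<in> J \<Longrightarrow> x j \<in> cell K j"
  shows "(\<lambda>j. (x j, {real j / real K..real (Suc j) / real K})) ` J tagged_partial_division_of {0..1}"
proof -
  define I where "I j = {real j / real K..real (Suc j) / real K}" for j
  have I01: "I j \<subseteq> {0..1}" if "j \<in> J" for j
  proof -
    have "real (Suc j) \<le> real K" using J that by (intro of_nat_mono) auto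
    then show ?thesis using K by (auto simp: I_def field_simps)
  qed
  have interior: "interior (I i) \<inter> interior (I j) = {}" if "i \<noteq> j" for i j
  proof -
    have "interior (I i) \<inter> interior (I j) = {}" if "i < j" for i j
    proof -
      have "real (Suc i) / real K \<le> real j / real K" using that K by (intro divide_right_mono) auto
      then show ?thesis by (auto simp: I_def)
    qed
    then show ?thesis using \<open>i \<noteq> j\<close> by (metis Int_commute nat_neq_iff)
  qed
  have xI: "x j \<in> I j" if "j \<in> J" for j using x[OF that] by (auto simp: I_def cell_def)
  have fin: "finite J" using J by (rule finite_subset) simp
  show ?thesis
    unfolding tagged_partial_division_of_def I_def[symmetric]
  proof (intro conjI allI impI; (elim conjE)?)
    show "finite ((\<lambda>j. (x j, I j)) ` J)" using fin by simp
    fix t k assume "(t, k) \<in> (\<lambda>j. (x j, I j)) ` J"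
    then obtain j where j: "j \<in> J" "t = x j" "k = I j" by blast
    show "t \<in> k" using xI[OF j(1)] j by simp
    show "k \<subseteq> {0..1}" using I01[OF j(1)] j by simp
    show "\<exists>a b. k = cbox a b" using j by (auto simp: I_def)
    fix t' k' assume "(t', k') \<in> (\<lambda>j. (x j, I j)) ` J" "(t, k) \<noteq> (t', k')"
    then obtain j' where j': "j' \<in> J" "t' = x j'" "k' = I j'" "(t, k) \<noteq> (t', k')" by blast
    then have "j \<noteq> j'" using j by auto
    then show "interior k \<inter> interior k' = {}" using interior j j' by simp
  qed
qed

text \<open>Every point of \<open>E j\<close> can tag the closed cell, whose length is below
  \<open>\<delta>\<close> there. For two choices of tags Henstock's lemma compares both sums with
  the same integrals over the cells, and these cancel in the difference. The \<open>\<omega>\<close>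
  found depends on \<open>f\<close>, but the bound \<open>2 * e\<close> does not.\<close>

lemma oscillation_on_cells:
  fixes f :: "real \<Rightarrow> real"
  assumes f: "(f has_integral y) {0..1}" and \<delta>: "measurable_gauge \<delta>" and e: "0 < e"
    and le: "\<And>p. perron \<delta> p \<Longrightarrow> \<bar>y - (\<Sum>(t, I)\<in>p. measure lborel I * f t)\<bar> < e"
    and K: "0 < K" and E: "\<And>j t. j < K \<Longrightarrow> t \<in> E j \<Longrightarrow> t \<in> cell K j \<and> 1 / real K < \<delta> t"
  obtains \<omega> where "\<And>j. 0 \<le> \<omega> j" "\<And>j s t. j < K \<Longrightarrow> s \<in> E j \<Longrightarrow> t \<in> E j \<Longrightarrow> \<bar>f s - f t\<bar> \<le> \<omega> j"
    "(\<Sum>j<K. \<omega> j / real K) \<le> 2 * e"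
proof -
  define J where "J = {j. j < K \<and> E j \<noteq> {}}"
  have J: "J \<subseteq> {..<K}" "finite J" by (auto simp: J_def)
  define I where "I j = {real j / real K..real (Suc j) / real K}" for j
  have I_len: "measure lborel (I j) = 1 / real K" for j
    using K by (simp add: I_def diff_divide_distrib[symmetric] divide_right_mono)
  have I_inj: "inj I" 
  proof (rule injI)
    fix i j assume "I i = I j"
    then have "real i / real K = real j / real K"
      using K by (simp add: I_def Icc_eq_Icc divide_right_mono)
    then show "i = j" using K by simp
  qed
  have partial: "\<bar>(\<Sum>j\<in>J. f (x j) / real K - integral (I j) f)\<bar> \<le> e" if x: "\<And>j. j \<in> J \<Longrightarrow> x j \<in> E j" for x
  proof -
    have xc: "x j \<in> cell K j" "1 / real K < \<delta> (x j)" if "j \<in> J" for j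
      using E[of j "x j"] x[OF that] that by (auto simp: J_def)
    have inj: "inj_on (\<lambda>j. (x j, I j)) J" using I_inj by (auto simp: inj_on_def inj_def)
    have fine: "(\<lambda>t. {t - \<delta> t<..<t + \<delta> t}) fine (\<lambda>j. (x j, I j)) ` J"
      unfolding fine_def
    proof (intro ballI, clarify)
      fix j u assume j: "j \<in> J" "u \<in> I j"
      have "real (Suc j) / real K = real j / real K + 1 / real K" by (simp add: add_divide_distrib)
      then show "u \<in> {x j - \<delta> (x j)<..<x j + \<delta> (x j)}"
        using xc[OF j(1)] j(2) unfolding cell_def I_def by auto
    qed
    have "\<bar>\<Sum>(t, k)\<in>(\<lambda>j. (x j, I j)) ` J. measure lborel k * f t - integral k f\<bar> \<le> e"
      using cells_tagged_partial_division[OF K J(1) xc(1)] fine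
      by (intro Henstock_lemma_perron[OF f \<delta> e le]) (simp_all add: I_def)
    then show ?thesis by (simp add: sum.reindex[OF inj] I_len)
  qed
  have pair: "(\<Sum>j\<in>J. \<bar>f (x j) - f (z j)\<bar> / real K) \<le> 2 * e"
    if x: "\<And>j. j \<in> J \<Longrightarrow> x j \<in> E j" and z: "\<And>j. j \<in> J \<Longrightarrow> z j \<in> E j" for x z
  proof -
    \<comment> \<open>The larger value goes to \<open>v\<close> in every cell, so that a difference
      of two sums equals the sum of absolute differences.\<close>
    define v where "v j = (if f (x j) \<le> f (z j) then z j else x j)" for j
    define w where "w j = (if f (x j) \<le> f (z j) then x j else z j)" for j
    have "(\<Sum>j\<in>J. \<bar>f (x j) - f (z j)\<bar> / real K) =
        (\<Sum>j\<in>J. f (v j) / real K - integral (I j) f) - (\<Sum>j\<in>J. f (w j) / real K - integral (I j) f)"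
      unfolding sum_subtractf[symmetric]
      by (intro sum.cong) (auto simp: v_def w_def diff_divide_distrib)
    also have "\<dots> \<le> 2 * e"
    proof -
      have "v j \<in> E j" "w j \<in> E j" if "j \<in> J" for j
        using x[OF that] z[OF that] by (simp_all add: v_def w_def)
      from partial[OF this(1)] partial[OF this(2)] show ?thesis by linarith
    qed
    finally show ?thesis .
  qed
  define D where "D j = {\<bar>f s - f t\<bar> / real K |s t. s \<in> E j \<and> t \<in> E j}" for j
  have Dne: "D j \<noteq> {}" if "j \<in> J" for j using that by (auto simp: D_def J_def)
  have "(\<forall>j\<in>J. bdd_above (D j)) \<and> (\<Sum>j\<in>J. Sup (D j)) \<le> 2 * e"
  proof (rule sum_Sup_le[OF J(2) Dne])
    fix d assume d: "\<And>j. j \<in> J \<Longrightarrow> d j \<in> D j"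
    then have "\<forall>j\<in>J. \<exists>s t. s \<in> E j \<and> t \<in> E j \<and> d j = \<bar>f s - f t\<bar> / real K" unfolding D_def by blast
    then obtain x z where xz: "\<And>j. j \<in> J \<Longrightarrow> x j \<in> E j" "\<And>j. j \<in> J \<Longrightarrow> z j \<in> E j"
      "\<And>j. j \<in> J \<Longrightarrow> d j = \<bar>f (x j) - f (z j)\<bar> / real K" by metis
    have "(\<Sum>j\<in>J. d j) = (\<Sum>j\<in>J. \<bar>f (x j) - f (z j)\<bar> / real K)" by (intro sum.cong refl xz(3))
    also have "\<dots> \<le> 2 * e" by (rule pair[OF xz(1,2)])
    finally show "(\<Sum>j\<in>J. d j) \<le> 2 * e" .
  qed
  then have bdd: "\<And>j. j \<in> J \<Longrightarrow> bdd_above (D j)" and Sup_le: "(\<Sum>j\<in>J. Sup (D j)) \<le> 2 * e"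
    by simp_all
  \<comment> \<open>The elements of \<open>D j\<close> carry the factor \<open>1 / real K\<close>,
    which is undone here. For \<open>j\<close> outside \<open>J\<close> no two points are to be
    compared, and the default \<open>0\<close> keeps \<open>\<omega>\<close> non-negative.\<close>
  define \<omega> where "\<omega> j = (if j \<in> J then Sup (D j) * real K else 0)" for j
  show ?thesis
  proof (rule that)
    show osc: "\<bar>f s - f t\<bar> \<le> \<omega> j" if "j < K" "s \<in> E j" "t \<in> E j" for j s t
    proof -
      have j: "j \<in> J" using that by (auto simp: J_def)
      have "\<bar>f s - f t\<bar> / real K \<in> D j" using that unfolding D_def by blast
      then have "\<bar>f s - f t\<bar> / real K \<le> Sup (D j)" using bdd[OF j] by (rule cSup_upper)
      then show ?thesis using j K by (simp add: \<omega>_def field_simps)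
    qed
    show "0 \<le> \<omega> j" for j
    proof (cases "j \<in> J")
      case True
      then obtain t where "t \<in> E j" "j < K" by (auto simp: J_def)
      then show ?thesis using osc[of j t t] by simp
    qed (simp add: \<omega>_def)
    have "(\<Sum>j<K. \<omega> j / real K) = (\<Sum>j\<in>J. Sup (D j))"
      using K J by (intro sum.mono_neutral_cong_right) (auto simp: \<omega>_def)
    then show "(\<Sum>j<K. \<omega> j / real K) \<le> 2 * e" using Sup_le by simp
  qed
qed

text \<open>Here measurability of the gauge enters: its sublevel sets are measurable and decrease to
  the empty set, so their measures tend to zero.\<close>

lemma gauge_level_small:
  assumes \<delta>: "measurable_gauge \<delta>" and e: "0 < e"
  obtains K where "0 < K" "{t \<in> {0..1}. \<delta> t \<le> 1 / real K} \<in> lmeasurable"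
    "measure lebesgue {t \<in> {0..1}. \<delta> t \<le> 1 / real K} < e"
proof -
  define B where "B k = {t \<in> {0..1}. \<delta> t \<le> 1 / real (Suc k)}" for k
  have meas: "B k \<in> sets lebesgue" for k
  proof -
    have "\<delta> \<in> borel_measurable (lebesgue_on {0..1})" using \<delta> by (simp add: measurable_gauge_def)
    then have "{t \<in> space (lebesgue_on {0..1}). \<delta> t \<le> 1 / real (Suc k)} \<in> sets (lebesgue_on {0..1})"
      by (rule borel_measurable_le[OF _ borel_measurable_const])
    moreover have "{t \<in> space (lebesgue_on {0..1}). \<delta> t \<le> 1 / real (Suc k)} = B k"
      unfolding B_def by (simp add: space_restrict_space)
    ultimately show ?thesis by (simp add: sets_restrict_space_iff)
  qed
  have lm: "B k \<in> lmeasurable" for k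
  proof (rule bounded_set_imp_lmeasurable[OF _ meas])
    show "bounded (B k)" by (rule bounded_subset[OF bounded_closed_interval[of 0 1]]) (auto simp: B_def)
  qed
  have "(\<lambda>k. measure lebesgue (B k)) \<longlonglongrightarrow> measure lebesgue (\<Inter>k. B k)"
  proof (rule Lim_measure_decseq)
    show "range B \<subseteq> sets lebesgue" using meas by blast
    show "decseq B"
    proof (rule decseq_SucI)
      fix k
      have "1 / real (Suc (Suc k)) \<le> 1 / real (Suc k)" by (simp add: frac_le)
      then show "B (Suc k) \<subseteq> B k" unfolding B_def using order_trans by blast
    qed
    show "emeasure lebesgue (B k) \<noteq> \<infinity>" for k using fmeasurableD2[OF lm] by simp
  qed
  moreover have "(\<Inter>k. B k) = {}"
  proof (rule equals0I)
    fix t assume t: "t \<in> (\<Inter>k. B k)"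
    then have "t \<in> {0..1}" by (auto simp: B_def)
    then have "0 < \<delta> t" using \<delta> unfolding measurable_gauge_def by blast
    then obtain k where "inverse (real (Suc k)) < \<delta> t" using reals_Archimedean by blast
    moreover have "t \<in> B k" using t by blast
    ultimately show False by (simp add: B_def inverse_eq_divide)
  qed
  ultimately have "(\<lambda>k. measure lebesgue (B k)) \<longlonglongrightarrow> 0" by simp
  then have "eventually (\<lambda>k. measure lebesgue (B k) < e) sequentially"
    using e by (rule order_tendstoD(2))
  then obtain k where k: "measure lebesgue (B k) < e" unfolding eventually_sequentially by blast
  show ?thesis
    by (rule that[of "Suc k", OF _ lm[of k, unfolded B_def] k[unfolded B_def]]) simp
qed

lemma cell_disjoint: "0 < K \<Longrightarrow> t \<in> cell K i \<Longrightarrow> t \<in> cell K j \<Longrightarrow> i = j"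
proof (rule ccontr)
  assume K: "0 < K" and t: "t \<in> cell K i" "t \<in> cell K j" and "i \<noteq> j"
  have *: "real (Suc a) / real K \<le> real b / real K" if "a < b" for a b
    using that K by (intro divide_right_mono) auto
  from \<open>i \<noteq> j\<close> consider "i < j" | "j < i" by linarith
  then show False using t *[of i j] *[of j i] by cases (auto simp: cell_def)
qed

lemma cell_cover:
  assumes "0 < K" "t \<in> {0..<1}"
  obtains j where "j < K" "t \<in> cell K j"
proof -
  define j where "j = nat \<lfloor>t * real K\<rfloor>"
  have tK: "0 \<le> t * real K" "t * real K < real K" using assms by (auto simp: mult_less_cancel_right2)
  then have "real j \<le> t * real K" "t * real K < real (Suc j)"
    unfolding j_def by (simp_all add: of_nat_floor) linarith+
  moreover from this tK have "j < K" by (metis le_less_trans of_nat_less_iff)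
  ultimately show ?thesis using assms by (intro that[of j]) (auto simp: cell_def field_simps)
qed

text \<open>On the \<open>m\<close>-th level the \<open>m\<close>-th gauge exceeds the mesh \<open>1 / K m\<close>, so any two points of one piece of that
  level can tag the same interval; piece \<open>0\<close> is a null set.\<close>

lemma gauge_partition:
  assumes \<delta>: "\<And>m. measurable_gauge (\<delta> m)"
  obtains K :: "nat \<Rightarrow> nat" and P where "\<And>m. 0 < K m" "countable_partition P" "measure lebesgue (P 0) = 0"
    "\<And>m j t. t \<in> P (Suc (prod_encode (m, j))) \<Longrightarrow> j < K m \<and> t \<in> cell (K m) j \<and> 1 / real (K m) < \<delta> m t"
proof -
  have ex: "\<forall>m. \<exists>k. 0 < k \<and> {t \<in> {0..1}. \<delta> m t \<le> 1 / real k} \<in> lmeasurable \<and>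
      measure lebesgue {t \<in> {0..1}. \<delta> m t \<le> 1 / real k} < inverse (real (Suc m))"
  proof
    fix m
    have "0 < inverse (real (Suc m))" by simp
    then obtain k where "0 < k" "{t \<in> {0..1}. \<delta> m t \<le> 1 / real k} \<in> lmeasurable"
      "measure lebesgue {t \<in> {0..1}. \<delta> m t \<le> 1 / real k} < inverse (real (Suc m))"
      by (rule gauge_level_small[OF \<delta>[of m]])
    then show "\<exists>k. 0 < k \<and> {t \<in> {0..1}. \<delta> m t \<le> 1 / real k} \<in> lmeasurable \<and>
      measure lebesgue {t \<in> {0..1}. \<delta> m t \<le> 1 / real k} < inverse (real (Suc m))" by (intro exI conjI)
  qed
  obtain K where K_all: "\<forall>m. 0 < K m \<and> {t \<in> {0..1}. \<delta> m t \<le> 1 / real (K m)} \<in> lmeasurable \<and>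
      measure lebesgue {t \<in> {0..1}. \<delta> m t \<le> 1 / real (K m)} < inverse (real (Suc m))"
    using choice[OF ex] by (rule exE)
  have K: "0 < K m" "{t \<in> {0..1}. \<delta> m t \<le> 1 / real (K m)} \<in> lmeasurable"
      "measure lebesgue {t \<in> {0..1}. \<delta> m t \<le> 1 / real (K m)} < inverse (real (Suc m))" for m
    using K_all[THEN spec, of m] by - (elim conjE, assumption)+
  define H where "H m = {t \<in> {0..1}. 1 / real (K m) < \<delta> m t}" for m
  \<comment> \<open>Each point goes to the first level whose gauge exceeds the mesh there; the
    disjoint levels are then cut by the cells of their grids.\<close>
  define L where "L = disjointed H"
  define E where "E m j = (if j < K m then L m \<inter> cell (K m) j else {})" for m j
  define R where "R i = E (fst (prod_decode i)) (snd (prod_decode i))" for i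
  define P where "P n = (case n of 0 \<Rightarrow> {0..1} - (\<Union>i. R i) | Suc i \<Rightarrow> R i)" for n
  have H_eq: "H m = {0..1} - {t \<in> {0..1}. \<delta> m t \<le> 1 / real (K m)}" for m by (auto simp: H_def)
  have H_meas: "H m \<in> sets lebesgue" for m
    unfolding H_eq using K(2)[of m] by (intro sets.Diff) auto
  have L_meas: "L m \<in> sets lebesgue" for m
    using sets.range_disjointed_sets[of H lebesgue] H_meas unfolding L_def by blast
  have LH: "L m \<subseteq> H m" for m unfolding L_def by (rule disjointed_subset)
  have L_disj: "L m \<inter> L m' = {}" if "m \<noteq> m'" for m m'
    using disjoint_family_disjointed[of H] that unfolding L_def disjoint_family_on_def by blast
  have E_disj: "E m j \<inter> E m' j' = {}" if "(m, j) \<noteq> (m', j')" for m j m' j'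
  proof (cases "m = m'")
    case True
    then show ?thesis using that cell_disjoint[OF K(1), of _ m j j'] by (auto simp: E_def)
  next
    case False
    then show ?thesis using L_disj[OF False] by (auto simp: E_def)
  qed
  have R_disj: "R i \<inter> R i' = {}" if "i \<noteq> i'" for i i'
  proof -
    have "prod_decode i \<noteq> prod_decode i'" using that by simp
    then show ?thesis unfolding R_def by (intro E_disj) (simp add: prod_eq_iff)
  qed
  have "cell k j \<in> sets lebesgue" for k j unfolding cell_def by simp
  then have "E m j \<in> sets lebesgue" for m j
    using L_meas[of m] unfolding E_def by (cases "j < K m") auto
  then have R_meas: "R i \<in> sets lebesgue" for i unfolding R_def .
  have "L m \<subseteq> {0..1}" for m using LH[of m] by (rule order_trans) (auto simp: H_def)
  then have "E m j \<subseteq> {0..1}" for m j unfolding E_def by (cases "j < K m") (simp_all add: le_infI1)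
  then have R01: "R i \<subseteq> {0..1}" for i unfolding R_def .
  have P: "countable_partition P"
    unfolding countable_partition_def
  proof (intro conjI allI)
    show "P n \<in> sets lebesgue" for n
      unfolding P_def using R_meas by (cases n) auto
    show "disjoint_family P"
      unfolding disjoint_family_on_def P_def using R_disj by (auto split: nat.splits)
    show "(\<Union>n. P n) = {0..1}"
    proof
      have "P n \<subseteq> {0..1}" for n unfolding P_def using R01 by (cases n) (simp_all add: Diff_subset)
      then show "(\<Union>n. P n) \<subseteq> {0..1}" by (rule UN_least)
      show "{0..1} \<subseteq> (\<Union>n. P n)"
      proof
        fix t :: real assume t: "t \<in> {0..1}"
        show "t \<in> (\<Union>n. P n)"
        proof (cases "\<exists>i. t \<in> R i")
          case True
          then obtain i where "t \<in> P (Suc i)" by (auto simp: P_def)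
          then show ?thesis by blast
        next
          case False
          then have "t \<in> P 0" using t by (auto simp: P_def)
          then show ?thesis by blast
        qed
      qed
    qed
  qed
  \<comment> \<open>A point below \<open>1\<close> outside all levels lies in every exceptional set,
    and the measures of these tend to zero; \<open>1\<close> is added because the cells miss
    it.\<close>
  have "measure lebesgue (P 0) \<le> inverse (real (Suc m))" for m
  proof -
    have "P 0 \<subseteq> {t \<in> {0..1}. \<delta> m t \<le> 1 / real (K m)} \<union> {1}"
    proof
      fix t assume t: "t \<in> P 0"
      then have t01: "t \<in> {0..1}" by (auto simp: P_def)
      show "t \<in> {t \<in> {0..1}. \<delta> m t \<le> 1 / real (K m)} \<union> {1}"
      proof (rule ccontr)
        assume "t \<notin> {t \<in> {0..1}. \<delta> m t \<le> 1 / real (K m)} \<union> {1}"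
        then have tH: "t \<in> H m" and t1: "t \<in> {0..<1}" using t01 by (auto simp: H_def)
        then have "t \<in> (\<Union>m. L m)" using tH UN_disjointed_eq[of H] unfolding L_def by blast
        then obtain m' where m': "t \<in> L m'" by blast
        obtain j where j: "j < K m'" "t \<in> cell (K m') j" by (rule cell_cover[OF K(1) t1])
        have "t \<in> R (prod_encode (m', j))" using m' j by (simp add: R_def E_def)
        then show False using t by (auto simp: P_def)
      qed
    qed
    moreover have one: "{1::real} \<in> lmeasurable" using lmeasurable_cbox[of "1::real" 1] by simp
    have "{t \<in> {0..1}. \<delta> m t \<le> 1 / real (K m)} \<union> {1} \<in> lmeasurable"
      by (rule fmeasurable.Un[OF K(2) one])
    moreover have "P 0 \<in> sets lebesgue" using P by (simp add: countable_partition_def)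
    ultimately have "measure lebesgue (P 0) \<le> measure lebesgue ({t \<in> {0..1}. \<delta> m t \<le> 1 / real (K m)} \<union> {1})"
      by (intro measure_mono_fmeasurable)
    also have "\<dots> \<le> measure lebesgue {t \<in> {0..1}. \<delta> m t \<le> 1 / real (K m)} + measure lebesgue {1::real}"
      by (intro measure_Un_le fmeasurableD K(2) one)
    finally show ?thesis using K(3)[of m] by simp
  qed
  then have "measure lebesgue (P 0) \<le> 0"
    using LIMSEQ_inverse_real_of_nat by (intro LIMSEQ_le_const[of "\<lambda>m. inverse (real (Suc m))"]) blast+
  then have P0: "measure lebesgue (P 0) = 0" using measure_nonneg[of lebesgue "P 0"] by simp
  show ?thesis
  proof (rule that[OF K(1) P P0])
    fix m j t assume "t \<in> P (Suc (prod_encode (m, j)))"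
    then have "t \<in> E m j" by (simp add: P_def R_def)
    then have "j < K m" "t \<in> L m" "t \<in> cell (K m) j" by (simp_all add: E_def split: if_splits)
    moreover from this(2) have "t \<in> H m" using LH by blast
    ultimately show "j < K m \<and> t \<in> cell (K m) j \<and> 1 / real (K m) < \<delta> m t"
      by (simp add: H_def)
  qed
qed

text \<open>If the tails were not uniformly small, Hahn--Banach minorants of disjoint blocks would be represented by points
  whose finite sums stay in \<open>\<Phi>\<close> without their norms becoming small.\<close>

lemma uniform_tails:
  fixes a :: "('a::banach \<Rightarrow>\<^sub>L real) \<Rightarrow> nat \<Rightarrow> real"
  assumes \<Phi>: "\<Phi> \<in> cwk" and sub: "\<And>n. sublinear (\<lambda>\<phi>. a \<phi> n)" and a0: "\<And>\<phi> n. 0 \<le> a \<phi> n"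
    and sums: "\<And>\<phi>. (\<lambda>n. a \<phi> n) sums supp \<Phi> \<phi>" and e: "0 < e"
  obtains N where "\<And>\<phi> n. norm \<phi> \<le> 1 \<Longrightarrow> (\<Sum>k\<in>{N..<n}. a \<phi> k) \<le> e"
proof (rule ccontr)
  assume neg: "\<not> thesis"
  have "\<exists>\<phi> n. norm \<phi> \<le> 1 \<and> e < (\<Sum>k\<in>{N..<n}. a \<phi> k)" for N
  proof (rule ccontr)
    assume "\<not> ?thesis"
    then have "(\<Sum>k\<in>{N..<n}. a \<phi> k) \<le> e" if "norm \<phi> \<le> 1" for \<phi> n
      using that by (meson not_le)
    from that[OF this] neg show False by simp
  qed
  then obtain F g where F: "\<And>N. norm (F N) \<le> 1" "\<And>N. e < (\<Sum>k\<in>{N..<g N}. a (F N) k)" by metis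
  \<comment> \<open>Each bad block starts where the previous one ends, which makes the blocks
    disjoint.\<close>
  define h where "h = rec_nat 0 (\<lambda>_. g)"
  have h0: "h 0 = 0" and hS: "h (Suc k) = g (h k)" for k by (simp_all add: h_def)
  have h_le: "h k \<le> h (Suc k)" for k
  proof (rule ccontr)
    assume "\<not> h k \<le> h (Suc k)"
    then have "{h k..<g (h k)} = {}" by (simp add: hS)
    then show False using F(2)[of "h k"] e by simp
  qed
  define Q where "Q k = {h k..<h (Suc k)}" for k
  have Q_disj: "Q i \<inter> Q j = {}" if "i \<noteq> j" for i j
  proof -
    have mono: "mono h" using h_le by (rule mono_iff_le_Suc[THEN iffD2, rule_format])
    have "Q i \<inter> Q j = {}" if "i < j" for i j
    proof -
      have "h (Suc i) \<le> h j" using that by (intro monoD[OF mono]) simp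
      then show ?thesis by (auto simp: Q_def)
    qed
    then show ?thesis using that by (metis Int_commute nat_neq_iff)
  qed
  define p where "p k \<phi> = (\<Sum>i\<in>Q k. a \<phi> i)" for k \<phi>
  have p_sub: "sublinear (p k)" for k
  proof (rule sublinearI)
    show "p k (\<phi> + \<psi>) \<le> p k \<phi> + p k \<psi>" for \<phi> \<psi>
      unfolding p_def sum.distrib[symmetric] by (intro sum_mono sublinear_add[OF sub])
    show "p k 0 = 0" unfolding p_def by (simp add: sublinear_zero[OF sub])
    show "p k (c *\<^sub>R \<phi>) \<le> c * p k \<phi>" if "0 < c" for c \<phi>
      unfolding p_def sum_distrib_left using that by (intro sum_mono) (simp add: sublinear_scale[OF sub])
  qed
  have p_sum: "(\<Sum>k\<in>S. p k \<phi>) \<le> supp \<Phi> \<phi>" if "finite S" for S \<phi>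
  proof -
    have "(\<Sum>k\<in>S. p k \<phi>) = (\<Sum>i\<in>(\<Union>k\<in>S. Q k). a \<phi> i)"
      unfolding p_def using that Q_disj by (intro sum.UNION_disjoint[symmetric]) (auto simp: Q_def)
    also have "\<dots> \<le> (\<Sum>i. a \<phi> i)"
      using that sums a0 by (intro sum_le_suminf) (auto simp: sums_iff Q_def)
    also have "\<dots> = supp \<Phi> \<phi>" using sums by (simp add: sums_iff)
    finally show ?thesis .
  qed
  \<comment> \<open>The minorant touches the block functional at the very \<open>F (h k)\<close>
    where the block exceeds \<open>e\<close>; this keeps the norm of the representing point above
    \<open>e\<close>.\<close>
  have "\<exists>\<xi>. linear \<xi> \<and> (\<forall>\<phi>. \<xi> \<phi> \<le> p k \<phi>) \<and> p k (F (h k)) \<le> \<xi> (F (h k))" for k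
    using Mazur_Orlicz[OF p_sub[of k], of "{F (h k)}" "p k (F (h k))"] by (metis convex_singleton order_refl singletonD singletonI)
  then obtain \<xi> where \<xi>: "\<And>k. linear (\<xi> k)" "\<And>k \<phi>. \<xi> k \<phi> \<le> p k \<phi>"
      "\<And>k. p k (F (h k)) \<le> \<xi> k (F (h k))" by metis
  \<comment> \<open>Disjoint blocks of non-negative terms sum to at most
    \<open>supp \<Phi> \<phi>\<close>, so finite sums of the minorants are represented inside
    \<open>\<Phi>\<close>.\<close>
  have repr: "\<exists>x\<in>\<Phi>. \<forall>\<phi>. (\<Sum>k\<in>S. \<xi> k \<phi>) = blinfun_apply \<phi> x" if S: "finite S" for S
  proof -
    have lin: "linear (\<lambda>\<phi>. \<Sum>k\<in>S. \<xi> k \<phi>)"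
      using \<xi>(1) by (intro linear_compose_sum ballI)
    have le: "(\<Sum>k\<in>S. \<xi> k \<phi>) \<le> supp \<Phi> \<phi>" for \<phi>
      using sum_mono[of S "\<lambda>k. \<xi> k \<phi>" "\<lambda>k. p k \<phi>"] \<xi>(2) p_sum[OF S, of \<phi>] by (meson order_trans)
    obtain x where "x \<in> \<Phi>" "\<And>\<phi>. (\<Sum>k\<in>S. \<xi> k \<phi>) = blinfun_apply \<phi> x"
      by (rule cwk_represents[OF \<Phi> lin le]) blast
    then show ?thesis by blast
  qed
  have "\<forall>k. \<exists>x. \<forall>\<phi>. \<xi> k \<phi> = blinfun_apply \<phi> x"
  proof
    fix k
    show "\<exists>x. \<forall>\<phi>. \<xi> k \<phi> = blinfun_apply \<phi> x" using repr[of "{k}"] by auto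
  qed
  then obtain x where x: "\<And>k \<phi>. \<xi> k \<phi> = blinfun_apply \<phi> (x k)" by metis
  have sums_in: "(\<Sum>k\<in>S. x k) \<in> \<Phi>" if S: "finite S" for S
  proof -
    obtain y where y: "y \<in> \<Phi>" "\<forall>\<phi>. (\<Sum>k\<in>S. \<xi> k \<phi>) = blinfun_apply \<phi> y" using repr[OF S] by blast
    have "(\<Sum>k\<in>S. x k) = y"
      by (rule blinfun_separates) (use y(2) in \<open>simp add: x blinfun.sum_right\<close>)
    then show ?thesis using y(1) by simp
  qed
  obtain k where k: "norm (x k) \<le> e" by (rule cwk_finite_sums_small_term[OF \<Phi> sums_in e])
  have "e < p k (F (h k))" using F(2)[of "h k"] by (simp add: p_def Q_def hS)
  also have "\<dots> \<le> F (h k) (x k)" using \<xi>(3)[of k] by (simp add: x)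
  also have "\<dots> \<le> 1 * norm (x k)" by (rule blinfun_le_norm[OF F(1)])
  finally show False using k by simp
qed

text \<open>Partial sums are represented, and the tail bound, made homogeneous in the functional,
  makes the total their uniform limit. So \<open>represented_limit\<close> applies, and no limit of
  sets has to be taken.\<close>

lemma cwk_of_uniformly_convergent_series:
  fixes f :: "('a::banach \<Rightarrow>\<^sub>L real) \<Rightarrow> nat \<Rightarrow> real"
  assumes rep: "\<And>n. represented (\<lambda>\<phi>. f \<phi> n)" and f0: "\<And>\<phi> n. 0 \<le> f \<phi> n"
    and tail: "\<And>e. 0 < e \<Longrightarrow> \<exists>N. \<forall>\<phi> n. norm \<phi> \<le> 1 \<longrightarrow> (\<Sum>k\<in>{N..<n}. f \<phi> k) \<le> e"
  obtains S where "S \<in> cwk" "\<And>\<phi>. (\<lambda>n. f \<phi> n) sums supp S \<phi>"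
proof -
  have sub: "sublinear (\<lambda>\<phi>. f \<phi> n)" for n using rep[of n] by (simp add: represented_def)
  have tail': "\<exists>N. \<forall>\<phi> n. (\<Sum>k\<in>{N..<n}. f \<phi> k) \<le> e * norm \<phi>" if e: "0 < e" for e
  proof -
    obtain N where N: "\<And>\<phi> n. norm \<phi> \<le> 1 \<Longrightarrow> (\<Sum>k\<in>{N..<n}. f \<phi> k) \<le> e" using tail[OF e] by blast
    have "(\<Sum>k\<in>{N..<n}. f \<phi> k) \<le> e * norm \<phi>" for \<phi> n
    proof (cases "\<phi> = 0")
      case True
      then show ?thesis by (simp add: sublinear_zero[OF sub])
    next
      case False
      have "f \<phi> k = norm \<phi> * f ((1 / norm \<phi>) *\<^sub>R \<phi>) k" for k
        using sublinear_scale[OF sub, of "1 / norm \<phi>" \<phi> k] False by simp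
      then have "(\<Sum>k\<in>{N..<n}. f \<phi> k) = norm \<phi> * (\<Sum>k\<in>{N..<n}. f ((1 / norm \<phi>) *\<^sub>R \<phi>) k)"
        by (metis (no_types, lifting) sum.cong sum_distrib_left)
      also have "\<dots> \<le> norm \<phi> * e" using False by (intro mult_left_mono N) auto
      finally show ?thesis by (simp add: mult.commute)
    qed
    then show ?thesis by blast
  qed
  have summable: "summable (\<lambda>n. f \<phi> n)" for \<phi>
  proof -
    obtain N where N: "\<And>\<phi> n. (\<Sum>k\<in>{N..<n}. f \<phi> k) \<le> 1 * norm \<phi>" using tail'[of 1] by auto
    have "(\<Sum>k<n. f \<phi> k) \<le> (\<Sum>k<N. f \<phi> k) + 1 * norm \<phi>" for n
    proof -
      have "(\<Sum>k<n. f \<phi> k) \<le> (\<Sum>k\<in>{..<N} \<union> {N..<n}. f \<phi> k)" using f0 by (intro sum_mono2) auto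
      also have "\<dots> = (\<Sum>k<N. f \<phi> k) + (\<Sum>k\<in>{N..<n}. f \<phi> k)" by (intro sum.union_disjoint) auto
      finally show ?thesis using N[where \<phi> = \<phi> and n = n] by simp
    qed
    then show ?thesis using f0 by (rule summableI_nonneg_bounded[rotated])
  qed
  define p where "p \<phi> = (\<Sum>n. f \<phi> n)" for \<phi>
  have p_sub: "sublinear p"
  proof (rule sublinearI)
    show "p (\<phi> + \<psi>) \<le> p \<phi> + p \<psi>" for \<phi> \<psi>
      unfolding p_def suminf_add[OF summable summable]
      by (intro suminf_le summable summable_add sublinear_add[OF sub])
    have "f 0 = (\<lambda>_. 0)" by (rule ext) (rule sublinear_zero[OF sub])
    then show "p 0 = 0" unfolding p_def by simp
    show "p (c *\<^sub>R \<phi>) \<le> c * p \<phi>" if "0 < c" for c \<phi>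
    proof -
      have "f (c *\<^sub>R \<phi>) = (\<lambda>n. c * f \<phi> n)"
        by (rule ext, rule sublinear_scale[OF sub]) (use that in simp)
      then show ?thesis unfolding p_def by (simp add: suminf_mult[OF summable])
    qed
  qed
  have "represented p"
  proof (rule represented_limit[OF p_sub])
    fix e :: real assume "0 < e"
    then obtain N where N: "\<And>\<phi> n. (\<Sum>k\<in>{N..<n}. f \<phi> k) \<le> e * norm \<phi>" using tail' by blast
    have "p \<phi> \<le> (\<Sum>k<N. f \<phi> k) + e * norm \<phi>" for \<phi>
      unfolding p_def
    proof (rule suminf_le_const[OF summable])
      fix n
      have "(\<Sum>k<n. f \<phi> k) \<le> (\<Sum>k\<in>{..<N} \<union> {N..<n}. f \<phi> k)" using f0 by (intro sum_mono2) auto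
      also have "\<dots> = (\<Sum>k<N. f \<phi> k) + (\<Sum>k\<in>{N..<n}. f \<phi> k)" by (intro sum.union_disjoint) auto
      finally show "(\<Sum>k<n. f \<phi> k) \<le> (\<Sum>k<N. f \<phi> k) + e * norm \<phi>" using N[where \<phi> = \<phi> and n = n] by simp
    qed
    moreover have "represented (\<lambda>\<phi>. \<Sum>k<N. f \<phi> k)" by (intro represented_sum rep) simp
    ultimately show "\<exists>q. represented q \<and> (\<forall>\<phi>. p \<phi> \<le> q \<phi> + e * norm \<phi>)" by blast
  qed
  then obtain S where S: "S \<in> cwk" "\<And>\<phi>. supp S \<phi> = p \<phi>" by (rule represented_cwk) blast
  show ?thesis
  proof (rule that[OF S(1)])
    show "(\<lambda>n. f \<phi> n) sums supp S \<phi>" for \<phi>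
      unfolding S(2) p_def by (rule summable_sums[OF summable])
  qed
qed

lemma set_sums_of_uniform_tails:
  fixes B :: "nat \<Rightarrow> 'a::banach set"
  assumes B: "\<And>n. B n \<in> bounded_convex" and rep: "\<And>n. represented (supp (B n))"
    and nonneg: "\<And>\<phi> n. 0 \<le> supp (B n) \<phi>"
    and tail: "\<And>e. 0 < e \<Longrightarrow> \<exists>N. \<forall>\<phi> n. norm \<phi> \<le> 1 \<longrightarrow> (\<Sum>k\<in>{N..<n}. supp (B k) \<phi>) \<le> e"
  obtains S where "set_sums B S" "\<forall>\<phi>. (\<lambda>n. supp (B n) \<phi>) sums supp S \<phi>"
proof -
  obtain S where S: "S \<in> cwk" "\<And>\<phi>. (\<lambda>n. supp (B n) \<phi>) sums supp S \<phi>"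
    by (rule cwk_of_uniformly_convergent_series[of "\<lambda>\<phi> n. supp (B n) \<phi>", OF rep nonneg tail]) blast+
  have "set_sums B S"
  proof (rule set_sumsI[OF B S(1)])
    fix e :: real assume "0 < e"
    then obtain N where N: "\<And>\<phi> n. norm \<phi> \<le> 1 \<Longrightarrow> (\<Sum>k\<in>{N..<n}. supp (B k) \<phi>) \<le> e" using tail by blast
    have "\<bar>(\<Sum>k<n. supp (B k) \<phi>) - supp S \<phi>\<bar> \<le> e" if n: "N \<le> n" and \<phi>: "norm \<phi> \<le> 1" for n \<phi>
    proof -
      have sm: "summable (\<lambda>n. supp (B n) \<phi>)" and eq: "supp S \<phi> = (\<Sum>n. supp (B n) \<phi>)"
        using S(2)[of \<phi>] by (simp_all add: sums_iff)
      have "(\<Sum>k<m. supp (B k) \<phi>) \<le> (\<Sum>k<n. supp (B k) \<phi>) + e" for m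
      proof -
        have "(\<Sum>k<m. supp (B k) \<phi>) \<le> (\<Sum>k\<in>{..<n} \<union> {n..<m}. supp (B k) \<phi>)"
          using nonneg by (intro sum_mono2) auto
        also have "\<dots> = (\<Sum>k<n. supp (B k) \<phi>) + (\<Sum>k\<in>{n..<m}. supp (B k) \<phi>)"
          by (intro sum.union_disjoint) auto
        also have "(\<Sum>k\<in>{n..<m}. supp (B k) \<phi>) \<le> (\<Sum>k\<in>{N..<m}. supp (B k) \<phi>)"
          using nonneg n by (intro sum_mono2) auto
        finally show ?thesis using N[OF \<phi>, of m] by linarith
      qed
      then have "supp S \<phi> \<le> (\<Sum>k<n. supp (B k) \<phi>) + e"
        unfolding eq by (rule suminf_le_const[OF sm])
      moreover have "(\<Sum>k<n. supp (B k) \<phi>) \<le> supp S \<phi>"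
        unfolding eq using nonneg by (intro sum_le_suminf[OF sm]) auto
      ultimately show ?thesis by (simp add: abs_le_iff)
    qed
    then show "\<exists>N. \<forall>n\<ge>N. \<forall>\<phi>. norm \<phi> \<le> 1 \<longrightarrow> \<bar>(\<Sum>k<n. supp (B k) \<phi>) - supp S \<phi>\<bar> \<le> e" by blast
  qed
  then show ?thesis using S(2) by (intro that[of S]) blast+
qed

section \<open>Integrals of support functions over the pieces of a partition\<close>

lemma sum_half_powers_ivl: "(\<Sum>m\<in>{M..<N}. (1/2::real) ^ Suc m) \<le> (1/2) ^ M"
proof (cases "M \<le> N")
  case True
  then have "(\<Sum>m\<in>{M..<N}. (1/2::real) ^ Suc m) = (1/2) ^ M - (1/2) ^ N"
    by (induction N rule: dec_induct) simp_all
  then show ?thesis by simp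
qed simp

lemma integral_near_tag_value:
  fixes f :: "real \<Rightarrow> real"
  assumes f: "set_integrable lebesgue A f" and A: "A \<in> lmeasurable"
    and osc: "\<And>x. x \<in> A \<Longrightarrow> \<bar>f t - f x\<bar> \<le> w"
  shows "\<bar>measure lebesgue A * f t - set_lebesgue_integral lebesgue A f\<bar> \<le> measure lebesgue A * w"
proof -
  have fin: "A \<in> sets lebesgue" "emeasure lebesgue A \<noteq> \<infinity>"
    using A fmeasurableD2[OF A] by auto
  have const: "set_integrable lebesgue A (\<lambda>_. c)" "set_lebesgue_integral lebesgue A (\<lambda>_. c) = measure lebesgue A * c"
    for c :: real
    using fin by (auto simp: set_integral_const set_integrable_def integrable_real_indicator top.not_eq_extremum less_top
        intro!: integrable_mult_left)
  have "set_lebesgue_integral lebesgue A (\<lambda>_. f t - w) \<le> set_lebesgue_integral lebesgue A f"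
    using osc by (intro set_integral_mono const f) (force simp: abs_le_iff)
  moreover have "set_lebesgue_integral lebesgue A f \<le> set_lebesgue_integral lebesgue A (\<lambda>_. f t + w)"
    using osc by (intro set_integral_mono const f) (force simp: abs_le_iff)
  ultimately show ?thesis by (simp add: const abs_le_iff algebra_simps)
qed

lemma set_integral_partition_sums:
  fixes f :: "real \<Rightarrow> real"
  assumes A: "countable_partition A" and f: "(f has_integral y) {0..1}" "f absolutely_integrable_on {0..1}"
  shows "(\<lambda>n. set_lebesgue_integral lebesgue (A n) f) sums y"
proof -
  have meas: "A n \<in> sets lebesgue" for n using A by (simp add: countable_partition_def)
  have int: "set_integrable lebesgue (A n) f" for n
    by (rule set_integrable_subset[OF f(2) meas countable_partition_subset[OF A]])
  have disj: "disjoint_family_on A {..<n}" for n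
    using A by (auto simp: countable_partition_def disjoint_family_on_def)
  have part: "set_lebesgue_integral lebesgue (\<Union>k<n. A k) f = (\<Sum>k<n. set_lebesgue_integral lebesgue (A k) f)" for n
    by (rule set_integral_finite_Union[OF _ disj int meas]) simp
  have un: "(\<Union>n. \<Union>k<n. A k) = {0..1}"
    using UN_UN_finite_eq[of A] A by (simp add: countable_partition_def atLeast0LessThan)
  have "(\<lambda>n. set_lebesgue_integral lebesgue (\<Union>k<n. A k) f) \<longlonglongrightarrow> set_lebesgue_integral lebesgue (\<Union>n. \<Union>k<n. A k) f"
  proof (rule set_integral_cont_up)
    show "(\<Union>k<n. A k) \<in> sets lebesgue" for n using meas by (intro sets.finite_UN) auto
    show "incseq (\<lambda>n. \<Union>k<n. A k)" by (intro incseq_SucI) (auto simp: lessThan_Suc)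
    show "set_integrable lebesgue (\<Union>n. \<Union>k<n. A k) f" unfolding un by (rule f(2))
  qed
  then show ?thesis
    using set_lebesgue_integral_eq_integral(2)[OF f(2)] f(1)
    unfolding part un sums_def by (simp add: integral_unique)
qed

text \<open>The Birkhoff terms are compared with the integrals of the support functions over the
  pieces. These integrals sum to \<open>supp \<Phi> \<phi>\<close> with uniformly small tails, and
  the deviation estimate \<open>err\<close> transfers both facts to the Birkhoff series.\<close>

theorem H_imp_birkhoff_integrable:
  fixes G :: "real \<Rightarrow> 'a::banach set"
  assumes G: "\<And>t. t \<in> {0..1} \<Longrightarrow> G t \<in> cwk" and G0: "\<And>t. t \<in> {0..1} \<Longrightarrow> 0 \<in> G t"
    and "H_integrable G"
  shows "birkhoff_integrable G"
proof -
  obtain \<Phi> where \<Phi>: "\<Phi> \<in> cwk" and H: "has_H_integral G \<Phi>"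
    using assms(3) by (auto simp: H_integrable_def)
  have Gb: "G t \<in> bounded_convex" if "t \<in> {0..1}" for t using G[OF that] by (rule cwk_bounded_convex)
  have \<Phi>b: "\<Phi> \<in> bounded_convex" by (rule cwk_bounded_convex[OF \<Phi>])
  define s where "s \<phi> t = supp (G t) \<phi>" for \<phi> t
  have s_sub: "sublinear (\<lambda>\<phi>. s \<phi> t)" if "t \<in> {0..1}" for t
    using sublinear_supp[of "G t"] Gb[OF that] by (simp add: s_def bounded_convex_def)
  have s_nonneg: "0 \<le> s \<phi> t" if "t \<in> {0..1}" for t \<phi>
    unfolding s_def using Gb[OF that] G0[OF that] by (intro supp_nonneg) (auto simp: bounded_convex_def)
  have gauges: "\<exists>\<delta>. measurable_gauge \<delta> \<and> (\<forall>p \<phi>. perron \<delta> p \<longrightarrow> norm \<phi> \<le> 1 \<longrightarrow>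
      \<bar>supp \<Phi> \<phi> - (\<Sum>(t, I)\<in>p. measure lborel I * s \<phi> t)\<bar> \<le> \<epsilon>)" if "0 < \<epsilon>" for \<epsilon>
    using has_H_integral_iff_supp[OF Gb \<Phi>b, THEN iffD1, rule_format, OF _ H that] unfolding s_def by blast
  have int1: "(s \<phi> has_integral supp \<Phi> \<phi>) {0..1}" if \<phi>: "norm \<phi> \<le> 1" for \<phi>
  proof (rule has_integral_perron)
    fix \<epsilon> :: real assume "0 < \<epsilon>"
    then show "\<exists>\<delta>. measurable_gauge \<delta> \<and> (\<forall>p. perron \<delta> p \<longrightarrow>
        \<bar>supp \<Phi> \<phi> - (\<Sum>(t, I)\<in>p. measure lborel I * s \<phi> t)\<bar> \<le> \<epsilon>)"
      using gauges[of \<epsilon>] \<phi> by blast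
  qed
  have \<Phi>_sub: "sublinear (supp \<Phi>)" using \<Phi>b by (intro sublinear_supp) (auto simp: bounded_convex_def)
  \<comment> \<open>The gauges are uniform on the dual ball only; homogeneity extends integrability
    to all functionals, as sublinearity of the integrals over the pieces requires.\<close>
  have int: "(s \<phi> has_integral supp \<Phi> \<phi>) {0..1}" for \<phi>
  proof (cases "\<phi> = 0")
    case True
    then show ?thesis by (simp add: int1)
  next
    case False
    define \<psi> where "\<psi> = (1 / norm \<phi>) *\<^sub>R \<phi>"
    have \<phi>: "\<phi> = norm \<phi> *\<^sub>R \<psi>" using False by (simp add: \<psi>_def)
    have "((\<lambda>t. norm \<phi> * s \<psi> t) has_integral norm \<phi> * supp \<Phi> \<psi>) {0..1}"
      by (intro has_integral_mult_right int1) (use False in \<open>simp add: \<psi>_def\<close>)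
    moreover have "norm \<phi> * supp \<Phi> \<psi> = supp \<Phi> \<phi>"
      by (rule sublinear_scale[OF \<Phi>_sub norm_ge_zero[of \<phi>], of \<psi>, folded \<phi>, symmetric])
    moreover have "norm \<phi> * s \<psi> t = s \<phi> t" if "t \<in> {0..1}" for t
      by (rule sublinear_scale[OF s_sub[OF that] norm_ge_zero[of \<phi>], of \<psi>, folded \<phi>, symmetric])
    ultimately show ?thesis by (metis (no_types, lifting) has_integral_cong)
  qed
  have abs_int: "s \<phi> absolutely_integrable_on {0..1}" for \<phi>
    using int[of \<phi>] s_nonneg by (intro nonnegative_absolutely_integrable_1) (auto simp: integrable_on_def)
  have main: "\<exists>P. countable_partition P \<and> (\<forall>A t. countable_partition A \<longrightarrow> finer A P \<longrightarrow> tags_of A t \<longrightarrow>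
      (\<exists>S. set_sums (birkhoff_term G A t) S \<and> hausdorff_distance \<Phi> S \<le> \<epsilon>))" if \<epsilon>: "0 < \<epsilon>" for \<epsilon>
  proof -
    \<comment> \<open>\<open>oscillation_on_cells\<close> doubles its bound, so level
      \<open>m\<close> contributes \<open>\<epsilon> * (1/2) ^ Suc m\<close> and all levels together
      at most \<open>\<epsilon>\<close>.\<close>
    define \<epsilon>' where "\<epsilon>' m = \<epsilon> * (1/2) ^ Suc m / 2" for m
    have \<epsilon>': "0 < \<epsilon>' m" for m using \<epsilon> by (simp add: \<epsilon>'_def)
    \<comment> \<open>The half turns the non-strict bound into the strict one that Henstock's lemma
      asks for.\<close>
    have "\<forall>m. \<exists>\<delta>. measurable_gauge \<delta> \<and> (\<forall>p \<phi>. perron \<delta> p \<longrightarrow> norm \<phi> \<le> 1 \<longrightarrow>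
      \<bar>supp \<Phi> \<phi> - (\<Sum>(t, I)\<in>p. measure lborel I * s \<phi> t)\<bar> \<le> \<epsilon>' m / 2)"
      using \<epsilon>' by (intro allI gauges) simp
    from choice[OF this] obtain \<delta> where \<delta>: "\<forall>m. measurable_gauge (\<delta> m) \<and> (\<forall>p \<phi>. perron (\<delta> m) p \<longrightarrow> norm \<phi> \<le> 1 \<longrightarrow>
      \<bar>supp \<Phi> \<phi> - (\<Sum>(t, I)\<in>p. measure lborel I * s \<phi> t)\<bar> \<le> \<epsilon>' m / 2)" by (rule exE)
    have \<delta>_meas: "measurable_gauge (\<delta> m)" for m using \<delta> by blast
    have \<delta>_le: "\<bar>supp \<Phi> \<phi> - (\<Sum>(t, I)\<in>p. measure lborel I * s \<phi> t)\<bar> < \<epsilon>' m"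
      if "perron (\<delta> m) p" "norm \<phi> \<le> 1" for m p \<phi>
    proof -
      have "\<bar>supp \<Phi> \<phi> - (\<Sum>(t, I)\<in>p. measure lborel I * s \<phi> t)\<bar> \<le> \<epsilon>' m / 2" using \<delta> that by blast
      then show ?thesis using \<epsilon>'[of m] by linarith
    qed
    obtain K P where K: "\<And>m. 0 < K m" and P: "countable_partition P" "measure lebesgue (P 0) = 0" and
      PK: "\<And>m j t. t \<in> P (Suc (prod_encode (m, j))) \<Longrightarrow> j < K m \<and> t \<in> cell (K m) j \<and> 1 / real (K m) < \<delta> m t"
      by (rule gauge_partition[where \<delta> = \<delta>, OF \<delta>_meas]) blast
    have P_lm: "P i \<in> lmeasurable" for i by (rule countable_partition_lmeasurable[OF P(1)])
    have P_small: "measure lebesgue (P (Suc (prod_encode (m, j)))) \<le> 1 / real (K m)" for m j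
    proof -
      have "P (Suc (prod_encode (m, j))) \<subseteq> {real j / real (K m)..real (Suc j) / real (K m)}"
      proof
        fix t assume "t \<in> P (Suc (prod_encode (m, j)))"
        from PK[OF this] show "t \<in> {real j / real (K m)..real (Suc j) / real (K m)}" unfolding cell_def by auto
      qed
      then have "measure lebesgue (P (Suc (prod_encode (m, j)))) \<le> measure lebesgue {real j / real (K m)..real (Suc j) / real (K m)}"
        using P_lm by (intro measure_mono_fmeasurable) auto
      also have "\<dots> = 1 / real (K m)" using K[of m] by (simp add: diff_divide_distrib[symmetric] divide_right_mono)
      finally show ?thesis .
    qed
    \<comment> \<open>A crude bound for all oscillations on the levels below \<open>M\<close>, the
      same for all functionals. It is not small, but it will be multiplied by the measure of a
      tail.\<close>
    define C where "C M = (\<Sum>m<M. 2 * \<epsilon>' m * real (K m))" for M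
    have C0: "0 \<le> C M" for M unfolding C_def using \<epsilon>' by (intro sum_nonneg) (simp add: less_imp_le)
    have "\<exists>S. set_sums (birkhoff_term G A t) S \<and> hausdorff_distance \<Phi> S \<le> \<epsilon>"
      if A: "countable_partition A" "finer A P" and t: "tags_of A t" for A t
    proof -
      define \<mu> where "\<mu> n = measure lebesgue (A n)" for n
      define a where "a \<phi> n = set_lebesgue_integral lebesgue (A n) (s \<phi>)" for \<phi> n
      have \<mu>0: "0 \<le> \<mu> n" for n by (simp add: \<mu>_def)
      have A01: "A n \<subseteq> {0..1}" for n by (rule countable_partition_subset[OF A(1)])
      have A_lm: "A n \<in> lmeasurable" for n by (rule countable_partition_lmeasurable[OF A(1)])
      have A_int: "set_integrable lebesgue (A n) (s \<phi>)" for n \<phi>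
        using A_lm by (intro set_integrable_subset[OF abs_int _ A01]) auto
      have a_sums: "(\<lambda>n. a \<phi> n) sums supp \<Phi> \<phi>" for \<phi>
        unfolding a_def by (rule set_integral_partition_sums[OF A(1) int abs_int])
      have a0: "0 \<le> a \<phi> n" for \<phi> n
      proof -
        have "set_lebesgue_integral lebesgue (A n) (\<lambda>_. 0) \<le> a \<phi> n"
          unfolding a_def using A01[of n] s_nonneg by (intro set_integral_mono A_int) (auto simp: set_integrable_def subset_iff)
        then show ?thesis by simp
      qed
      have a_sub: "sublinear (\<lambda>\<phi>. a \<phi> n)" for n
      proof (rule sublinearI)
        show "a (\<phi> + \<psi>) n \<le> a \<phi> n + a \<psi> n" for \<phi> \<psi>
          unfolding a_def set_integral_add(2)[OF A_int A_int, symmetric]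
        proof (intro set_integral_mono A_int set_integral_add)
          fix x assume "x \<in> A n"
          then have "x \<in> {0..1}" using A01 by blast
          then show "s (\<phi> + \<psi>) x \<le> s \<phi> x + s \<psi> x" by (rule sublinear_add[OF s_sub])
        qed
        have "a 0 n = set_lebesgue_integral lebesgue (A n) (\<lambda>_. 0)"
          unfolding a_def
        proof (intro set_lebesgue_integral_cong allI impI)
          fix x assume "x \<in> A n"
          then have "x \<in> {0..1}" using A01 by blast
          then show "s 0 x = 0" by (rule sublinear_zero[OF s_sub])
        qed (use A_lm in auto)
        then show "a 0 n = 0" by simp
        show "a (c *\<^sub>R \<phi>) n \<le> c * a \<phi> n" if c: "0 < c" for c \<phi>
        proof -
          have "a (c *\<^sub>R \<phi>) n = set_lebesgue_integral lebesgue (A n) (\<lambda>x. c * s \<phi> x)"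
            unfolding a_def
          proof (intro set_lebesgue_integral_cong allI impI)
            fix x assume "x \<in> A n"
            then have "x \<in> {0..1}" using A01 by blast
            then show "s (c *\<^sub>R \<phi>) x = c * s \<phi> x" using c by (intro sublinear_scale[OF s_sub]) auto
          qed (use A_lm in auto)
          then show ?thesis by (simp add: a_def)
        qed
      qed
      define f where "f \<phi> n = \<mu> n * s \<phi> (t n)" for \<phi> n
      have t01: "t n \<in> {0..1}" if "A n \<noteq> {}" for n
        using t that A01[of n] unfolding tags_of_def by blast
      have f0: "0 \<le> f \<phi> n" for \<phi> n
        using s_nonneg[OF t01, of n \<phi>] \<mu>0[of n] by (cases "A n = {}") (auto simp: f_def \<mu>_def)
      \<comment> \<open>Levels below \<open>M\<close> are estimated by \<open>C M\<close> times the
        measure, the others by their summable oscillations. Two values of \<open>M\<close> are used: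
        with \<open>M = 0\<close>, where \<open>C 0 = 0\<close>, the total deviation is at most
        \<open>\<epsilon>\<close>; a large \<open>M\<close> makes the tails small.\<close>
      have err: "(\<Sum>n\<in>F. \<bar>f \<phi> n - a \<phi> n\<bar>) \<le> C M * (\<Sum>n\<in>F. \<mu> n) + \<epsilon> * (1/2) ^ M"
        if \<phi>: "norm \<phi> \<le> 1" and F: "finite F" for \<phi> M F
      proof -
        have "\<forall>m. \<exists>\<omega>. (\<forall>j. 0 \<le> \<omega> j) \<and> (\<forall>j x y. j < K m \<longrightarrow> x \<in> P (Suc (prod_encode (m, j))) \<longrightarrow>
            y \<in> P (Suc (prod_encode (m, j))) \<longrightarrow> \<bar>s \<phi> x - s \<phi> y\<bar> \<le> \<omega> j) \<and> (\<Sum>j<K m. \<omega> j / real (K m)) \<le> 2 * \<epsilon>' m"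
        proof
          fix m
          obtain \<omega> where "\<And>j. 0 \<le> \<omega> j" "\<And>j x y. j < K m \<Longrightarrow> x \<in> P (Suc (prod_encode (m, j))) \<Longrightarrow>
            y \<in> P (Suc (prod_encode (m, j))) \<Longrightarrow> \<bar>s \<phi> x - s \<phi> y\<bar> \<le> \<omega> j" "(\<Sum>j<K m. \<omega> j / real (K m)) \<le> 2 * \<epsilon>' m"
          proof (rule oscillation_on_cells[OF int \<delta>_meas \<epsilon>' _ K])
            show "\<bar>supp \<Phi> \<phi> - (\<Sum>(t, I)\<in>p. measure lborel I * s \<phi> t)\<bar> < \<epsilon>' m" if "perron (\<delta> m) p" for p
              by (rule \<delta>_le[OF that \<phi>])
            show "x \<in> cell (K m) j \<and> 1 / real (K m) < \<delta> m x" if "x \<in> P (Suc (prod_encode (m, j)))" for j x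
              using PK[OF that] by blast
          qed blast
          then show "\<exists>\<omega>. (\<forall>j. 0 \<le> \<omega> j) \<and> (\<forall>j x y. j < K m \<longrightarrow> x \<in> P (Suc (prod_encode (m, j))) \<longrightarrow>
            y \<in> P (Suc (prod_encode (m, j))) \<longrightarrow> \<bar>s \<phi> x - s \<phi> y\<bar> \<le> \<omega> j) \<and> (\<Sum>j<K m. \<omega> j / real (K m)) \<le> 2 * \<epsilon>' m"
            by blast
        qed
        from choice[OF this] obtain \<omega> where \<omega>_all: "\<forall>m. (\<forall>j. 0 \<le> \<omega> m j) \<and> (\<forall>j x y. j < K m \<longrightarrow>
            x \<in> P (Suc (prod_encode (m, j))) \<longrightarrow> y \<in> P (Suc (prod_encode (m, j))) \<longrightarrow> \<bar>s \<phi> x - s \<phi> y\<bar> \<le> \<omega> m j) \<and>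
            (\<Sum>j<K m. \<omega> m j / real (K m)) \<le> 2 * \<epsilon>' m" by (rule exE)
        have \<omega>0: "0 \<le> \<omega> m j" and \<omega>_sum: "(\<Sum>j<K m. \<omega> m j / real (K m)) \<le> 2 * \<epsilon>' m" for m j
          using \<omega>_all by blast+
        have \<omega>_osc: "\<bar>s \<phi> x - s \<phi> y\<bar> \<le> \<omega> m j" if "j < K m" "x \<in> P (Suc (prod_encode (m, j)))"
          "y \<in> P (Suc (prod_encode (m, j)))" for m j x y
          using \<omega>_all that by blast
        have \<omega>_le: "\<omega> m j \<le> 2 * \<epsilon>' m * real (K m)" if "j < K m" for m j
        proof -
          have "\<omega> m j / real (K m) \<le> (\<Sum>j<K m. \<omega> m j / real (K m))"
            using that \<omega>0 by (intro member_le_sum) auto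
          then have "\<omega> m j / real (K m) \<le> 2 * \<epsilon>' m" using \<omega>_sum[of m] by linarith
          then show ?thesis using K[of m] by (simp add: pos_divide_le_eq)
        qed
        have "\<forall>n. \<exists>i. A n \<subseteq> P i" using A(2) by (simp add: finer_def)
        from choice[OF this] obtain c where c: "\<forall>n. A n \<subseteq> P (c n)" by (rule exE)
        \<comment> \<open>The oscillation bound of a piece from level \<open>M\<close> on. Lower
          levels get \<open>0\<close>, since \<open>C M\<close> takes care of them, and so does the
          null piece.\<close>
        define W where "W i = (case i of 0 \<Rightarrow> 0 | Suc k \<Rightarrow>
            (if M \<le> fst (prod_decode k) \<and> snd (prod_decode k) < K (fst (prod_decode k)) then \<omega> (fst (prod_decode k)) (snd (prod_decode k)) else 0))" for i
        have W0: "0 \<le> W i" for i using \<omega>0 by (simp add: W_def split: nat.split)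
        have term_le: "\<bar>f \<phi> n - a \<phi> n\<bar> \<le> \<mu> n * C M + \<mu> n * W (c n)" for n
        proof (cases "A n = {}")
          case True
          then show ?thesis by (simp add: f_def a_def \<mu>_def set_lebesgue_integral_def)
        next
          case False
          have tn: "t n \<in> P (c n)" using t False c unfolding tags_of_def by blast
          show ?thesis
          proof (cases "c n")
            case 0
            \<comment> \<open>Inside the null piece the Birkhoff term and the integral both vanish,
              whatever the values of \<open>s \<phi>\<close>.\<close>
            then have "\<mu> n \<le> measure lebesgue (P 0)"
              unfolding \<mu>_def using c A_lm P_lm by (intro measure_mono_fmeasurable) (auto simp flip: 0)
            then have \<mu>: "\<mu> n = 0" using P(2) \<mu>0[of n] by simp
            then have "A n \<in> null_sets lebesgue"
              using A_lm[of n] by (auto simp: \<mu>_def null_sets_def emeasure_eq_measure2)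
            then have "negligible (A n)" by (simp add: negligible_iff_null_sets)
            then have "integral (A n) (s \<phi>) = 0" by (intro integral_negligible) auto
            then have "a \<phi> n = 0" by (simp add: a_def set_lebesgue_integral_eq_integral(2)[OF A_int])
            then show ?thesis by (simp add: f_def \<mu>)
          next
            case (Suc k)
            obtain m j where k: "k = prod_encode (m, j)" by (metis prod_decode_inverse surj_pair)
            have j: "j < K m" using PK tn by (simp add: Suc k)
            have cell: "A n \<subseteq> P (Suc (prod_encode (m, j)))" using c Suc k by metis
            have "\<bar>\<mu> n * s \<phi> (t n) - a \<phi> n\<bar> \<le> \<mu> n * \<omega> m j"
              unfolding \<mu>_def a_def
            proof (rule integral_near_tag_value[OF A_int A_lm])
              fix x assume "x \<in> A n"
              then have "x \<in> P (Suc (prod_encode (m, j)))" using cell by blast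
              moreover have "t n \<in> P (Suc (prod_encode (m, j)))" using tn by (simp add: Suc k)
              ultimately show "\<bar>s \<phi> (t n) - s \<phi> x\<bar> \<le> \<omega> m j" using \<omega>_osc[OF j] by blast
            qed
            also have "\<dots> \<le> \<mu> n * (C M + W (c n))"
            proof (rule mult_left_mono[OF _ \<mu>0])
              show "\<omega> m j \<le> C M + W (c n)"
              proof (cases "M \<le> m")
                case True
                then show ?thesis using j C0[of M] by (simp add: Suc k W_def)
              next
                case False
                then have "2 * \<epsilon>' m * real (K m) \<le> C M"
                  unfolding C_def using \<epsilon>' by (intro member_le_sum[where f = "\<lambda>m. 2 * \<epsilon>' m * real (K m)"]) (auto simp: less_imp_le)
                then show ?thesis using \<omega>_le[OF j] W0[of "c n"] by linarith
              qed
            qed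
            finally show ?thesis by (simp add: f_def distrib_left)
          qed
        qed
        have part: "(\<Sum>n\<in>{n\<in>F. c n = i}. \<mu> n) \<le> measure lebesgue (P i)" for i
        proof -
          have "(\<Sum>n\<in>{n\<in>F. c n = i}. \<mu> n) = measure lebesgue (\<Union>n\<in>{n\<in>F. c n = i}. A n)"
            unfolding \<mu>_def
          proof (rule measure_finite_Union[symmetric])
            show "finite {n\<in>F. c n = i}" using F by simp
            show "A ` {n\<in>F. c n = i} \<subseteq> sets lebesgue" using A_lm by blast
            show "disjoint_family_on A {n\<in>F. c n = i}"
              using A(1) unfolding countable_partition_def disjoint_family_on_def by blast
            show "emeasure lebesgue (A n) \<noteq> \<infinity>" for n using fmeasurableD2[OF A_lm] by simp
          qed
          also have "\<dots> \<le> measure lebesgue (P i)"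
          proof (rule measure_mono_fmeasurable)
            show "(\<Union>n\<in>{n\<in>F. c n = i}. A n) \<subseteq> P i" using c by blast
            show "(\<Union>n\<in>{n\<in>F. c n = i}. A n) \<in> sets lebesgue" using F A_lm by (intro sets.finite_UN) auto
          qed (rule P_lm)
          finally show ?thesis .
        qed
        have "(\<Sum>n\<in>F. \<mu> n * W (c n)) = (\<Sum>i\<in>c ` F. \<Sum>n\<in>{n\<in>F. c n = i}. \<mu> n * W (c n))"
          by (rule sum.image_gen[OF F])
        also have "\<dots> = (\<Sum>i\<in>c ` F. W i * (\<Sum>n\<in>{n\<in>F. c n = i}. \<mu> n))"
          by (intro sum.cong refl) (simp add: sum_distrib_left mult.commute)
        also have "\<dots> \<le> (\<Sum>i\<in>c ` F. W i * measure lebesgue (P i))"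
          by (intro sum_mono mult_left_mono part W0)
        also have "\<dots> \<le> \<epsilon> * (1/2) ^ M"
        proof -
          \<comment> \<open>Piece \<open>Suc k\<close> has its level and cell encoded in
            \<open>k\<close>; at \<open>0\<close> truncated subtraction gives level
            \<open>0\<close>, which is harmless, as only an upper bound for finitely many levels is
            wanted.\<close>
          define lev where "lev i = fst (prod_decode (i - 1))" for i
          define M' where "M' = Suc (Max (insert 0 (lev ` c ` F)))"
          have M': "lev i < M'" if "i \<in> c ` F" for i
            unfolding M'_def less_Suc_eq_le using that F by (intro Max_ge) auto
          define D where "D = (SIGMA m:{M..<M'}. {..<K m})"
          define h where "h = (\<lambda>x. Suc (prod_encode x))"
          have fD: "finite D" by (simp add: D_def)
          have inj: "inj_on h D" by (auto simp: h_def inj_on_def)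
          have Wh: "W (h x) * measure lebesgue (P (h x)) \<le> \<omega> (fst x) (snd x) / real (K (fst x))" if "x \<in> D" for x
          proof -
            have "W (h x) = \<omega> (fst x) (snd x)" using that by (auto simp: D_def W_def h_def)
            moreover have "measure lebesgue (P (h x)) \<le> 1 / real (K (fst x))"
              using P_small[of "fst x" "snd x"] by (simp add: h_def)
            ultimately show ?thesis
              using mult_left_mono[of "measure lebesgue (P (h x))" "1 / real (K (fst x))" "\<omega> (fst x) (snd x)"] \<omega>0 by simp
          qed
          have zero: "W i = 0" if "i \<in> c ` F" "i \<notin> h ` D" for i
          proof (rule ccontr)
            assume W: "W i \<noteq> 0"
            then obtain k where k: "i = Suc k" by (cases i) (auto simp: W_def)
            then have "M \<le> fst (prod_decode k)" "snd (prod_decode k) < K (fst (prod_decode k))"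
              using W by (auto simp: W_def split: if_splits)
            moreover have "fst (prod_decode k) < M'" using M'[OF that(1)] by (simp add: lev_def k)
            ultimately have "prod_decode k \<in> D" unfolding D_def by (cases "prod_decode k") simp
            then have "i \<in> h ` D" by (intro image_eqI[of _ _ "prod_decode k"]) (simp_all add: h_def k)
            then show False using that(2) by blast
          qed
          have "(\<Sum>i\<in>c ` F. W i * measure lebesgue (P i)) = (\<Sum>i\<in>c ` F \<inter> h ` D. W i * measure lebesgue (P i))"
            using F zero by (intro sum.mono_neutral_right) auto
          also have "\<dots> \<le> (\<Sum>i\<in>h ` D. W i * measure lebesgue (P i))"
            using fD W0 by (intro sum_mono2) auto
          also have "\<dots> = (\<Sum>x\<in>D. W (h x) * measure lebesgue (P (h x)))"
            by (simp add: sum.reindex[OF inj])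
          also have "\<dots> \<le> (\<Sum>x\<in>D. \<omega> (fst x) (snd x) / real (K (fst x)))"
            by (intro sum_mono Wh)
          also have "\<dots> = (\<Sum>m\<in>{M..<M'}. \<Sum>j<K m. \<omega> m j / real (K m))"
            unfolding D_def by (subst sum.Sigma) (auto simp: split_beta)
          also have "\<dots> \<le> (\<Sum>m\<in>{M..<M'}. 2 * \<epsilon>' m)" by (intro sum_mono \<omega>_sum)
          also have "\<dots> = \<epsilon> * (\<Sum>m\<in>{M..<M'}. (1/2) ^ Suc m)"
            by (simp add: \<epsilon>'_def sum_distrib_left)
          also have "\<dots> \<le> \<epsilon> * (1/2) ^ M" using \<epsilon> by (intro mult_left_mono sum_half_powers_ivl) auto
          finally show ?thesis .
        qed
        finally have W_sum: "(\<Sum>n\<in>F. \<mu> n * W (c n)) \<le> \<epsilon> * (1/2) ^ M" .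
        have "(\<Sum>n\<in>F. \<bar>f \<phi> n - a \<phi> n\<bar>) \<le> (\<Sum>n\<in>F. \<mu> n * C M + \<mu> n * W (c n))"
          by (intro sum_mono term_le)
        also have "\<dots> = C M * (\<Sum>n\<in>F. \<mu> n) + (\<Sum>n\<in>F. \<mu> n * W (c n))"
          by (simp add: sum.distrib sum_distrib_left mult.commute)
        finally show ?thesis using W_sum by linarith
      qed
      have \<mu>_summable: "summable \<mu>"
      proof (rule summableI_nonneg_bounded[OF \<mu>0])
        fix n
        have "(\<Sum>k<n. \<mu> k) = measure lebesgue (\<Union>k<n. A k)"
          unfolding \<mu>_def
        proof (rule measure_finite_Union[symmetric])
          show "A ` {..<n} \<subseteq> sets lebesgue" using A_lm by blast
          show "disjoint_family_on A {..<n}"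
            using A(1) unfolding countable_partition_def disjoint_family_on_def by blast
          show "emeasure lebesgue (A k) \<noteq> \<infinity>" for k using fmeasurableD2[OF A_lm] by simp
        qed simp
        also have "\<dots> \<le> measure lebesgue {0..1::real}"
          using A01 A_lm by (intro measure_mono_fmeasurable sets.finite_UN) (auto intro!: UN_least)
        finally show "(\<Sum>k<n. \<mu> k) \<le> 1" by simp
      qed
      have tail: "\<exists>N. \<forall>\<phi> n. norm \<phi> \<le> 1 \<longrightarrow> (\<Sum>k\<in>{N..<n}. f \<phi> k) \<le> \<eta>" if \<eta>: "0 < \<eta>" for \<eta>
      proof -
        have "(\<lambda>M. \<epsilon> * (1/2) ^ M) \<longlonglongrightarrow> \<epsilon> * 0" by (intro tendsto_intros LIMSEQ_realpow_zero) auto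
        then have "eventually (\<lambda>M. \<epsilon> * (1/2) ^ M < \<eta> / 3) sequentially"
          using \<eta> by (intro order_tendstoD(2)[of _ "\<epsilon> * 0"]) auto
        then obtain M where M: "\<epsilon> * (1/2) ^ M < \<eta> / 3" unfolding eventually_sequentially by blast
        have \<eta>3: "0 < \<eta> / 3" using \<eta> by simp
        obtain N1 where N1: "\<And>\<phi> n. norm \<phi> \<le> 1 \<Longrightarrow> (\<Sum>k\<in>{N1..<n}. a \<phi> k) \<le> \<eta> / 3"
          by (rule uniform_tails[OF \<Phi> a_sub a0 a_sums \<eta>3]) blast
        \<comment> \<open>\<open>M\<close> is fixed before \<open>N2\<close>: now \<open>C M\<close>
          is a constant, and a tail of the convergent series of measures can be made small against
          it.\<close>
        have "0 < \<eta> / 3 / (C M + 1)" using \<eta> C0[of M] by (intro divide_pos_pos) auto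
        then obtain N2 where "\<And>n m. N2 \<le> m \<Longrightarrow> norm (\<Sum>k\<in>{m..<n}. \<mu> k) < \<eta> / 3 / (C M + 1)"
          using \<mu>_summable unfolding summable_Cauchy by blast
        then have N2: "C M * (\<Sum>k\<in>{m..<n}. \<mu> k) \<le> \<eta> / 3" if "N2 \<le> m" for n m
        proof -
          have le: "(\<Sum>k\<in>{m..<n}. \<mu> k) \<le> \<eta> / 3 / (C M + 1)"
            using \<open>\<And>n m. N2 \<le> m \<Longrightarrow> norm (\<Sum>k\<in>{m..<n}. \<mu> k) < \<eta> / 3 / (C M + 1)\<close>[OF that, of n]
            by (simp add: abs_less_iff less_imp_le)
          have "C M * (\<Sum>k\<in>{m..<n}. \<mu> k) \<le> (C M + 1) * (\<Sum>k\<in>{m..<n}. \<mu> k)"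
            using \<mu>0 by (intro mult_right_mono sum_nonneg) auto
          also have "\<dots> \<le> (C M + 1) * (\<eta> / 3 / (C M + 1))" using le C0[of M] by (intro mult_left_mono) auto
          also have "\<dots> = \<eta> / 3"
          proof -
            have "C M + 1 \<noteq> 0" using C0[of M] by linarith
            then show ?thesis by (metis nonzero_mult_div_cancel_left times_divide_eq_right)
          qed
          finally show ?thesis .
        qed
        define N where "N = max N1 N2"
        have "(\<Sum>k\<in>{N..<n}. f \<phi> k) \<le> \<eta>" if \<phi>: "norm \<phi> \<le> 1" for \<phi> n
        proof -
          have "(\<Sum>k\<in>{N..<n}. f \<phi> k) \<le> (\<Sum>k\<in>{N..<n}. a \<phi> k + \<bar>f \<phi> k - a \<phi> k\<bar>)"
            by (intro sum_mono) linarith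
          also have "\<dots> = (\<Sum>k\<in>{N..<n}. a \<phi> k) + (\<Sum>k\<in>{N..<n}. \<bar>f \<phi> k - a \<phi> k\<bar>)" by (rule sum.distrib)
          also have "(\<Sum>k\<in>{N..<n}. a \<phi> k) \<le> (\<Sum>k\<in>{N1..<n}. a \<phi> k)"
            using a0 by (intro sum_mono2) (auto simp: N_def)
          finally show ?thesis
            using N1[OF \<phi>, of n] err[OF \<phi>, of "{N..<n}" M] N2[of N n] M by (simp add: N_def)
        qed
        then show ?thesis by blast
      qed
      have bt: "birkhoff_term G A t n \<in> bounded_convex" for n
        by (rule birkhoff_term_supp(1)[OF A(1) t Gb])
      have bt_supp: "supp (birkhoff_term G A t n) = (\<lambda>\<phi>. f \<phi> n)" for n
        by (rule ext, unfold f_def \<mu>_def s_def, rule birkhoff_term_supp(2)[OF A(1) t Gb])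
      have rep: "represented (supp (birkhoff_term G A t n))" for n
      proof (cases "A n = {}")
        case True
        then show ?thesis unfolding bt_supp f_def \<mu>_def by (simp add: represented_zero)
      next
        case False
        have "represented (supp (G (t n)))" by (rule represented_supp[OF G[OF t01[OF False]]])
        from represented_scale[OF this \<mu>0] show ?thesis unfolding bt_supp f_def s_def .
      qed
      have bt_nonneg: "0 \<le> supp (birkhoff_term G A t n) \<phi>" for \<phi> n
        unfolding bt_supp by (rule f0)
      have bt_tail: "\<exists>N. \<forall>\<phi> n. norm \<phi> \<le> 1 \<longrightarrow> (\<Sum>k\<in>{N..<n}. supp (birkhoff_term G A t k) \<phi>) \<le> e"
        if "0 < e" for e
        unfolding bt_supp by (rule tail[OF that])
      obtain S where S: "set_sums (birkhoff_term G A t) S" "\<forall>\<phi>. (\<lambda>n. supp (birkhoff_term G A t n) \<phi>) sums supp S \<phi>"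
        by (rule set_sums_of_uniform_tails[OF bt rep bt_nonneg bt_tail])
      have "hausdorff_distance \<Phi> S \<le> \<epsilon>"
      proof (rule hausdorff_le[OF \<Phi>b])
        show "S \<in> bounded_convex" using S(1) by (simp add: set_sums_def cwk_bounded_convex)
        fix \<phi> :: "'a \<Rightarrow>\<^sub>L real" assume \<phi>: "norm \<phi> \<le> 1"
        have f_sums: "(\<lambda>n. f \<phi> n) sums supp S \<phi>" using S(2)[rule_format, of \<phi>] unfolding bt_supp .
        have "(\<lambda>n. \<bar>(\<Sum>k<n. a \<phi> k) - (\<Sum>k<n. f \<phi> k)\<bar>) \<longlonglongrightarrow> \<bar>supp \<Phi> \<phi> - supp S \<phi>\<bar>"
          using a_sums[of \<phi>] f_sums unfolding sums_def by (intro tendsto_intros)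
        moreover have "\<bar>(\<Sum>k<n. a \<phi> k) - (\<Sum>k<n. f \<phi> k)\<bar> \<le> \<epsilon>" for n
        proof -
          have "\<bar>(\<Sum>k<n. a \<phi> k) - (\<Sum>k<n. f \<phi> k)\<bar> = \<bar>\<Sum>k<n. a \<phi> k - f \<phi> k\<bar>" by (simp add: sum_subtractf)
          also have "\<dots> \<le> (\<Sum>k<n. \<bar>a \<phi> k - f \<phi> k\<bar>)" by (rule sum_abs)
          also have "\<dots> = (\<Sum>k<n. \<bar>f \<phi> k - a \<phi> k\<bar>)" by (simp add: abs_minus_commute)
          also have "\<dots> \<le> \<epsilon>" using err[OF \<phi>, of "{..<n}" 0] by (simp add: C_def)
          finally show ?thesis .
        qed
        ultimately show "\<bar>supp \<Phi> \<phi> - supp S \<phi>\<bar> \<le> \<epsilon>" by (intro LIMSEQ_le_const2) blast+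
      qed
      with S(1) show ?thesis by blast
    qed
    with P(1) show ?thesis by blast
  qed
  have "has_birkhoff_integral G \<Phi>"
    unfolding has_birkhoff_integral_def
  proof (intro allI impI)
    fix \<epsilon> :: real assume e: "0 < \<epsilon>"
    then have "0 < \<epsilon> / 2" by simp
    from main[OF this] obtain P where P: "countable_partition P" and
      PA: "\<And>A t. countable_partition A \<Longrightarrow> finer A P \<Longrightarrow> tags_of A t \<Longrightarrow>
        \<exists>S. set_sums (birkhoff_term G A t) S \<and> hausdorff_distance \<Phi> S \<le> \<epsilon> / 2" by blast
    show "\<exists>P. countable_partition P \<and>
        (\<forall>A t. countable_partition A \<and> finer A P \<and> (\<forall>n. A n \<noteq> {} \<longrightarrow> t n \<in> A n) \<longrightarrow>
           unconditionally_convergent (birkhoff_term G A t) \<and>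
           (\<exists>S. set_sums (birkhoff_term G A t) S \<and> hausdorff_distance \<Phi> S < \<epsilon>))"
    proof (intro exI[of _ P] conjI allI impI P; elim conjE)
      fix A t assume A: "countable_partition A" "finer A P" and t: "\<forall>n. A n \<noteq> {} \<longrightarrow> t n \<in> A n"
      have "tags_of A t" using t by (simp add: tags_of_def)
      from PA[OF A this] obtain S where "set_sums (birkhoff_term G A t) S" "hausdorff_distance \<Phi> S \<le> \<epsilon> / 2" by blast
      then show "\<exists>S. set_sums (birkhoff_term G A t) S \<and> hausdorff_distance \<Phi> S < \<epsilon>"
        using e by (intro exI[of _ S]) simp
      show "unconditionally_convergent (birkhoff_term G A t)"
        unfolding unconditionally_convergent_def
      proof (intro allI impI)
        fix \<pi> :: "nat \<Rightarrow> nat" assume \<pi>: "bij \<pi>"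
        \<comment> \<open>A rearranged partition with rearranged tags again refines
          \<open>P\<close>, so convergence for all refinements already contains unconditional
          convergence.\<close>
        have "countable_partition (A \<circ> \<pi>)"
          unfolding countable_partition_def
        proof (intro conjI allI)
          show "(A \<circ> \<pi>) n \<in> sets lebesgue" for n using A(1) by (simp add: countable_partition_def)
          show "disjoint_family (A \<circ> \<pi>)"
            unfolding disjoint_family_on_def
          proof (intro ballI impI)
            fix m n :: nat assume "m \<noteq> n"
            then have "\<pi> m \<noteq> \<pi> n" using bij_is_inj[OF \<pi>] by (simp add: inj_eq)
            then show "(A \<circ> \<pi>) m \<inter> (A \<circ> \<pi>) n = {}"
              using A(1) by (simp add: countable_partition_def disjoint_family_on_def)
          qed
          show "(\<Union>n. (A \<circ> \<pi>) n) = {0..1}"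
          proof -
            have "(\<Union>n. (A \<circ> \<pi>) n) = \<Union> (A ` range \<pi>)" by auto
            also have "\<dots> = (\<Union>n. A n)" using bij_is_surj[OF \<pi>] by simp
            finally show ?thesis using A(1) by (simp add: countable_partition_def)
          qed
        qed
        moreover have "finer (A \<circ> \<pi>) P" using A(2) by (simp add: finer_def)
        moreover have "tags_of (A \<circ> \<pi>) (t \<circ> \<pi>)" using t by (simp add: tags_of_def)
        ultimately obtain S where "set_sums (birkhoff_term G (A \<circ> \<pi>) (t \<circ> \<pi>)) S" using PA by blast
        moreover have "birkhoff_term G (A \<circ> \<pi>) (t \<circ> \<pi>) = birkhoff_term G A t \<circ> \<pi>"
          by (rule ext) (simp add: birkhoff_term_def)
        ultimately show "\<exists>S. set_sums (birkhoff_term G A t \<circ> \<pi>) S" by auto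
      qed
    qed
  qed
  with \<Phi> show ?thesis unfolding birkhoff_integrable_def by blast
qed

theorem theorem4p2:
  fixes \<Gamma> :: "real \<Rightarrow> 'a::banach set"
  assumes "\<forall>t\<in>{0..1}. \<Gamma> t \<in> cwk"
  shows "(H_integrable \<Gamma> \<longleftrightarrow>
            H_selections \<Gamma> \<noteq> {} \<and>
            (\<forall>f\<in>H_selections \<Gamma>. birkhoff_integrable (translate_by \<Gamma> f)))
       \<and> (H_integrable \<Gamma> \<longleftrightarrow>
            (\<exists>f\<in>H_selections \<Gamma>. birkhoff_integrable (translate_by \<Gamma> f)))"
proof -
  have G: "\<Gamma> t \<in> cwk" if "t \<in> {0..1}" for t using assms that by blast
  \<comment> \<open>Subtracting a selection puts \<open>0\<close> into every set, as both comparison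
    theorems require. Each selection in \<open>H_selections \<Gamma>\<close> thus makes Birkhoff
    integrability of the translate equivalent to (i), and only the existence of a selection under
    (i) remains.\<close>
  have equiv: "birkhoff_integrable (translate_by \<Gamma> f) \<longleftrightarrow> H_integrable \<Gamma>" if f: "f \<in> H_selections \<Gamma>" for f
  proof -
    have cwk: "translate_by \<Gamma> f t \<in> cwk" if "t \<in> {0..1}" for t
      unfolding translate_by_def by (rule cwk_translation[OF G[OF that]])
    have zero: "0 \<in> translate_by \<Gamma> f t" if "t \<in> {0..1}" for t
    proof -
      have "f t \<in> \<Gamma> t" using f that by (simp add: H_selections_def)
      then show ?thesis unfolding translate_by_def by force
    qed
    have Hf: "H_integrable_fun f" using f by (simp add: H_selections_def)
    have "H_integrable (translate_by \<Gamma> f) \<longleftrightarrow> H_integrable \<Gamma>"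
      by (rule H_integrable_translate_iff[OF G Hf])
    moreover have "H_integrable (translate_by \<Gamma> f) \<Longrightarrow> birkhoff_integrable (translate_by \<Gamma> f)"
      by (rule H_imp_birkhoff_integrable[OF cwk zero])
    moreover have "birkhoff_integrable (translate_by \<Gamma> f) \<Longrightarrow> H_integrable (translate_by \<Gamma> f)"
      by (rule birkhoff_imp_H_integrable[OF cwk zero])
    ultimately show ?thesis by blast
  qed
  have "H_integrable \<Gamma> \<Longrightarrow> H_selections \<Gamma> \<noteq> {}" by (rule H_selections_nonempty[OF G])
  with equiv show ?thesis by blast
qed

end
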